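(* The quantum reading capacity of any environment-parametrized memory cell $\mathcal{E}_{\mathcal{X}}$ with environment states $\{\theta^x_E\}_{x\in\mathcal{X}}$ satisfies $\mathcal{C}(\mathcal{E}_{\mathcal{X}})\le\max_{p_X}I(X;E)_\theta$, where $\theta_{XE}=\sum_xp_X(x)|x\rangle\langle x|_X\otimes\theta^x_E$.
   Context: An environment-parametrized memory cell is a set of channels $\{\mathcal{E}^x_{A\to B}\}_{x\in\mathcal{X}}$ ($\mathcal{X}$ finite) with $\mathcal{E}^x_{A\to B}(\rho_A)=\mathcal{F}_{AE\to B}(\rho_A\otimes\theta^x_E)$ for a fixed channel $\mathcal{F}$ and states $\theta^x_E$. An $(n,R,\varepsilon)$ quantum reading protocol for a memory cell $\{\mathcal{N}^x\}$: messages $\mathcal{M}$ with $R=\frac1n\log_2|\mathcal{M}|$, encoding $m\mapsto x^n(m)\in\mathcal{X}^n$, adaptive strategy (initial state $\rho_{R_1A_1}$, interleaved channels $\mathcal{A}^i_{R_iB_i\to R_{i+1}A_{i+1}}$, final POVM $\{\Lambda^{\hat m}_{R_nB_n}\}$, the $i$-th call applying $\mathcal{N}^{x_i(m)}$ to $A_i$) with average success probability (uniform messages) at least $1-\varepsilon$. A rate $R$ is achievable if for all $\varepsilon\in(0,1)$, $\delta>0$ and all sufficiently large $n$ there is an $(n,R-\delta,\varepsilon)$ protocol; the quantum reading capacity $\mathcal{C}$ is the supremum of achievable rates. $I(X;E)$ is quantum mutual information. *)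

theory Defs
  imports "Jordan_Normal_Form.Char_Poly" "HOL-Computational_Algebra.Fundamental_Theorem_Algebra" "HOL-Library.Extended_Real"
begin

definition dag :: "complex mat \<Rightarrow> complex mat" where
  "dag A = mat (dim_col A) (dim_row A) (\<lambda>(i,j). cnj (A $$ (j,i)))"

definition tr :: "complex mat \<Rightarrow> complex" where
  "tr A = (\<Sum>i<dim_row A. A $$ (i,i))"

text \<open>Kronecker (tensor) product; index (a,b) of A (x) B is a * dim B + b.\<close>
definition kron :: "complex mat \<Rightarrow> complex mat \<Rightarrow> complex mat" where
  "kron A B = mat (dim_row A * dim_row B) (dim_col A * dim_col B)
     (\<lambda>(i,j). A $$ (i div dim_row B, j div dim_col B) * B $$ (i mod dim_row B, j mod dim_col B))"

definition msum :: "nat \<Rightarrow> nat \<Rightarrow> (nat \<Rightarrow> complex mat) \<Rightarrow> nat \<Rightarrow> complex mat" where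
  "msum r c f k = mat r c (\<lambda>(a,b). \<Sum>i<k. f i $$ (a,b))"

definition psd :: "nat \<Rightarrow> complex mat \<Rightarrow> bool" where
  "psd n A \<longleftrightarrow> A \<in> carrier_mat n n \<and> dag A = A \<and>
     (\<forall>v :: nat \<Rightarrow> complex. 0 \<le> Re (\<Sum>i<n. \<Sum>j<n. cnj (v i) * A $$ (i,j) * v j))"

definition density :: "nat \<Rightarrow> complex mat \<Rightarrow> bool" where
  "density n \<rho> \<longleftrightarrow> psd n \<rho> \<and> tr \<rho> = 1"

text \<open>Quantum channel (CPTP map) from a dA-dimensional to a dB-dimensional system,
  given by a Kraus representation (Choi--Kraus theorem).\<close>
definition is_channel :: "nat \<Rightarrow> nat \<Rightarrow> (complex mat \<Rightarrow> complex mat) \<Rightarrow> bool" where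
  "is_channel dA dB \<Phi> \<longleftrightarrow> (\<exists>k K. (\<forall>i<k. K i \<in> carrier_mat dB dA) \<and>
      msum dA dA (\<lambda>i. dag (K i) * K i) k = 1\<^sub>m dA \<and>
      (\<forall>\<rho> \<in> carrier_mat dA dA. \<Phi> \<rho> = msum dB dB (\<lambda>i. K i * \<rho> * dag (K i)) k))"

definition id_tensor :: "nat \<Rightarrow> nat \<Rightarrow> nat \<Rightarrow> (complex mat \<Rightarrow> complex mat) \<Rightarrow> complex mat \<Rightarrow> complex mat" where
  "id_tensor r dA dB \<Phi> M = mat (r * dB) (r * dB) (\<lambda>(i,j).
      \<Phi> (mat dA dA (\<lambda>(a,b). M $$ ((i div dB) * dA + a, (j div dB) * dA + b))) $$ (i mod dB, j mod dB))"

definition ptr_second :: "nat \<Rightarrow> nat \<Rightarrow> complex mat \<Rightarrow> complex mat" where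
  "ptr_second a b M = mat a a (\<lambda>(i,j). \<Sum>l<b. M $$ (i * b + l, j * b + l))"

definition ptr_first :: "nat \<Rightarrow> nat \<Rightarrow> complex mat \<Rightarrow> complex mat" where
  "ptr_first a b M = mat b b (\<lambda>(i,j). \<Sum>l<a. M $$ (l * b + i, l * b + j))"

text \<open>Von Neumann entropy (base 2): -Tr rho log rho = - sum over the eigenvalues (with multiplicity)
  of lambda log lambda; note 0 * log 2 0 = 0 in Isabelle.\<close>
definition vn_entropy :: "complex mat \<Rightarrow> real" where
  "vn_entropy \<rho> = - (\<Sum>e\<in>#proots (char_poly \<rho>). Re e * log 2 (Re e))"

definition mutual_info :: "nat \<Rightarrow> nat \<Rightarrow> complex mat \<Rightarrow> real" where
  "mutual_info a b \<rho> = vn_entropy (ptr_second a b \<rho>) + vn_entropy (ptr_first a b \<rho>) - vn_entropy \<rho>"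

definition proj :: "nat \<Rightarrow> nat \<Rightarrow> complex mat" where
  "proj k x = mat k k (\<lambda>(i,j). if i = x \<and> j = x then 1 else 0)"

definition cq_state :: "nat \<Rightarrow> nat \<Rightarrow> (nat \<Rightarrow> real) \<Rightarrow> (nat \<Rightarrow> complex mat) \<Rightarrow> complex mat" where
  "cq_state k dE p \<theta> = msum (k * dE) (k * dE) (\<lambda>x. complex_of_real (p x) \<cdot>\<^sub>m kron (proj k x) (\<theta> x)) k"

definition prob_dist :: "nat \<Rightarrow> (nat \<Rightarrow> real) \<Rightarrow> bool" where
  "prob_dist k p \<longleftrightarrow> (\<forall>x<k. 0 \<le> p x) \<and> (\<Sum>x<k. p x) = 1"

definition env_cell :: "(complex mat \<Rightarrow> complex mat) \<Rightarrow> (nat \<Rightarrow> complex mat) \<Rightarrow> nat \<Rightarrow> complex mat \<Rightarrow> complex mat" where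
  "env_cell F \<theta> x \<rho> = F (kron \<rho> (\<theta> x))"

text \<open>State on R_i A_i just before the i-th call (0-indexed); N i is the channel applied at call i,
  Ad i the interleaved channel R_i B_i -> R_(i+1) A_(i+1), r i = dim R_i.\<close>
fun proto_state :: "(nat \<Rightarrow> nat) \<Rightarrow> nat \<Rightarrow> nat \<Rightarrow> (nat \<Rightarrow> complex mat \<Rightarrow> complex mat)
    \<Rightarrow> (nat \<Rightarrow> complex mat \<Rightarrow> complex mat) \<Rightarrow> complex mat \<Rightarrow> nat \<Rightarrow> complex mat" where
  "proto_state r dA dB N Ad \<rho>0 0 = \<rho>0"
| "proto_state r dA dB N Ad \<rho>0 (Suc i) =
     Ad i (id_tensor (r i) dA dB (N i) (proto_state r dA dB N Ad \<rho>0 i))"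

text \<open>Final state on R_n B_n after the n-th call (n >= 1).\<close>
definition proto_output :: "(nat \<Rightarrow> nat) \<Rightarrow> nat \<Rightarrow> nat \<Rightarrow> (nat \<Rightarrow> complex mat \<Rightarrow> complex mat)
    \<Rightarrow> (nat \<Rightarrow> complex mat \<Rightarrow> complex mat) \<Rightarrow> complex mat \<Rightarrow> nat \<Rightarrow> complex mat" where
  "proto_output r dA dB N Ad \<rho>0 n =
     id_tensor (r (n - 1)) dA dB (N (n - 1)) (proto_state r dA dB N Ad \<rho>0 (n - 1))"

text \<open>Existence of an (n, log2(M)/n, eps) quantum reading protocol for the memory cell
  {Nc x}_(x<k), Nc x : A -> B, with message set {0..<M}.\<close>
definition reading_protocol ::
  "(nat \<Rightarrow> complex mat \<Rightarrow> complex mat) \<Rightarrow> nat \<Rightarrow> nat \<Rightarrow> nat \<Rightarrow> nat \<Rightarrow> nat \<Rightarrow> real \<Rightarrow> bool" where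
  "reading_protocol Nc k dA dB n M \<epsilon> \<longleftrightarrow> 1 \<le> M \<and>
    (\<exists>(enc :: nat \<Rightarrow> nat \<Rightarrow> nat) (r :: nat \<Rightarrow> nat) \<rho>0 Ad (\<Lambda> :: nat \<Rightarrow> complex mat).
       (\<forall>m<M. \<forall>i<n. enc m i < k) \<and>
       density (r 0 * dA) \<rho>0 \<and>
       (\<forall>i. Suc i < n \<longrightarrow> is_channel (r i * dB) (r (Suc i) * dA) (Ad i)) \<and>
       (\<forall>m<M. psd (r (n - 1) * dB) (\<Lambda> m)) \<and>
       msum (r (n - 1) * dB) (r (n - 1) * dB) \<Lambda> M = 1\<^sub>m (r (n - 1) * dB) \<and>
       (1 / real M) * (\<Sum>m<M. Re (tr (\<Lambda> m *
          proto_output r dA dB (\<lambda>i. Nc (enc m i)) Ad \<rho>0 n))) \<ge> 1 - \<epsilon>)"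

definition achievable_rate ::
  "(nat \<Rightarrow> complex mat \<Rightarrow> complex mat) \<Rightarrow> nat \<Rightarrow> nat \<Rightarrow> nat \<Rightarrow> real \<Rightarrow> bool" where
  "achievable_rate Nc k dA dB R \<longleftrightarrow>
    (\<forall>\<epsilon> \<delta>. 0 < \<epsilon> \<and> \<epsilon> < 1 \<and> 0 < \<delta> \<longrightarrow>
      (\<exists>n0. \<forall>n\<ge>n0. \<exists>M. log 2 (real M) / real n \<ge> R - \<delta> \<and>
         reading_protocol Nc k dA dB n M \<epsilon>))"

definition reading_capacity ::
  "(nat \<Rightarrow> complex mat \<Rightarrow> complex mat) \<Rightarrow> nat \<Rightarrow> nat \<Rightarrow> nat \<Rightarrow> ereal" where
  "reading_capacity Nc k dA dB = Sup {ereal R | R. achievable_rate Nc k dA dB R}"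

end

theory Submission
  imports Defs "Jordan_Normal_Form.Schur_Decomposition" "HOL-Real_Asymp.Real_Asymp"
begin

text \<open>Leaving the environment registers open turns a protocol into a fixed channel from those registers to
  the decoder, so the success probability for message \<open>m\<close> is a positive quadratic form \<open>B m\<close>, with
  \<open>\<Sum>m. B m = 1\<close>, evaluated on the product state \<open>\<theta> (x\<^sub>1) \<otimes> \<dots> \<otimes> \<theta> (x\<^sub>n)\<close> of its codeword. Group the
  codewords by their type \<open>p\<close>, of which there are only polynomially many, and compare every product state
  of a class with the \<open>n\<close>-th power of the average state \<open>\<sigma> = \<Sum>x. p x \<theta> x\<close>. Up to a Chebyshev error, uniform
  in \<open>p\<close> because \<open>t log\<^sup>2 t\<close> is bounded, only eigenvectors of the product state of weight at most
  \<open>2 powr (n (a + \<delta>))\<close> and eigenvectors of the power of \<open>\<sigma>\<close> of weight at least \<open>2 powr (n (b - \<delta>))\<close>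
  matter, where \<open>a = - \<Sum>x. p x H(\<theta> x)\<close> and \<open>b = - H(\<sigma>)\<close>. Hence the success probabilities in a class add up
  to at most \<open>2 \<cdot> 2 powr (n (a - b + 2 \<delta>))\<close> plus the error, and \<open>a - b\<close> is the mutual information for \<open>p\<close>.\<close>

section \<open>Spectral decomposition\<close>

text \<open>The product state of a codeword and the power of \<open>\<sigma>\<close> need not
  commute, so their typical sets live in different eigenbases. Each eigenvector of the product state
  is therefore expanded in the eigenbasis of the power of \<open>\<sigma>\<close> and cut at the
  typical set; positivity and the parallelogram law control the two pieces separately at the price
  of a factor 2. The piece outside is governed by measuring the product state in that eigenbasis.
  The outcome is a product distribution, so the classical Chebyshev inequality serves in both places
  and no quantum entropy inequality enters. Types matter because letter averages along a codeword
  then agree exactly with \<open>p\<close>: the mean of the logarithmic weight under the outcome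
  distribution is \<open>n b\<close> for every codeword, although its factors vary from position to
  position. The error \<open>12 d / ((ln 2)^2 n \<delta>^2)\<close> is three Chebyshev errors, one
  for the product state and two, by the parallelogram law, for the power of
  \<open>\<sigma>\<close>.\<close>

lemma dag_carrier [simp]: "A \<in> carrier_mat m n \<Longrightarrow> dag A \<in> carrier_mat n m"
  by (auto simp: dag_def)

lemma index_dag: "A \<in> carrier_mat m n \<Longrightarrow> i < n \<Longrightarrow> j < m \<Longrightarrow> dag A $$ (i,j) = cnj (A $$ (j,i))"
  by (auto simp: dag_def)

lemma index_mult_sum:
  "A \<in> carrier_mat m n \<Longrightarrow> B \<in> carrier_mat n k \<Longrightarrow> i < m \<Longrightarrow> j < k \<Longrightarrow>
    (A * B) $$ (i,j) = (\<Sum>l<n. A $$ (i,l) * B $$ (l,j))"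
  by (auto simp: scalar_prod_def atLeast0LessThan intro!: sum.cong)

lemma dag_dag [simp]: "dag (dag A) = A"
  by (rule eq_matI) (auto simp: dag_def)

lemma dag_mult:
  assumes "A \<in> carrier_mat m n" "B \<in> carrier_mat n k"
  shows "dag (A * B) = dag B * dag A"
proof (rule eq_matI)
  fix i j assume ij: "i < dim_row (dag B * dag A)" "j < dim_col (dag B * dag A)"
  then have i: "i < k" and j: "j < m" using assms by (auto simp: dag_def)
  have "dag (A * B) $$ (i,j) = cnj (\<Sum>l<n. A $$ (j,l) * B $$ (l,i))"
    using assms i j by (simp add: index_dag[of _ m k] index_mult_sum[of A m n B k] mult_carrier_mat del: index_mult_mat(1))
  also have "\<dots> = (\<Sum>l<n. dag B $$ (i,l) * dag A $$ (l,j))"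
    using assms i j by (auto simp: index_dag[of B n k] index_dag[of A m n] mult.commute intro!: sum.cong)
  also have "\<dots> = (dag B * dag A) $$ (i,j)"
    using assms i j by (simp add: index_mult_sum[of _ k n _ m])
  finally show "dag (A * B) $$ (i,j) = (dag B * dag A) $$ (i,j)" .
qed (use assms in \<open>auto simp: dag_def\<close>)

text \<open>Gram-Schmidt keeps the first vector of a completed basis and delivers orthogonal,
  nonzero, unnormalised vectors. Dividing by their lengths gives a unitary matrix, with
  \<open>c\<close> the reciprocal length of \<open>v\<close>.\<close>

lemma unitary_first_column:
  assumes v: "v \<in> carrier_vec n" and v0: "v \<noteq> 0\<^sub>v n"
  obtains U c where "U \<in> carrier_mat n n" "dag U * U = 1\<^sub>m n" "c \<noteq> 0"
    "\<And>i. i < n \<Longrightarrow> U $$ (i,0) = c * v $ i"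
proof -
  have n: "n \<noteq> 0" using v v0 by auto
  interpret cof_vec_space n "TYPE(complex)" .
  define b where "b = basis_completion v"
  from basis_completion[OF v v0, folded b_def]
  have dist_b: "distinct b" and indep: "\<not> lin_dep (set b)" and b: "set b \<subseteq> carrier_vec n"
    and hdb: "hd b = v" and len_b: "length b = n" by auto
  from hdb len_b n obtain vs where bv: "b = v # vs" by (cases b, auto)
  define ws where "ws = gram_schmidt n b"
  from gram_schmidt_result[OF b dist_b indep refl, folded ws_def]
  have ws: "set ws \<subseteq> carrier_vec n" "corthogonal ws" "length ws = n"
    by (auto simp: len_b)
  from gram_schmidt_hd[OF v, of vs, folded bv] have hdws: "hd ws = v" unfolding ws_def .
  have wsc: "ws ! j \<in> carrier_vec n" if "j < n" for j using ws that by auto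
  define N where "N j = sqrt (\<Sum>a<n. (cmod (ws ! j $ a))\<^sup>2)" for j
  define U where "U = mat n n (\<lambda>(i,j). ws ! j $ i / of_real (N j))"
  have U: "U \<in> carrier_mat n n" by (simp add: U_def)
  have ip: "ws ! i \<bullet>c ws ! j = (\<Sum>a<n. ws ! i $ a * cnj (ws ! j $ a))" if "i < n" "j < n" for i j
    using wsc[OF that(1)] wsc[OF that(2)] by (auto simp: scalar_prod_def atLeast0LessThan)
  have nn: "(\<Sum>a<n. ws ! j $ a * cnj (ws ! j $ a)) = of_real ((N j)\<^sup>2)" for j
    by (simp add: N_def sum_nonneg complex_norm_square of_real_sum del: of_real_power)
  have N0: "N j \<noteq> 0" if "j < n" for j
    using corthogonalD[OF ws(2), of j j] that ws(3) ip[OF that that] nn[of j] by auto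
  have orth: "dag U * U = 1\<^sub>m n"
  proof (rule eq_matI)
    fix i j assume "i < dim_row (1\<^sub>m n)" "j < dim_col (1\<^sub>m n)"
    then have i: "i < n" and j: "j < n" by auto
    have "(dag U * U) $$ (i,j) = (\<Sum>a<n. (ws ! j $ a * cnj (ws ! i $ a)) / of_real (N i * N j))"
      using i j unfolding index_mult_sum[OF dag_carrier[OF U] U i j]
      by (intro sum.cong refl) (simp add: index_dag[OF U], simp add: U_def mult.commute)
    also have "\<dots> = (ws ! j \<bullet>c ws ! i) / of_real (N i * N j)"
      by (simp add: ip[OF j i] sum_divide_distrib)
    also have "\<dots> = (if i = j then 1 else 0)"
    proof (cases "i = j")
      case True
      then show ?thesis using N0[OF i] ip[OF i i] nn[of i] by (simp add: power2_eq_square)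
    next
      case False
      then show ?thesis using corthogonalD[OF ws(2), of j i] i j ws(3) by auto
    qed
    finally show "(dag U * U) $$ (i,j) = 1\<^sub>m n $$ (i,j)" using i j by simp
  qed (use U in \<open>auto simp: dag_def\<close>)
  have "U $$ (i,0) = (1 / of_real (N 0)) * v $ i" if "i < n" for i
    using that n hdws ws(3) by (cases ws) (auto simp: U_def)
  moreover have "1 / of_real (N 0) \<noteq> (0::complex)" using N0[of 0] n by auto
  ultimately show ?thesis using that U orth by blast
qed

text \<open>Deflation: a unitary whose first column is an eigenvector makes the first column of the
  conjugated matrix vanish below the diagonal, and hermiticity does the same for the first row. What
  remains is a Hermitian block of size \<open>n\<close>.\<close>

lemma hermitian_diagonalisation:
  assumes "A \<in> carrier_mat n n" "dag A = A"
  shows "\<exists>U (l :: nat \<Rightarrow> real). U \<in> carrier_mat n n \<and> dag U * U = 1\<^sub>m n \<and>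
    A = U * mat n n (\<lambda>(i,j). if i = j then of_real (l i) else 0) * dag U"
  using assms
proof (induction n arbitrary: A)
  case 0
  then show ?case by (intro exI[of _ "1\<^sub>m 0"] exI[of _ "\<lambda>_. 0"]) (auto simp: dag_def)
next
  case (Suc n)
  note A = Suc.prems(1) and hA = Suc.prems(2)
  obtain as where as: "char_poly A = (\<Prod> a \<leftarrow> as. [:- a, 1:])" "length as = Suc n"
    using char_poly_factorized[OF A] by blast
  then obtain e es where "as = e # es" by (cases as) auto
  then have "poly (char_poly A) e = 0" using as by simp
  then obtain v where ev: "eigenvector A v e"
    using eigenvalue_root_char_poly[OF A] unfolding eigenvalue_def by blast
  then have v: "v \<in> carrier_vec (Suc n)" and v0: "v \<noteq> 0\<^sub>v (Suc n)" and Av: "A *\<^sub>v v = e \<cdot>\<^sub>v v"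
    using A by (auto simp: eigenvector_def)
  obtain U c where U: "U \<in> carrier_mat (Suc n) (Suc n)" and UU: "dag U * U = 1\<^sub>m (Suc n)"
    and c: "c \<noteq> 0" "\<And>i. i < Suc n \<Longrightarrow> U $$ (i,0) = c * v $ i"
    using unitary_first_column[OF v v0] by blast
  have dU: "dag U \<in> carrier_mat (Suc n) (Suc n)" using U by simp
  have UU': "U * dag U = 1\<^sub>m (Suc n)" using mat_mult_left_right_inverse[OF dU U UU] .
  define B where "B = dag U * A * U"
  have B: "B \<in> carrier_mat (Suc n) (Suc n)" unfolding B_def by (intro mult_carrier_mat) (use U A dU in auto)
  have dAU: "dag U * A \<in> carrier_mat (Suc n) (Suc n)" by (rule mult_carrier_mat[OF dU A])
  have hB: "dag B = B"
  proof -
    have "dag B = dag U * dag (dag U * A)" unfolding B_def by (rule dag_mult[OF dAU U])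
    also have "\<dots> = dag U * (A * U)" by (simp add: dag_mult[OF dU A] hA)
    also have "\<dots> = B" by (simp add: B_def assoc_mult_mat[OF dU A U])
    finally show ?thesis .
  qed
  have AUcol: "(A * U) $$ (i,0) = e * U $$ (i,0)" if i: "i < Suc n" for i
  proof -
    have "(A * U) $$ (i,0) = c * (\<Sum>l<Suc n. A $$ (i,l) * v $ l)"
      using i by (simp only: index_mult_sum[OF A U i zero_less_Suc] sum_distrib_left)
        (auto simp: c(2) intro!: sum.cong)
    also have "(\<Sum>l<Suc n. A $$ (i,l) * v $ l) = (A *\<^sub>v v) $ i"
      using i v A by (auto simp: scalar_prod_def atLeast0LessThan intro!: sum.cong)
    also have "\<dots> = e * v $ i" using Av v i by simp
    finally show ?thesis using c(2)[OF i] by simp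
  qed
  have Bcol: "B $$ (i,0) = (if i = 0 then e else 0)" if i: "i < Suc n" for i
  proof -
    have "B $$ (i,0) = (dag U * (A * U)) $$ (i,0)"
      using A U dU by (simp add: B_def assoc_mult_mat[of _ "Suc n" "Suc n" _ "Suc n" _ "Suc n"])
    also have "\<dots> = (\<Sum>l<Suc n. dag U $$ (i,l) * (A * U) $$ (l,0))"
      by (rule index_mult_sum[OF dU _ i]) (use A U in auto)
    also have "\<dots> = e * (\<Sum>l<Suc n. dag U $$ (i,l) * U $$ (l,0))"
      unfolding sum_distrib_left by (intro sum.cong refl) (simp add: AUcol)
    also have "(\<Sum>l<Suc n. dag U $$ (i,l) * U $$ (l,0)) = (dag U * U) $$ (i,0)"
      by (rule index_mult_sum[OF dU U i, symmetric]) simp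
    finally show ?thesis using i by (simp add: UU)
  qed
  have Brow: "B $$ (0,i) = (if i = 0 then e else 0)" if i: "i < Suc n" for i
  proof -
    have "B $$ (0,i) = cnj (B $$ (i,0))" using index_dag[OF B, of 0 i] hB i by simp
    then show ?thesis using Bcol[OF i] Bcol[of 0] by (cases "i = 0") simp_all
  qed
  have ereal: "e = of_real (Re e)"
    using index_dag[OF B, of 0 0] hB Bcol[of 0] by (simp add: complex_eq_iff)
  define B' where "B' = mat n n (\<lambda>(i,j). B $$ (Suc i, Suc j))"
  have B': "B' \<in> carrier_mat n n" by (simp add: B'_def)
  have hB': "dag B' = B'"
  proof (rule eq_matI)
    fix i j assume "i < dim_row B'" "j < dim_col B'"
    then have i: "i < n" and j: "j < n" using B' by auto
    have "B $$ (Suc i, Suc j) = dag B $$ (Suc i, Suc j)" by (simp add: hB)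
    then show "dag B' $$ (i,j) = B' $$ (i,j)"
      using i j by (simp add: index_dag[OF B']) (simp add: B'_def index_dag[OF B])
  qed (auto simp: dag_def B'_def)
  obtain V l where V: "V \<in> carrier_mat n n" and VV: "dag V * V = 1\<^sub>m n"
    and BV: "B' = V * mat n n (\<lambda>(i,j). if i = j then of_real (l i) else 0) * dag V"
    using Suc.IH[OF B' hB'] by blast
  define W where "W = mat (Suc n) (Suc n) (\<lambda>(i,j). if i = 0 \<or> j = 0 then (if i = j then 1 else 0) else V $$ (i-1,j-1))"
  define l' where "l' i = (case i of 0 \<Rightarrow> Re e | Suc k \<Rightarrow> l k)" for i
  define D where "D = mat (Suc n) (Suc n) (\<lambda>(i,j). if i = j then complex_of_real (l' i) else 0)"
  have W: "W \<in> carrier_mat (Suc n) (Suc n)" and D: "D \<in> carrier_mat (Suc n) (Suc n)"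
    by (auto simp: W_def D_def)
  have dW: "dag W \<in> carrier_mat (Suc n) (Suc n)" using W by simp
  have WW: "dag W * W = 1\<^sub>m (Suc n)"
  proof (rule eq_matI)
    fix i j assume "i < dim_row (1\<^sub>m (Suc n))" "j < dim_col (1\<^sub>m (Suc n))"
    then have i: "i < Suc n" and j: "j < Suc n" by auto
    have V1: "(\<Sum>a<n. cnj (V $$ (a, x)) * V $$ (a, y)) = (if x = y then 1 else 0)" if "x < n" "y < n" for x y
      using index_mult_sum[OF dag_carrier[OF V] V that] that by (simp add: VV index_dag[OF V])
    show "(dag W * W) $$ (i,j) = 1\<^sub>m (Suc n) $$ (i,j)"
    proof -
      have "(dag W * W) $$ (i,j) = (\<Sum>a<Suc n. cnj (W $$ (a,i)) * W $$ (a,j))"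
        unfolding index_mult_sum[OF dW W i j] by (intro sum.cong refl) (simp add: index_dag[OF W] i)
      then show ?thesis
        using i j V1 by (cases i; cases j) (auto simp: W_def sum.lessThan_Suc_shift simp del: sum.lessThan_Suc)
    qed
  qed (use W in \<open>auto simp: dag_def\<close>)
  have BW: "B = W * D * dag W"
  proof (rule eq_matI)
    fix i j assume "i < dim_row (W * D * dag W)" "j < dim_col (W * D * dag W)"
    then have i: "i < Suc n" and j: "j < Suc n" using W by (auto simp: dag_def)
    have WD: "(W * D) $$ (i,b) = W $$ (i,b) * of_real (l' b)" if "b < Suc n" for b
      using i that by (simp only: index_mult_sum[OF W D i that]) (simp add: D_def if_distrib[of "\<lambda>x. _ * x"] sum.delta cong: if_cong del: sum.lessThan_Suc)
    have e1: "(W * D * dag W) $$ (i,j) = (\<Sum>b<Suc n. W $$ (i,b) * of_real (l' b) * cnj (W $$ (j,b)))"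
      unfolding index_mult_sum[OF mult_carrier_mat[OF W D] dW i j]
      by (intro sum.cong refl) (simp add: WD index_dag[OF W] j)
    have B2: "B' $$ (x,y) = (\<Sum>b<n. V $$ (x,b) * of_real (l b) * cnj (V $$ (y,b)))" if x: "x < n" and y: "y < n" for x y
    proof -
      let ?D = "mat n n (\<lambda>(i,j). if i = j then complex_of_real (l i) else 0)"
      have Dc: "?D \<in> carrier_mat n n" by simp
      have VD: "(V * ?D) $$ (x,b) = V $$ (x,b) * of_real (l b)" if "b < n" for b
        using x that by (simp only: index_mult_sum[OF V Dc x that]) (simp add: if_distrib[of "\<lambda>x. _ * x"] sum.delta cong: if_cong)
      show ?thesis unfolding BV
        unfolding index_mult_sum[OF mult_carrier_mat[OF V Dc] dag_carrier[OF V] x y]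
        by (intro sum.cong refl) (simp add: VD index_dag[OF V] y)
    qed
    show "B $$ (i,j) = (W * D * dag W) $$ (i,j)"
    proof (cases i)
      case 0
      then show ?thesis unfolding e1 using j Brow[OF j] ereal
        by (cases j) (auto simp: W_def l'_def sum.lessThan_Suc_shift simp del: sum.lessThan_Suc)
    next
      case (Suc x)
      show ?thesis
      proof (cases j)
        case 0
        then show ?thesis unfolding e1 using i Suc Bcol[OF i]
          by (auto simp: W_def l'_def sum.lessThan_Suc_shift simp del: sum.lessThan_Suc)
      next
        case (Suc y)
        then show ?thesis unfolding e1 using i j \<open>i = Suc x\<close> B2[of x y]
          by (auto simp: W_def l'_def B'_def sum.lessThan_Suc_shift simp del: sum.lessThan_Suc)
      qed
    qed
  qed (use W B in \<open>auto simp: dag_def\<close>)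
  have mm: "X * Y \<in> carrier_mat (Suc n) (Suc n)"
    if "X \<in> carrier_mat (Suc n) (Suc n)" "Y \<in> carrier_mat (Suc n) (Suc n)" for X Y :: "complex mat"
    using mult_carrier_mat[OF that] .
  have UW: "U * W \<in> carrier_mat (Suc n) (Suc n)" using U W by simp
  note as = assoc_mult_mat[of _ "Suc n" "Suc n" _ "Suc n" _ "Suc n"]
  have un: "dag (U * W) * (U * W) = 1\<^sub>m (Suc n)"
  proof -
    have "dag (U * W) * (U * W) = dag W * ((dag U * U) * W)"
      using U W dU dW by (simp add: dag_mult[OF U W] as mm)
    then show ?thesis using W by (simp add: UU WW)
  qed
  have "A = (U * dag U) * A * (U * dag U)" using A by (simp add: UU')
  also have "\<dots> = U * B * dag U" using A U dU by (simp add: B_def as mm)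
  also have "\<dots> = (U * W) * D * dag (U * W)"
    unfolding BW using U W D dU dW by (simp add: dag_mult[OF U W] as mm)
  finally show ?case using UW un unfolding D_def by blast
qed

text \<open>Eigenvectors are plain functions, \<open>u j a\<close> being component \<open>a\<close>
  of eigenvector \<open>j\<close>, so that everything later is a manipulation of finite sums and
  extends to tuples of indices.\<close>

definition spectral_decomp :: "nat \<Rightarrow> complex mat \<Rightarrow> (nat \<Rightarrow> nat \<Rightarrow> complex) \<Rightarrow> (nat \<Rightarrow> real) \<Rightarrow> bool" where
  "spectral_decomp n A u l \<longleftrightarrow> A \<in> carrier_mat n n \<and>
     (\<forall>i<n. \<forall>j<n. (\<Sum>a<n. cnj (u i a) * u j a) = (if i = j then 1 else 0)) \<and>
     (\<forall>a<n. \<forall>b<n. A $$ (a,b) = (\<Sum>j<n. of_real (l j) * u j a * cnj (u j b)))"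

lemma hermitian_spectral_decomp:
  assumes "A \<in> carrier_mat n n" "dag A = A"
  obtains u l where "spectral_decomp n A u l"
proof -
  obtain U and l :: "nat \<Rightarrow> real" where U: "U \<in> carrier_mat n n" and UU: "dag U * U = 1\<^sub>m n"
    and AU: "A = U * mat n n (\<lambda>(i,j). if i = j then of_real (l i) else 0) * dag U"
    using hermitian_diagonalisation[OF assms] by blast
  let ?D = "mat n n (\<lambda>(i,j). if i = j then complex_of_real (l i) else 0)"
  have Dc: "?D \<in> carrier_mat n n" by simp
  have 1: "(\<Sum>a<n. cnj (U $$ (a,i)) * U $$ (a,j)) = (if i = j then 1 else 0)" if "i < n" "j < n" for i j
    using index_mult_sum[OF dag_carrier[OF U] U that] that by (simp add: UU index_dag[OF U])
  have 2: "A $$ (a,b) = (\<Sum>j<n. of_real (l j) * U $$ (a,j) * cnj (U $$ (b,j)))" if a: "a < n" and b: "b < n" for a b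
  proof -
    have VD: "(U * ?D) $$ (a,c) = U $$ (a,c) * of_real (l c)" if "c < n" for c
      using a that by (simp only: index_mult_sum[OF U Dc a that]) (simp add: if_distrib[of "\<lambda>x. _ * x"] sum.delta cong: if_cong)
    show ?thesis unfolding AU
      unfolding index_mult_sum[OF mult_carrier_mat[OF U Dc] dag_carrier[OF U] a b]
      by (intro sum.cong refl) (simp add: VD index_dag[OF U] b)
  qed
  have "spectral_decomp n A (\<lambda>j a. U $$ (a,j)) l"
    unfolding spectral_decomp_def using assms(1) 1 2 by auto
  then show ?thesis using that by blast
qed

text \<open>A left inverse of a square matrix is also a right inverse, so \<open>n\<close>
  orthonormal vectors in dimension \<open>n\<close> resolve the identity.\<close>

lemma spectral_decomp_complete:
  assumes "spectral_decomp n A u l" "a < n" "b < n"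
  shows "(\<Sum>j<n. u j a * cnj (u j b)) = (if a = b then 1 else 0)"
proof -
  define U where "U = mat n n (\<lambda>(a,j). u j a)"
  have U: "U \<in> carrier_mat n n" by (simp add: U_def)
  have "dag U * U = 1\<^sub>m n"
  proof (rule eq_matI)
    fix i j assume "i < dim_row (1\<^sub>m n)" "j < dim_col (1\<^sub>m n)"
    then show "(dag U * U) $$ (i,j) = 1\<^sub>m n $$ (i,j)"
      using assms(1) by (simp add: index_mult_sum[OF dag_carrier[OF U] U] index_dag[OF U])
        (simp add: U_def spectral_decomp_def)
  qed (auto simp: dag_def U_def)
  then have "U * dag U = 1\<^sub>m n"
    using mat_mult_left_right_inverse[OF dag_carrier[OF U] U] by simp
  then have "(U * dag U) $$ (a,b) = (if a = b then 1 else 0)" using assms by simp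
  moreover have "(U * dag U) $$ (a,b) = (\<Sum>j<n. u j a * cnj (u j b))"
    unfolding index_mult_sum[OF U dag_carrier[OF U] assms(2,3)]
    using assms(2,3) by (intro sum.cong refl) (simp add: index_dag[OF U], simp add: U_def)
  ultimately show ?thesis by simp
qed

text \<open>Unitary similarity preserves the characteristic polynomial, whose multiset of roots is
  therefore the family \<open>l\<close> with multiplicities, whichever eigenbasis was
  chosen.\<close>

lemma vn_entropy_spectral_decomp:
  assumes "spectral_decomp n A u l"
  shows "vn_entropy A = - (\<Sum>j<n. l j * log 2 (l j))"
proof -
  define U where "U = mat n n (\<lambda>(a,j). u j a)"
  define D where "D = mat n n (\<lambda>(i,j). if i = j then complex_of_real (l i) else 0)"
  have A: "A \<in> carrier_mat n n" using assms by (simp add: spectral_decomp_def)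
  have U: "U \<in> carrier_mat n n" and D: "D \<in> carrier_mat n n" by (simp_all add: U_def D_def)
  have UU: "dag U * U = 1\<^sub>m n"
  proof (rule eq_matI)
    fix i j assume "i < dim_row (1\<^sub>m n)" "j < dim_col (1\<^sub>m n)"
    then show "(dag U * U) $$ (i,j) = 1\<^sub>m n $$ (i,j)"
      using assms(1) by (simp add: index_mult_sum[OF dag_carrier[OF U] U] index_dag[OF U])
        (simp add: U_def spectral_decomp_def)
  qed (auto simp: dag_def U_def)
  have UU': "U * dag U = 1\<^sub>m n" using mat_mult_left_right_inverse[OF dag_carrier[OF U] U UU] .
  have "A = U * D * dag U"
  proof (rule eq_matI)
    fix a b assume "a < dim_row (U * D * dag U)" "b < dim_col (U * D * dag U)"
    then have a: "a < n" and b: "b < n" using U by (auto simp: dag_def)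
    have VD: "(U * D) $$ (a,c) = U $$ (a,c) * of_real (l c)" if "c < n" for c
      using a that by (simp only: index_mult_sum[OF U D a that]) (simp add: D_def if_distrib[of "\<lambda>x. _ * x"] sum.delta cong: if_cong)
    show "A $$ (a,b) = (U * D * dag U) $$ (a,b)"
      unfolding index_mult_sum[OF mult_carrier_mat[OF U D] dag_carrier[OF U] a b]
      using assms a b
      by (simp add: VD index_dag[OF U] spectral_decomp_def) (simp add: U_def mult_ac)
  qed (use A U in \<open>auto simp: dag_def\<close>)
  then have "similar_mat A D"
    using similar_mat_witI[OF UU' UU _ A D U dag_carrier[OF U]] unfolding similar_mat_def by blast
  then have "char_poly A = char_poly D" by (rule char_poly_similar)
  also have "\<dots> = (\<Prod> a \<leftarrow> diag_mat D. [:- a, 1:])"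
    by (rule char_poly_upper_triangular[OF D]) (auto simp: D_def)
  also have "diag_mat D = map (\<lambda>i. complex_of_real (l i)) [0..<n]"
    by (auto simp: diag_mat_def D_def)
  finally have "char_poly A = (\<Prod>i\<leftarrow>[0..<n]. [:- complex_of_real (l i), 1:])" by (simp add: comp_def)
  also have "\<dots> = (\<Prod>i\<in>{..<n}. [:- complex_of_real (l i), 1:])"
    using prod.distinct_set_conv_list[of "[0..<n]" "\<lambda>i. [:- complex_of_real (l i), 1:]"]
    by (simp only: set_upt distinct_upt atLeast0LessThan)
  finally have "proots (char_poly A) = (\<Sum>i<n. {#complex_of_real (l i)#})"
    by (simp add: proots_prod)
  also have "\<dots> = image_mset (\<lambda>i. complex_of_real (l i)) (mset_set {..<n})"
    by (induction n) (simp_all add: lessThan_Suc)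
  finally show ?thesis
    by (simp add: vn_entropy_def sum_unfold_sum_mset image_mset.compositionality comp_def)
qed

section \<open>Mutual information of classical-quantum states\<close>

lemma sum_prod_index:
  fixes f :: "nat \<Rightarrow> 'a::comm_monoid_add"
  shows "(\<Sum>i<k*d. f i) = (\<Sum>x<k. \<Sum>j<d. f (x * d + j))"
proof (induction k)
  case (Suc k)
  have "(\<Sum>i<Suc k * d. f i) = (\<Sum>i<k*d. f i) + (\<Sum>i\<in>{k*d..<k*d+d}. f i)"
    using sum.atLeastLessThan_concat[of 0 "k*d" "k*d+d" f] by (simp add: atLeast0LessThan add.commute)
  also have "(\<Sum>i\<in>{k*d..<k*d+d}. f i) = (\<Sum>j<d. f (k*d+j))"
    using sum.shift_bounds_nat_ivl[of f 0 "k*d" d] by (simp add: atLeast0LessThan add.commute)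
  finally show ?case using Suc by simp
qed simp

lemma prod_index_less: "x < k \<Longrightarrow> j < d \<Longrightarrow> x * d + j < k * (d::nat)"
  by (metis add.commute add_mult_distrib less_le_trans mult_le_mono1 nat_add_left_cancel_less
      Suc_leI mult_Suc)

lemma prod_index_eq_iff:
  assumes "a < d" "b < (d::nat)"
  shows "x * d + a = y * d + b \<longleftrightarrow> x = y \<and> a = b"
proof
  assume eq: "x * d + a = y * d + b"
  then have "(x * d + a) div d = (y * d + b) div d" by simp
  then have "x = y" using assms by simp
  then show "x = y \<and> a = b" using eq by simp
qed simp

section \<open>Quadratic forms, eigenvalues and trace\<close>

lemma quadratic_form_spectral:
  assumes "spectral_decomp n A u l"
  shows "(\<Sum>a<n. \<Sum>b<n. cnj (w a) * A $$ (a,b) * w b)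
    = of_real (\<Sum>j<n. l j * (cmod (\<Sum>b<n. cnj (u j b) * w b))\<^sup>2)"
proof -
  have "(\<Sum>a<n. \<Sum>b<n. cnj (w a) * A $$ (a,b) * w b)
      = (\<Sum>a<n. \<Sum>b<n. \<Sum>j<n. of_real (l j) * ((cnj (u j b) * w b) * cnj (cnj (u j a) * w a)))"
    using assms by (simp add: spectral_decomp_def sum_distrib_left sum_distrib_right mult_ac)
  also have "\<dots> = (\<Sum>a<n. \<Sum>j<n. \<Sum>b<n. of_real (l j) * ((cnj (u j b) * w b) * cnj (cnj (u j a) * w a)))"
    by (intro sum.cong refl sum.swap)
  also have "\<dots> = (\<Sum>j<n. \<Sum>a<n. \<Sum>b<n. of_real (l j) * ((cnj (u j b) * w b) * cnj (cnj (u j a) * w a)))"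
    by (rule sum.swap)
  also have "\<dots> = (\<Sum>j<n. of_real (l j) * ((\<Sum>b<n. cnj (u j b) * w b) * cnj (\<Sum>a<n. cnj (u j a) * w a)))"
    unfolding cnj_sum sum_product unfolding sum_distrib_left
    by (rule sum.cong[OF refl], rule sum.swap)
  finally show ?thesis by (simp only: of_real_sum of_real_mult complex_norm_square)
qed

lemma eigenvalue_quadratic_form:
  assumes "spectral_decomp n A u l" "i < n"
  shows "(\<Sum>a<n. \<Sum>b<n. cnj (u i a) * A $$ (a,b) * u i b) = of_real (l i)"
proof -
  have "(\<Sum>j<n. l j * (cmod (\<Sum>b<n. cnj (u j b) * u i b))\<^sup>2) = (\<Sum>j<n. if j = i then l j else 0)"
    using assms by (intro sum.cong refl) (simp add: spectral_decomp_def)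
  then show ?thesis unfolding quadratic_form_spectral[OF assms(1)] using assms(2) by simp
qed

lemma eigenvalue_nonneg:
  assumes "spectral_decomp n A u l" "psd n A" "i < n"
  shows "0 \<le> l i"
proof -
  have "0 \<le> Re (\<Sum>a<n. \<Sum>b<n. cnj (u i a) * A $$ (a,b) * u i b)" using assms(2) unfolding psd_def by blast
  then show ?thesis unfolding eigenvalue_quadratic_form[OF assms(1,3)] by simp
qed

lemma sum_eigenvalues:
  assumes "spectral_decomp n A u l"
  shows "tr A = of_real (\<Sum>j<n. l j)"
proof -
  have "tr A = (\<Sum>a<n. \<Sum>j<n. of_real (l j) * (cnj (u j a) * u j a))"
    using assms by (auto simp: tr_def spectral_decomp_def mult_ac intro!: sum.cong)
  also have "\<dots> = (\<Sum>j<n. of_real (l j) * (\<Sum>a<n. cnj (u j a) * u j a))"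
    unfolding sum_distrib_left by (rule sum.swap)
  also have "\<dots> = (\<Sum>j<n. of_real (l j))"
    using assms by (intro sum.cong refl) (simp add: spectral_decomp_def)
  finally show ?thesis by simp
qed

lemma density_eigenvalues:
  assumes "spectral_decomp n A u l" "density n A"
  shows "j < n \<Longrightarrow> 0 \<le> l j" "(\<Sum>j<n. l j) = 1"
proof -
  show "j < n \<Longrightarrow> 0 \<le> l j" using eigenvalue_nonneg[OF assms(1)] assms(2) by (simp add: density_def)
  have "complex_of_real (\<Sum>j<n. l j) = 1"
    using sum_eigenvalues[OF assms(1)] assms(2) by (simp add: density_def)
  then show "(\<Sum>j<n. l j) = 1" using of_real_eq_1_iff by blast
qed

section \<open>Average state and entropies of the classical-quantum state\<close>

definition average_state :: "nat \<Rightarrow> nat \<Rightarrow> (nat \<Rightarrow> real) \<Rightarrow> (nat \<Rightarrow> complex mat) \<Rightarrow> complex mat" where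
  "average_state k d p \<theta> = mat d d (\<lambda>(a,b). \<Sum>x<k. of_real (p x) * \<theta> x $$ (a,b))"

lemma density_average_state:
  assumes p: "prob_dist k p" and \<theta>: "\<forall>x<k. density d (\<theta> x)"
  shows "density d (average_state k d p \<theta>)"
proof -
  have c: "average_state k d p \<theta> \<in> carrier_mat d d" by (simp add: average_state_def)
  have \<theta>c: "\<theta> x \<in> carrier_mat d d" if "x < k" for x using \<theta> that by (simp add: density_def psd_def)
  have h: "cnj (\<theta> x $$ (b,a)) = \<theta> x $$ (a,b)" if "x < k" "a < d" "b < d" for x a b
    using index_dag[OF \<theta>c[OF that(1)] that(2,3)] \<theta> that by (simp add: density_def psd_def)
  have "dag (average_state k d p \<theta>) = average_state k d p \<theta>"
  proof (rule eq_matI)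
    fix a b assume "a < dim_row (average_state k d p \<theta>)" "b < dim_col (average_state k d p \<theta>)"
    then have ab: "a < d" "b < d" using c by auto
    show "dag (average_state k d p \<theta>) $$ (a,b) = average_state k d p \<theta> $$ (a,b)"
      unfolding index_dag[OF c ab] using ab h by (simp add: average_state_def)
  qed (auto simp: dag_def average_state_def)
  moreover have "0 \<le> Re (\<Sum>i<d. \<Sum>j<d. cnj (w i) * average_state k d p \<theta> $$ (i,j) * w j)" for w
  proof -
    have "(\<Sum>i<d. \<Sum>j<d. cnj (w i) * average_state k d p \<theta> $$ (i,j) * w j)
      = (\<Sum>i<d. \<Sum>j<d. \<Sum>x<k. of_real (p x) * (cnj (w i) * \<theta> x $$ (i,j) * w j))"
      by (intro sum.cong refl) (simp add: average_state_def sum_distrib_left sum_distrib_right mult_ac)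
    also have "\<dots> = (\<Sum>i<d. \<Sum>x<k. \<Sum>j<d. of_real (p x) * (cnj (w i) * \<theta> x $$ (i,j) * w j))"
      by (intro sum.cong refl sum.swap)
    also have "\<dots> = (\<Sum>x<k. of_real (p x) * (\<Sum>i<d. \<Sum>j<d. cnj (w i) * \<theta> x $$ (i,j) * w j))"
      unfolding sum_distrib_left by (rule sum.swap)
    finally have "Re (\<Sum>i<d. \<Sum>j<d. cnj (w i) * average_state k d p \<theta> $$ (i,j) * w j)
      = (\<Sum>x<k. p x * Re (\<Sum>i<d. \<Sum>j<d. cnj (w i) * \<theta> x $$ (i,j) * w j))" by simp
    also have "\<dots> \<ge> 0"
      using p \<theta> by (intro sum_nonneg mult_nonneg_nonneg) (auto simp: prob_dist_def density_def psd_def)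
    finally show ?thesis .
  qed
  moreover have "tr (average_state k d p \<theta>) = 1"
  proof -
    have "tr (average_state k d p \<theta>) = (\<Sum>x<k. of_real (p x) * (\<Sum>a<d. \<theta> x $$ (a,a)))"
      unfolding tr_def sum_distrib_left by (subst sum.swap) (simp add: average_state_def)
    also have "\<dots> = (\<Sum>x<k. of_real (p x))"
    proof (intro sum.cong refl)
      fix x assume "x \<in> {..<k}"
      then have "(\<Sum>a<d. \<theta> x $$ (a,a)) = 1" using \<theta> \<theta>c[of x] by (auto simp: density_def tr_def)
      then show "of_real (p x) * (\<Sum>a<d. \<theta> x $$ (a,a)) = complex_of_real (p x)" by simp
    qed
    also have "\<dots> = of_real (\<Sum>x<k. p x)" by simp
    also have "\<dots> = 1" using p by (simp add: prob_dist_def)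
    finally show ?thesis .
  qed
  ultimately show ?thesis using c by (simp add: density_def psd_def)
qed

lemma index_cq_state:
  assumes "\<forall>x<k. \<theta> x \<in> carrier_mat d d" "x < k" "y < k" "a < d" "b < d"
  shows "cq_state k d p \<theta> $$ (x * d + a, y * d + b) = (if x = y then of_real (p x) * \<theta> x $$ (a,b) else 0)"
proof -
  have "cq_state k d p \<theta> $$ (x * d + a, y * d + b)
     = (\<Sum>z<k. (of_real (p z) \<cdot>\<^sub>m kron (proj k z) (\<theta> z)) $$ (x * d + a, y * d + b))"
    using assms prod_index_less[of x k a d] prod_index_less[of y k b d] by (simp add: cq_state_def msum_def)
  also have "\<dots> = (\<Sum>z<k. if z = x then (if x = y then of_real (p x) * \<theta> x $$ (a,b) else 0) else 0)"
  proof (intro sum.cong refl)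
    fix z assume "z \<in> {..<k}"
    then have z: "z < k" and zc: "\<theta> z \<in> carrier_mat d d" using assms by auto
    have "dim_row (\<theta> z) = d" "dim_col (\<theta> z) = d" using zc by auto
    then show "(of_real (p z) \<cdot>\<^sub>m kron (proj k z) (\<theta> z)) $$ (x * d + a, y * d + b)
      = (if z = x then (if x = y then of_real (p x) * \<theta> x $$ (a,b) else 0) else 0)"
      using assms prod_index_less[of x k a d] prod_index_less[of y k b d]
      by (simp add: kron_def proj_def)
  qed
  finally show ?thesis using assms(2) by simp
qed

text \<open>The state is block diagonal with blocks \<open>p x\<close> times
  \<open>\<theta> x\<close>, so its eigenvalues are the products \<open>p x * l x j\<close>. Its
  entropy splits into the entropy of \<open>p\<close> and the averaged entropies of the blocks, and
  the former cancels against the marginal on \<open>X\<close>.\<close>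

lemma mutual_info_cq_state:
  assumes p: "prob_dist k p" and \<theta>: "\<forall>x<k. density d (\<theta> x)"
    and u: "\<And>x. x < k \<Longrightarrow> spectral_decomp d (\<theta> x) (u x) (l x)"
    and v: "spectral_decomp d (average_state k d p \<theta>) v s"
  shows "mutual_info k d (cq_state k d p \<theta>)
    = (\<Sum>x<k. p x * (\<Sum>j<d. l x j * log 2 (l x j))) - (\<Sum>j<d. s j * log 2 (s j))"
proof -
  have \<theta>c: "\<forall>x<k. \<theta> x \<in> carrier_mat d d" using \<theta> by (simp add: density_def psd_def)
  have p0: "0 \<le> p x" if "x < k" for x using p that by (simp add: prob_dist_def)
  let ?M = "cq_state k d p \<theta>"
  have Mc: "?M \<in> carrier_mat (k*d) (k*d)" by (simp add: cq_state_def msum_def)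
  note idx = index_cq_state[OF \<theta>c]
  have tr1: "(\<Sum>a<d. \<theta> x $$ (a,a)) = 1" if "x < k" for x
    using \<theta> \<theta>c that by (auto simp: density_def tr_def)
  have "spectral_decomp k (ptr_second k d ?M) (\<lambda>i a. if i = a then 1 else 0) p"
    unfolding spectral_decomp_def
  proof (intro conjI allI impI)
    fix a b assume ab: "a < k" "b < k"
    have "ptr_second k d ?M $$ (a,b) = (\<Sum>l<d. if a = b then of_real (p a) * \<theta> a $$ (l,l) else 0)"
      using ab by (simp add: ptr_second_def idx)
    also have "\<dots> = (if a = b then of_real (p a) else 0)"
      using tr1[OF ab(1)] by (cases "a = b") (simp_all flip: sum_distrib_left)
    also have "\<dots> = (\<Sum>j<k. if j = a then of_real (p a) * (if a = b then 1 else 0) else 0)"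
      using ab by simp
    also have "\<dots> = (\<Sum>j<k. of_real (p j) * (if j = a then 1 else 0) * cnj (if j = b then 1 else 0))"
      by (intro sum.cong) auto
    finally show "ptr_second k d ?M $$ (a,b) = (\<Sum>j<k. of_real (p j) * (if j = a then 1 else 0) * cnj (if j = b then 1 else 0))" .
  next
    fix i j assume "i < k" "j < k"
    have "(\<Sum>a<k. cnj (if i = a then 1 else 0) * (if j = a then 1 else 0)) = (\<Sum>a<k. if a = i then (if i = j then 1 else 0) else 0 :: complex)"
      by (intro sum.cong) auto
    then show "(\<Sum>a<k. cnj (if i = a then 1 else 0) * (if j = a then 1 else 0)) = (if i = j then 1 else 0 :: complex)"
      using \<open>i < k\<close> by simp
  qed (simp add: ptr_second_def)
  then have e1: "vn_entropy (ptr_second k d ?M) = - (\<Sum>x<k. p x * log 2 (p x))"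
    by (rule vn_entropy_spectral_decomp)
  have "ptr_first k d ?M = average_state k d p \<theta>"
    by (rule eq_matI) (auto simp: ptr_first_def average_state_def idx)
  then have e2: "vn_entropy (ptr_first k d ?M) = - (\<Sum>j<d. s j * log 2 (s j))"
    using vn_entropy_spectral_decomp[OF v] by simp
  \<comment> \<open>The index \<open>i\<close> encodes the pair (\<open>i div d\<close>,
    \<open>i mod d\<close>): a block and an eigenvector supported in that block.\<close>
  define U where "U i a = (if a div d = i div d then u (i div d) (i mod d) (a mod d) else 0)" for i a :: nat
  define L where "L i = p (i div d) * l (i div d) (i mod d)" for i :: nat
  have split: "\<exists>x j. i = x * d + j \<and> x < k \<and> j < d" if "i < k * d" for i
  proof -
    have "0 < d" using that by (cases d) auto
    then show ?thesis using less_mult_imp_div_less[OF that]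
      by (intro exI[of _ "i div d"] exI[of _ "i mod d"]) simp
  qed
  have "spectral_decomp (k*d) ?M U L"
    unfolding spectral_decomp_def
  proof (intro conjI allI impI)
    fix i j assume "i < k*d" "j < k*d"
    then obtain x a y b where ij: "i = x * d + a" "x < k" "a < d" "j = y * d + b" "y < k" "b < d"
      using split by meson
    have "(\<Sum>c<k*d. cnj (U i c) * U j c)
      = (\<Sum>z<k. \<Sum>c<d. if z = x then (if x = y then cnj (u x a c) * u x b c else 0) else 0)"
      unfolding sum_prod_index using ij by (intro sum.cong refl) (auto simp: U_def)
    also have "\<dots> = (\<Sum>z<k. if z = x then (\<Sum>c<d. (if x = y then cnj (u x a c) * u x b c else 0)) else 0)"
      by (intro sum.cong) auto
    also have "\<dots> = (if x = y then (\<Sum>c<d. cnj (u x a c) * u x b c) else 0)" using ij by simp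
    also have "\<dots> = (if i = j then 1 else 0)"
      using u[OF ij(2)] ij(3,6) unfolding ij(1,4) prod_index_eq_iff[OF ij(3,6)]
      by (cases "x = y") (auto simp: spectral_decomp_def)
    finally show "(\<Sum>c<k*d. cnj (U i c) * U j c) = (if i = j then 1 else 0)" .
  next
    fix i j assume "i < k*d" "j < k*d"
    then obtain x a y b where ij: "i = x * d + a" "x < k" "a < d" "j = y * d + b" "y < k" "b < d"
      using split by meson
    have "(\<Sum>c<k*d. of_real (L c) * U c i * cnj (U c j))
      = (\<Sum>z<k. \<Sum>c<d. if z = x then (if x = y then of_real (p x) * (of_real (l x c) * u x c a * cnj (u x c b)) else 0) else 0)"
      unfolding sum_prod_index using ij by (intro sum.cong refl) (auto simp: U_def L_def)
    also have "\<dots> = (\<Sum>z<k. if z = x then (\<Sum>c<d. (if x = y then of_real (p x) * (of_real (l x c) * u x c a * cnj (u x c b)) else 0)) else 0)"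
      by (intro sum.cong) auto
    also have "\<dots> = (if x = y then of_real (p x) * \<theta> x $$ (a,b) else 0)"
      using ij u[OF ij(2)] by (auto simp: spectral_decomp_def sum_distrib_left)
    finally show "?M $$ (i,j) = (\<Sum>c<k*d. of_real (L c) * U c i * cnj (U c j))"
      using ij by (simp add: idx)
  qed (rule Mc)
  then have "vn_entropy ?M = - (\<Sum>i<k*d. L i * log 2 (L i))" by (rule vn_entropy_spectral_decomp)
  also have "(\<Sum>i<k*d. L i * log 2 (L i)) = (\<Sum>x<k. \<Sum>j<d. (p x * l x j) * log 2 (p x * l x j))"
    unfolding sum_prod_index by (intro sum.cong refl) (auto simp: L_def)
  also have "\<dots> = (\<Sum>x<k. \<Sum>j<d. (p x * log 2 (p x)) * l x j + p x * (l x j * log 2 (l x j)))"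
  proof (intro sum.cong refl)
    fix x j assume "x \<in> {..<k}" "j \<in> {..<d}"
    then have "0 \<le> p x" "0 \<le> l x j" using p0 density_eigenvalues(1)[OF u] \<theta> by auto
    \<comment> \<open>The logarithm of a product splits only for positive factors; if one of them
      vanishes, both sides are 0.\<close>
    then show "(p x * l x j) * log 2 (p x * l x j) = (p x * log 2 (p x)) * l x j + p x * (l x j * log 2 (l x j))"
      by (cases "p x = 0"; cases "l x j = 0") (auto simp: log_mult algebra_simps)
  qed
  also have "\<dots> = (\<Sum>x<k. p x * log 2 (p x)) + (\<Sum>x<k. p x * (\<Sum>j<d. l x j * log 2 (l x j)))"
    using density_eigenvalues(2)[OF u] \<theta>
    by (simp add: sum.distrib flip: sum_distrib_left)
  finally show ?thesis unfolding mutual_info_def e1 e2 by simp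
qed

section \<open>Positive kernels and channels with an environment\<close>

text \<open>Basis indices of \<open>n\<close> registers of dimension \<open>d\<close>. With lists in
  place of numbers below \<open>d ^ n\<close>, adding a register is a \<open>Cons\<close> and
  inductions on \<open>n\<close> follow the calls of the protocol.\<close>

definition tuples :: "nat \<Rightarrow> nat \<Rightarrow> nat list set" where
  "tuples d n = {xs. set xs \<subseteq> {..<d} \<and> length xs = n}"

lemma finite_tuples [simp]: "finite (tuples d n)"
  unfolding tuples_def by (rule finite_lists_length_eq) simp

lemma tuples_0 [simp]: "tuples d 0 = {[]}"
  by (auto simp: tuples_def)

lemma tuples_Cons [simp]: "e # I \<in> tuples d (Suc n) \<longleftrightarrow> e < d \<and> I \<in> tuples d n"
  by (auto simp: tuples_def)

lemma tuples_Suc: "tuples d (Suc n) = (\<lambda>(e,I). e # I) ` ({..<d} \<times> tuples d n)"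
  unfolding tuples_def set_eq_iff by (auto simp: length_Suc_conv image_iff)

lemma length_tuples: "I \<in> tuples d n \<Longrightarrow> length I = n"
  by (simp add: tuples_def)

lemma sum_tuples_Suc:
  "(\<Sum>I\<in>tuples d (Suc n). f I) = (\<Sum>e<d. \<Sum>I\<in>tuples d n. f (e # I))"
  unfolding tuples_Suc
  by (subst sum.reindex) (auto simp: inj_on_def sum.cartesian_product case_prod_unfold)

text \<open>Entry \<open>(I, J)\<close> of the tensor product of the operators \<open>T 0, T 1, \<dots>\<close>. Tuples list the latest
  tensor factor first, so the head of a tuple belongs to the operator indexed by the length of its tail.\<close>
fun tensor_entry :: "(nat \<Rightarrow> nat \<Rightarrow> nat \<Rightarrow> complex) \<Rightarrow> nat list \<Rightarrow> nat list \<Rightarrow> complex" where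
  "tensor_entry T [] J = 1"
| "tensor_entry T (e # I) [] = 0"
| "tensor_entry T (e # I) (f # J) = T (length I) e f * tensor_entry T I J"

text \<open>Positivity of an operator with an arbitrary index set, later pairs of a register tuple
  and a system index. The function \<open>\<phi>\<close> plays the role of the conjugate of the
  vector in \<open>psd\<close>.\<close>

definition psd_kernel :: "'a set \<Rightarrow> ('a \<Rightarrow> 'a \<Rightarrow> complex) \<Rightarrow> bool" where
  "psd_kernel S K \<longleftrightarrow> (\<forall>\<phi>. 0 \<le> Re (\<Sum>p\<in>S. \<Sum>q\<in>S. \<phi> p * cnj (\<phi> q) * K p q))"

lemma kernel_congruence:
  "(\<Sum>p\<in>P. \<Sum>q\<in>P. \<phi> p * cnj (\<phi> q) * (\<Sum>r\<in>S. \<Sum>s\<in>S. C p r * K r s * cnj (C q s)))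
    = (\<Sum>r\<in>S. \<Sum>s\<in>S. (\<Sum>p\<in>P. \<phi> p * C p r) * cnj (\<Sum>q\<in>P. \<phi> q * C q s) * K r s)"
proof -
  have "(\<Sum>p\<in>P. \<Sum>q\<in>P. \<phi> p * cnj (\<phi> q) * (\<Sum>r\<in>S. \<Sum>s\<in>S. C p r * K r s * cnj (C q s)))
    = (\<Sum>(p,q,r,s)\<in>P\<times>P\<times>S\<times>S. \<phi> p * cnj (\<phi> q) * (C p r * K r s * cnj (C q s)))"
    unfolding sum_distrib_left by (simp add: sum.cartesian_product case_prod_unfold)
  also have "\<dots> = (\<Sum>(r,s,p,q)\<in>S\<times>S\<times>P\<times>P. \<phi> p * cnj (\<phi> q) * (C p r * K r s * cnj (C q s)))"
    by (rule sum.reindex_bij_witness[of _ "\<lambda>(r,s,p,q). (p,q,r,s)" "\<lambda>(p,q,r,s). (r,s,p,q)"]) auto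
  also have "\<dots> = (\<Sum>r\<in>S. \<Sum>s\<in>S. \<Sum>p\<in>P. \<Sum>q\<in>P. \<phi> p * cnj (\<phi> q) * (C p r * K r s * cnj (C q s)))"
    by (simp add: sum.cartesian_product case_prod_unfold)
  also have "\<dots> = (\<Sum>r\<in>S. \<Sum>s\<in>S. (\<Sum>p\<in>P. \<phi> p * C p r) * cnj (\<Sum>q\<in>P. \<phi> q * C q s) * K r s)"
    unfolding cnj_sum sum_product unfolding sum_distrib_right by (intro sum.cong refl) (simp add: mult_ac)
  finally show ?thesis .
qed

text \<open>Each summand is a congruence of \<open>K\<close>, so its form at \<open>\<phi>\<close>
  is the form of \<open>K\<close> at a transformed vector.\<close>

lemma psd_kernel_congruence:
  assumes "psd_kernel S K"
    and eq: "\<And>p q. p \<in> P \<Longrightarrow> q \<in> P \<Longrightarrow> K' p q = (\<Sum>\<mu><N. \<Sum>r\<in>S. \<Sum>s\<in>S. C \<mu> p r * K r s * cnj (C \<mu> q s))"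
  shows "psd_kernel P K'"
  unfolding psd_kernel_def
proof
  fix \<phi> :: "'b \<Rightarrow> complex"
  have "(\<Sum>p\<in>P. \<Sum>q\<in>P. \<phi> p * cnj (\<phi> q) * K' p q)
    = (\<Sum>p\<in>P. \<Sum>q\<in>P. \<Sum>\<mu><N. \<phi> p * cnj (\<phi> q) * (\<Sum>r\<in>S. \<Sum>s\<in>S. C \<mu> p r * K r s * cnj (C \<mu> q s)))"
    by (intro sum.cong refl) (simp add: eq sum_distrib_left)
  also have "\<dots> = (\<Sum>p\<in>P. \<Sum>\<mu><N. \<Sum>q\<in>P. \<phi> p * cnj (\<phi> q) * (\<Sum>r\<in>S. \<Sum>s\<in>S. C \<mu> p r * K r s * cnj (C \<mu> q s)))"
    by (intro sum.cong refl sum.swap)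
  also have "\<dots> = (\<Sum>\<mu><N. \<Sum>p\<in>P. \<Sum>q\<in>P. \<phi> p * cnj (\<phi> q) * (\<Sum>r\<in>S. \<Sum>s\<in>S. C \<mu> p r * K r s * cnj (C \<mu> q s)))"
    by (rule sum.swap)
  also have "Re \<dots> \<ge> 0"
    unfolding kernel_congruence Re_sum[of _ "{..<N}"]
    by (intro sum_nonneg) (rule assms(1)[unfolded psd_kernel_def, rule_format])
  finally show "0 \<le> Re (\<Sum>p\<in>P. \<Sum>q\<in>P. \<phi> p * cnj (\<phi> q) * K' p q)" .
qed

text \<open>The kernel \<open>\<Omega>\<close> is an operator on the environment registers (indexed by \<open>S\<close>) and a system of
  dimension \<open>D\<close>; a channel acting on the system consumes or creates environment registers through \<open>t\<close>.\<close>
lemma psd_kernel_kraus: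
  fixes D D' :: nat
  assumes \<Omega>: "psd_kernel (S \<times> {..<D}) \<Omega>" and S: "finite S" and t: "\<And>I. I \<in> S' \<Longrightarrow> t I \<in> S"
  shows "psd_kernel (S' \<times> {..<D'}) (\<lambda>p q. \<Sum>\<mu><N. \<Sum>a<D. \<Sum>b<D.
    C \<mu> (fst p) (snd p) a * \<Omega> (t (fst p), a) (t (fst q), b) * cnj (C \<mu> (fst q) (snd q) b))"
\<comment> \<open>A Kronecker delta on the register component extends the operators to pairs; the
  sums over pairs then collapse to sums over system indices.\<close>
proof (rule psd_kernel_congruence[OF \<Omega>, where C = "\<lambda>\<mu> p r. if fst r = t (fst p) then C \<mu> (fst p) (snd p) (snd r) else 0"])
  fix p q assume pq: "p \<in> S' \<times> {..<D'}" "q \<in> S' \<times> {..<D'}"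
  have col: "(\<Sum>r\<in>S \<times> {..<D}. if fst r = J then g (snd r) else 0) = (\<Sum>a<D. g a)"
    if "J \<in> S" for g :: "nat \<Rightarrow> complex" and J
  proof -
    have "(\<Sum>r\<in>S \<times> {..<D}. if fst r = J then g (snd r) else 0) = (\<Sum>I\<in>S. \<Sum>a<D. if I = J then g a else 0)"
      by (simp add: sum.cartesian_product case_prod_unfold)
    also have "\<dots> = (\<Sum>I\<in>S. if I = J then \<Sum>a<D. g a else 0)" by (intro sum.cong) auto
    finally show ?thesis using that S by simp
  qed
  have "(\<Sum>r\<in>S\<times>{..<D}. \<Sum>s\<in>S\<times>{..<D}.
      (if fst r = t (fst p) then C \<mu> (fst p) (snd p) (snd r) else 0) * \<Omega> r s *
      cnj (if fst s = t (fst q) then C \<mu> (fst q) (snd q) (snd s) else 0))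
    = (\<Sum>a<D. \<Sum>b<D. C \<mu> (fst p) (snd p) a * \<Omega> (t (fst p), a) (t (fst q), b) * cnj (C \<mu> (fst q) (snd q) b))" for \<mu>
  proof -
    have "(\<Sum>r\<in>S\<times>{..<D}. \<Sum>s\<in>S\<times>{..<D}.
      (if fst r = t (fst p) then C \<mu> (fst p) (snd p) (snd r) else 0) * \<Omega> r s *
      cnj (if fst s = t (fst q) then C \<mu> (fst q) (snd q) (snd s) else 0))
     = (\<Sum>r\<in>S\<times>{..<D}. if fst r = t (fst p) then
          (\<Sum>s\<in>S\<times>{..<D}. if fst s = t (fst q) then C \<mu> (fst p) (snd p) (snd r) * \<Omega> (t (fst p), snd r) (t (fst q), snd s) *
      cnj (C \<mu> (fst q) (snd q) (snd s)) else 0) else 0)"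
      by (auto intro!: sum.cong)
    also have "\<dots> = (\<Sum>a<D. \<Sum>b<D. C \<mu> (fst p) (snd p) a * \<Omega> (t (fst p), a) (t (fst q), b) * cnj (C \<mu> (fst q) (snd q) b))"
      using pq t by (subst col, force, subst col) auto
    finally show ?thesis .
  qed
  then show "(\<Sum>\<mu><N. \<Sum>a<D. \<Sum>b<D. C \<mu> (fst p) (snd p) a * \<Omega> (t (fst p), a) (t (fst q), b) * cnj (C \<mu> (fst q) (snd q) b))
    = (\<Sum>\<mu><N. \<Sum>r\<in>S\<times>{..<D}. \<Sum>s\<in>S\<times>{..<D}.
      (if fst r = t (fst p) then C \<mu> (fst p) (snd p) (snd r) else 0) * \<Omega> r s *
      cnj (if fst s = t (fst q) then C \<mu> (fst q) (snd q) (snd s) else 0))" by simp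
qed

section \<open>Channels and memory cells in Kraus coordinates\<close>

lemma channel_kraus_entries:
  assumes "is_channel m n \<Phi>"
  obtains N :: nat and A :: "nat \<Rightarrow> nat \<Rightarrow> nat \<Rightarrow> complex" where
    "\<And>a b. a < m \<Longrightarrow> b < m \<Longrightarrow> (\<Sum>\<mu><N. \<Sum>i<n. A \<mu> i a * cnj (A \<mu> i b)) = (if a = b then 1 else 0)"
    "\<And>\<rho>. \<rho> \<in> carrier_mat m m \<Longrightarrow> \<Phi> \<rho> \<in> carrier_mat n n"
    "\<And>\<rho> i j. \<rho> \<in> carrier_mat m m \<Longrightarrow> i < n \<Longrightarrow> j < n \<Longrightarrow>
      \<Phi> \<rho> $$ (i,j) = (\<Sum>\<mu><N. \<Sum>a<m. \<Sum>b<m. A \<mu> i a * \<rho> $$ (a,b) * cnj (A \<mu> j b))"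
proof -
  obtain N K where K: "\<And>i. i < N \<Longrightarrow> K i \<in> carrier_mat n m"
    and tp: "msum m m (\<lambda>i. dag (K i) * K i) N = 1\<^sub>m m"
    and \<Phi>: "\<And>\<rho>. \<rho> \<in> carrier_mat m m \<Longrightarrow> \<Phi> \<rho> = msum n n (\<lambda>i. K i * \<rho> * dag (K i)) N"
    using assms unfolding is_channel_def by blast
  show ?thesis
  proof (rule that[where N = N and A = "\<lambda>\<mu> i a. K \<mu> $$ (i,a)"])
    fix a b assume ab: "a < m" "b < m"
    have "(\<Sum>\<mu><N. \<Sum>i<n. cnj (K \<mu> $$ (i,b)) * K \<mu> $$ (i,a)) = (\<Sum>\<mu><N. (dag (K \<mu>) * K \<mu>) $$ (b,a))"
    proof (intro sum.cong refl)
      fix \<mu> assume "\<mu> \<in> {..<N}"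
      then have c: "K \<mu> \<in> carrier_mat n m" using K by simp
      show "(\<Sum>i<n. cnj (K \<mu> $$ (i,b)) * K \<mu> $$ (i,a)) = (dag (K \<mu>) * K \<mu>) $$ (b,a)"
        unfolding index_mult_sum[OF dag_carrier[OF c] c ab(2,1)]
        by (intro sum.cong refl) (simp add: index_dag[OF c] ab)
    qed
    also have "\<dots> = msum m m (\<lambda>i. dag (K i) * K i) N $$ (b,a)" using ab by (simp add: msum_def)
    finally show "(\<Sum>\<mu><N. \<Sum>i<n. K \<mu> $$ (i,a) * cnj (K \<mu> $$ (i,b))) = (if a = b then 1 else 0)"
      using ab by (simp add: tp mult.commute)
  next
    fix \<rho> :: "complex mat" assume "\<rho> \<in> carrier_mat m m"
    then show "\<Phi> \<rho> \<in> carrier_mat n n" by (simp add: \<Phi> msum_def)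
  next
    fix \<rho> :: "complex mat" and i j assume \<rho>: "\<rho> \<in> carrier_mat m m" and ij: "i < n" "j < n"
    have "\<Phi> \<rho> $$ (i,j) = (\<Sum>\<mu><N. (K \<mu> * \<rho> * dag (K \<mu>)) $$ (i,j))"
      using ij by (simp add: \<Phi>[OF \<rho>] msum_def)
    also have "\<dots> = (\<Sum>\<mu><N. \<Sum>a<m. \<Sum>b<m. K \<mu> $$ (i,a) * \<rho> $$ (a,b) * cnj (K \<mu> $$ (j,b)))"
    proof (intro sum.cong refl)
      fix \<mu> assume "\<mu> \<in> {..<N}"
      then have c: "K \<mu> \<in> carrier_mat n m" using K by simp
      have "(K \<mu> * \<rho> * dag (K \<mu>)) $$ (i,j) = (\<Sum>b<m. (K \<mu> * \<rho>) $$ (i,b) * dag (K \<mu>) $$ (b,j))"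
        by (rule index_mult_sum[OF mult_carrier_mat[OF c \<rho>] dag_carrier[OF c] ij])
      also have "\<dots> = (\<Sum>b<m. (\<Sum>a<m. K \<mu> $$ (i,a) * \<rho> $$ (a,b)) * cnj (K \<mu> $$ (j,b)))"
      proof (intro sum.cong refl)
        fix b assume "b \<in> {..<m}"
        then have b: "b < m" by simp
        show "(K \<mu> * \<rho>) $$ (i,b) * dag (K \<mu>) $$ (b,j) = (\<Sum>a<m. K \<mu> $$ (i,a) * \<rho> $$ (a,b)) * cnj (K \<mu> $$ (j,b))"
          unfolding index_mult_sum[OF c \<rho> ij(1) b] index_dag[OF c b ij(2)] ..
      qed
      also have "\<dots> = (\<Sum>a<m. \<Sum>b<m. K \<mu> $$ (i,a) * \<rho> $$ (a,b) * cnj (K \<mu> $$ (j,b)))"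
        unfolding sum_distrib_right by (rule sum.swap)
      finally show "(K \<mu> * \<rho> * dag (K \<mu>)) $$ (i,j) = (\<Sum>a<m. \<Sum>b<m. K \<mu> $$ (i,a) * \<rho> $$ (a,b) * cnj (K \<mu> $$ (j,b)))" .
    qed
    finally show "\<Phi> \<rho> $$ (i,j) = (\<Sum>\<mu><N. \<Sum>a<m. \<Sum>b<m. K \<mu> $$ (i,a) * \<rho> $$ (a,b) * cnj (K \<mu> $$ (j,b)))" .
  qed
qed

text \<open>Splitting the environment index off the input of the Kraus operators of
  \<open>F\<close>, and padding with the identity on the reference, leaves one operator
  \<open>C \<mu> e\<close> per environment basis vector. The letter \<open>x\<close> enters only
  through the entries of \<open>\<theta> x\<close>, while \<open>C\<close> is the same for all
  letters. Trace preservation becomes orthonormality jointly in the system and the environment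
  index.\<close>

lemma env_cell_kraus_entries:
  assumes F: "is_channel (dA * dE) dB F"
  obtains N :: nat and C :: "nat \<Rightarrow> nat \<Rightarrow> nat \<Rightarrow> nat \<Rightarrow> complex" where
    "\<And>a b e f. a < r * dA \<Longrightarrow> b < r * dA \<Longrightarrow> e < dE \<Longrightarrow> f < dE \<Longrightarrow>
      (\<Sum>\<mu><N. \<Sum>i<r*dB. C \<mu> e i a * cnj (C \<mu> f i b)) = (if a = b \<and> e = f then 1 else 0)"
    "\<And>\<theta> x M i j. \<theta> x \<in> carrier_mat dE dE \<Longrightarrow> i < r * dB \<Longrightarrow> j < r * dB \<Longrightarrow>
      id_tensor r dA dB (env_cell F \<theta> x) M $$ (i,j) =
        (\<Sum>e<dE. \<Sum>f<dE. \<theta> x $$ (e,f) * (\<Sum>\<mu><N. \<Sum>a<r*dA. \<Sum>b<r*dA. C \<mu> e i a * M $$ (a,b) * cnj (C \<mu> f j b)))"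
proof -
  obtain N :: nat and L :: "nat \<Rightarrow> nat \<Rightarrow> nat \<Rightarrow> complex" where
    tp: "\<And>a b. a < dA * dE \<Longrightarrow> b < dA * dE \<Longrightarrow>
      (\<Sum>\<mu><N. \<Sum>i<dB. L \<mu> i a * cnj (L \<mu> i b)) = (if a = b then 1 else 0)"
    and "\<And>\<rho>. \<rho> \<in> carrier_mat (dA * dE) (dA * dE) \<Longrightarrow> F \<rho> \<in> carrier_mat dB dB"
    and L: "\<And>\<rho> i j. \<rho> \<in> carrier_mat (dA * dE) (dA * dE) \<Longrightarrow> i < dB \<Longrightarrow> j < dB \<Longrightarrow>
      F \<rho> $$ (i,j) = (\<Sum>\<mu><N. \<Sum>a<dA*dE. \<Sum>b<dA*dE. L \<mu> i a * \<rho> $$ (a,b) * cnj (L \<mu> j b))"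
    by (rule channel_kraus_entries[OF F], rule that)
  \<comment> \<open>The condition on the quotients is the identity on the reference; the remainders
    are the indices of the systems \<open>A\<close> and \<open>B\<close>.\<close>
  define C where "C \<mu> e i a = (if a div dA = i div dB then L \<mu> (i mod dB) ((a mod dA) * dE + e) else 0)" for \<mu> e i a :: nat
  show ?thesis
  proof (rule that[where N = N and C = C])
    fix a b e f assume a: "a < r * dA" and b: "b < r * dA" and e: "e < dE" and f: "f < dE"
    have dA: "0 < dA" using a by (cases dA) auto
    have ar: "a div dA < r" and am: "a mod dA < dA" and bm: "b mod dA < dA"
      using a dA less_mult_imp_div_less by auto
    have ae: "(a mod dA) * dE + e < dA * dE" and bf: "(b mod dA) * dE + f < dA * dE"
      using prod_index_less am bm e f by auto
    have "(\<Sum>i<r*dB. C \<mu> e i a * cnj (C \<mu> f i b)) = (if a div dA = b div dA then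
        (\<Sum>i<dB. L \<mu> i ((a mod dA) * dE + e) * cnj (L \<mu> i ((b mod dA) * dE + f))) else 0)" for \<mu>
    proof -
      have "(\<Sum>i<r*dB. C \<mu> e i a * cnj (C \<mu> f i b)) = (\<Sum>x<r. \<Sum>i<dB. if x = a div dA then
         (if a div dA = b div dA then L \<mu> i ((a mod dA) * dE + e) * cnj (L \<mu> i ((b mod dA) * dE + f)) else 0) else 0)"
        unfolding sum_prod_index by (intro sum.cong refl) (auto simp: C_def)
      also have "\<dots> = (\<Sum>x<r. if x = a div dA then (\<Sum>i<dB.
         (if a div dA = b div dA then L \<mu> i ((a mod dA) * dE + e) * cnj (L \<mu> i ((b mod dA) * dE + f)) else 0)) else 0)"
        by (intro sum.cong) auto
      finally show ?thesis using ar by simp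
    qed
    then have "(\<Sum>\<mu><N. \<Sum>i<r*dB. C \<mu> e i a * cnj (C \<mu> f i b)) = (if a div dA = b div dA then
        (\<Sum>\<mu><N. \<Sum>i<dB. L \<mu> i ((a mod dA) * dE + e) * cnj (L \<mu> i ((b mod dA) * dE + f))) else 0)"
      by simp
    also have "\<dots> = (if a div dA = b div dA \<and> a mod dA = b mod dA \<and> e = f then 1 else 0)"
      unfolding tp[OF ae bf] prod_index_eq_iff[OF e f] by simp
    also have "\<dots> = (if a = b \<and> e = f then 1 else 0)"
    proof -
      have "a = b \<longleftrightarrow> a div dA = b div dA \<and> a mod dA = b mod dA" by (metis div_mult_mod_eq)
      then show ?thesis by simp
    qed
    finally show "(\<Sum>\<mu><N. \<Sum>i<r*dB. C \<mu> e i a * cnj (C \<mu> f i b)) = (if a = b \<and> e = f then 1 else 0)" .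
  next
    fix \<theta> :: "nat \<Rightarrow> complex mat" and x i j and M :: "complex mat"
    assume \<theta>: "\<theta> x \<in> carrier_mat dE dE" and i: "i < r * dB" and j: "j < r * dB"
    have dB: "0 < dB" using i by (cases dB) auto
    have ir: "i div dB < r" "j div dB < r" and im: "i mod dB < dB" "j mod dB < dB"
      using i j dB less_mult_imp_div_less by auto
    define Y where "Y = mat dA dA (\<lambda>(a,b). M $$ ((i div dB) * dA + a, (j div dB) * dA + b))"
    have K: "kron Y (\<theta> x) \<in> carrier_mat (dA * dE) (dA * dE)" using \<theta> by (auto simp: kron_def Y_def)
    have Kidx: "kron Y (\<theta> x) $$ (a * dE + e, b * dE + f) = Y $$ (a,b) * \<theta> x $$ (e,f)"
      if "a < dA" "b < dA" "e < dE" "f < dE" for a b e f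
    proof -
      have "dim_row Y = dA" "dim_col Y = dA" "dim_row (\<theta> x) = dE" "dim_col (\<theta> x) = dE"
        using \<theta> by (auto simp: Y_def)
      then show ?thesis using that prod_index_less[of a dA e dE] prod_index_less[of b dA f dE]
        by (simp add: kron_def)
    qed
    have block: "(\<Sum>b<r*dA. g b * cnj (C \<mu> f j b)) = (\<Sum>b<dA. g ((j div dB) * dA + b) * cnj (L \<mu> (j mod dB) (b * dE + f)))"
      if "j < r * dB" for g \<mu> f j
    proof -
      have jr: "j div dB < r" using that less_mult_imp_div_less by auto
      have "(\<Sum>b<r*dA. g b * cnj (C \<mu> f j b)) = (\<Sum>y<r. \<Sum>b<dA. if y = j div dB then
         g ((j div dB) * dA + b) * cnj (L \<mu> (j mod dB) (b * dE + f)) else 0)"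
        unfolding sum_prod_index by (intro sum.cong refl) (auto simp: C_def)
      also have "\<dots> = (\<Sum>y<r. if y = j div dB then (\<Sum>b<dA.
         g ((j div dB) * dA + b) * cnj (L \<mu> (j mod dB) (b * dE + f))) else 0)"
        by (intro sum.cong) auto
      finally show ?thesis using jr by simp
    qed
    have block': "(\<Sum>a<r*dA. C \<mu> e i a * g a) = (\<Sum>a<dA. L \<mu> (i mod dB) (a * dE + e) * g ((i div dB) * dA + a))" for g \<mu> e
      using arg_cong[OF block[OF i, of "\<lambda>a. cnj (g a)" \<mu> e], of cnj] by (simp add: mult.commute)
    have "id_tensor r dA dB (env_cell F \<theta> x) M $$ (i,j) = F (kron Y (\<theta> x)) $$ (i mod dB, j mod dB)"
      using i j by (simp add: id_tensor_def env_cell_def Y_def)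
    also have "\<dots> = (\<Sum>\<mu><N. \<Sum>a<dA*dE. \<Sum>b<dA*dE. L \<mu> (i mod dB) a * kron Y (\<theta> x) $$ (a,b) * cnj (L \<mu> (j mod dB) b))"
      by (rule L[OF K im])
    also have "\<dots> = (\<Sum>\<mu><N. \<Sum>a<dA. \<Sum>e<dE. \<Sum>b<dA. \<Sum>f<dE. L \<mu> (i mod dB) (a*dE+e) *
        (Y $$ (a,b) * \<theta> x $$ (e,f)) * cnj (L \<mu> (j mod dB) (b*dE+f)))"
      unfolding sum_prod_index by (intro sum.cong refl) (simp add: Kidx)
    also have "\<dots> = (\<Sum>(\<mu>,a,e,b,f)\<in>{..<N}\<times>{..<dA}\<times>{..<dE}\<times>{..<dA}\<times>{..<dE}. L \<mu> (i mod dB) (a*dE+e) *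
        (Y $$ (a,b) * \<theta> x $$ (e,f)) * cnj (L \<mu> (j mod dB) (b*dE+f)))"
      by (simp add: sum.cartesian_product case_prod_unfold)
    also have "\<dots> = (\<Sum>(e,f,\<mu>,a,b)\<in>{..<dE}\<times>{..<dE}\<times>{..<N}\<times>{..<dA}\<times>{..<dA}. L \<mu> (i mod dB) (a*dE+e) *
        (Y $$ (a,b) * \<theta> x $$ (e,f)) * cnj (L \<mu> (j mod dB) (b*dE+f)))"
      by (rule sum.reindex_bij_witness[of _ "\<lambda>(e,f,\<mu>,a,b). (\<mu>,a,e,b,f)" "\<lambda>(\<mu>,a,e,b,f). (e,f,\<mu>,a,b)"]) auto
    also have "\<dots> = (\<Sum>e<dE. \<Sum>f<dE. \<Sum>\<mu><N. \<Sum>a<dA. \<Sum>b<dA. L \<mu> (i mod dB) (a*dE+e) *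
        (Y $$ (a,b) * \<theta> x $$ (e,f)) * cnj (L \<mu> (j mod dB) (b*dE+f)))"
      by (simp add: sum.cartesian_product case_prod_unfold)
    also have "\<dots> = (\<Sum>e<dE. \<Sum>f<dE. \<theta> x $$ (e,f) * (\<Sum>\<mu><N. \<Sum>a<dA. L \<mu> (i mod dB) (a*dE+e) * (\<Sum>b<dA.
        M $$ ((i div dB) * dA + a, (j div dB) * dA + b) * cnj (L \<mu> (j mod dB) (b*dE+f)))))"
      unfolding sum_distrib_left by (intro sum.cong refl) (simp add: Y_def mult_ac)
    also have "\<dots> = (\<Sum>e<dE. \<Sum>f<dE. \<theta> x $$ (e,f) * (\<Sum>\<mu><N. \<Sum>a<r*dA. C \<mu> e i a * (\<Sum>b<r*dA. M $$ (a,b) * cnj (C \<mu> f j b))))"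
      unfolding block' block[OF j] ..
    finally show "id_tensor r dA dB (env_cell F \<theta> x) M $$ (i,j) =
        (\<Sum>e<dE. \<Sum>f<dE. \<theta> x $$ (e,f) * (\<Sum>\<mu><N. \<Sum>a<r*dA. \<Sum>b<r*dA. C \<mu> e i a * M $$ (a,b) * cnj (C \<mu> f j b)))"
      by (simp add: sum_distrib_left mult_ac)
  qed
qed

section \<open>Protocols with open environment registers\<close>

text \<open>\<open>\<Omega>\<close> represents the states \<open>X enc\<close> of a protocol with the environment registers left open: the state
  for an encoding is recovered by contracting \<open>\<Omega>\<close> with the product of the environment states used.\<close>
definition open_state ::
  "(nat \<Rightarrow> complex mat) \<Rightarrow> nat \<Rightarrow> nat \<Rightarrow> nat \<Rightarrow> nat \<Rightarrow> ((nat \<Rightarrow> nat) \<Rightarrow> complex mat) \<Rightarrow>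
    (nat list \<times> nat \<Rightarrow> nat list \<times> nat \<Rightarrow> complex) \<Rightarrow> bool" where
  "open_state \<theta> k d n D X \<Omega> \<longleftrightarrow>
     psd_kernel (tuples d n \<times> {..<D}) \<Omega> \<and>
     (\<forall>I\<in>tuples d n. \<forall>J\<in>tuples d n. (\<Sum>a<D. \<Omega> (I,a) (J,a)) = (if I = J then 1 else 0)) \<and>
     (\<forall>enc. (\<forall>i<n. enc i < k) \<longrightarrow> X enc \<in> carrier_mat D D \<and>
        (\<forall>a<D. \<forall>b<D. X enc $$ (a,b) = (\<Sum>I\<in>tuples d n. \<Sum>J\<in>tuples d n.
           tensor_entry (\<lambda>l e f. \<theta> (enc l) $$ (e,f)) I J * \<Omega> (I,a) (J,b))))"

lemma open_state_initial:
  assumes "density D \<rho>"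
  shows "open_state \<theta> k d 0 D (\<lambda>_. \<rho>) (\<lambda>p q. \<rho> $$ (snd p, snd q))"
proof -
  have \<rho>: "\<rho> \<in> carrier_mat D D" and tr: "tr \<rho> = 1"
    and pos: "\<And>v. 0 \<le> Re (\<Sum>i<D. \<Sum>j<D. cnj (v i) * \<rho> $$ (i,j) * v j)"
    using assms by (simp_all add: density_def psd_def)
  have "0 \<le> Re (\<Sum>p\<in>{[]} \<times> {..<D}. \<Sum>q\<in>{[]} \<times> {..<D}. \<phi> p * cnj (\<phi> q) * \<rho> $$ (snd p, snd q))"
    for \<phi> :: "nat list \<times> nat \<Rightarrow> complex"
  proof -
    have "(\<Sum>p\<in>{[]} \<times> {..<D}. g p) = (\<Sum>a<D. g ([], a))" for g :: "nat list \<times> nat \<Rightarrow> complex"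
      by (rule sum.reindex_bij_witness[of _ "\<lambda>a. ([],a)" snd]) auto
    then show ?thesis using pos[of "\<lambda>a. cnj (\<phi> ([], a))"] by (simp add: mult_ac)
  qed
  then show ?thesis using \<rho> tr by (auto simp: open_state_def psd_kernel_def tr_def)
qed

text \<open>The call puts its environment input at the head of the tuple, as the factor with index
  \<open>n\<close>, the length of the tail. Since the Kraus operators do not involve the letter, one
  \<open>\<Omega>'\<close> serves all encodings.\<close>

lemma open_state_env_cell:
  assumes X: "open_state \<theta> k dE n (r * dA) X \<Omega>" and F: "is_channel (dA * dE) dB F"
    and \<theta>: "\<forall>x<k. density dE (\<theta> x)"
  shows "\<exists>\<Omega>'. open_state \<theta> k dE (Suc n) (r * dB) (\<lambda>enc. id_tensor r dA dB (env_cell F \<theta> (enc n)) (X enc)) \<Omega>'"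
proof -
  let ?D = "r * dA" and ?D' = "r * dB"
  obtain C :: "nat \<Rightarrow> nat \<Rightarrow> nat \<Rightarrow> nat \<Rightarrow> complex" and N :: nat where
    tp: "\<And>a b e f. a < r * dA \<Longrightarrow> b < r * dA \<Longrightarrow> e < dE \<Longrightarrow> f < dE \<Longrightarrow>
      (\<Sum>\<mu><N. \<Sum>i<r*dB. C \<mu> e i a * cnj (C \<mu> f i b)) = (if a = b \<and> e = f then 1 else 0)"
    and C: "\<And>\<theta> x M i j. \<theta> x \<in> carrier_mat dE dE \<Longrightarrow> i < r * dB \<Longrightarrow> j < r * dB \<Longrightarrow>
      id_tensor r dA dB (env_cell F \<theta> x) M $$ (i,j) =
        (\<Sum>e<dE. \<Sum>f<dE. \<theta> x $$ (e,f) * (\<Sum>\<mu><N. \<Sum>a<r*dA. \<Sum>b<r*dA. C \<mu> e i a * M $$ (a,b) * cnj (C \<mu> f j b)))"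
    by (rule env_cell_kraus_entries[OF F], rule that)
  have psd: "psd_kernel (tuples dE n \<times> {..<?D}) \<Omega>"
    and tr: "\<And>I J. I \<in> tuples dE n \<Longrightarrow> J \<in> tuples dE n \<Longrightarrow> (\<Sum>a<?D. \<Omega> (I,a) (J,a)) = (if I = J then 1 else 0)"
    and rep: "\<And>enc a b. \<forall>i<n. enc i < k \<Longrightarrow> a < ?D \<Longrightarrow> b < ?D \<Longrightarrow> X enc $$ (a,b) =
       (\<Sum>I\<in>tuples dE n. \<Sum>J\<in>tuples dE n. tensor_entry (\<lambda>l e f. \<theta> (enc l) $$ (e,f)) I J * \<Omega> (I,a) (J,b))"
    using X unfolding open_state_def by blast+
  define \<Omega>' where "\<Omega>' p q = (\<Sum>\<mu><N. \<Sum>a<?D. \<Sum>b<?D.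
    C \<mu> (hd (fst p)) (snd p) a * \<Omega> (tl (fst p), a) (tl (fst q), b) * cnj (C \<mu> (hd (fst q)) (snd q) b))" for p q
  have "psd_kernel (tuples dE (Suc n) \<times> {..<?D'}) \<Omega>'"
    unfolding \<Omega>'_def
    by (rule psd_kernel_kraus[OF psd finite_tuples, where C = "\<lambda>\<mu> I. C \<mu> (hd I)"]) (auto simp: tuples_Suc)
  moreover have "(\<Sum>i<?D'. \<Omega>' (I',i) (J',i)) = (if I' = J' then 1 else 0)"
    if IJ: "I' \<in> tuples dE (Suc n)" "J' \<in> tuples dE (Suc n)" for I' J'
  proof -
    obtain e I f J where I: "I' = e # I" "e < dE" "I \<in> tuples dE n" and J: "J' = f # J" "f < dE" "J \<in> tuples dE n"
      using IJ by (auto simp: tuples_Suc)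
    have "(\<Sum>i<?D'. \<Omega>' (I',i) (J',i))
       = (\<Sum>(i,\<mu>,a,b)\<in>{..<?D'}\<times>{..<N}\<times>{..<?D}\<times>{..<?D}. C \<mu> e i a * \<Omega> (I,a) (J,b) * cnj (C \<mu> f i b))"
      by (simp add: \<Omega>'_def I J sum.cartesian_product case_prod_unfold)
    also have "\<dots> = (\<Sum>(a,b,\<mu>,i)\<in>{..<?D}\<times>{..<?D}\<times>{..<N}\<times>{..<?D'}. C \<mu> e i a * \<Omega> (I,a) (J,b) * cnj (C \<mu> f i b))"
      by (rule sum.reindex_bij_witness[of _ "\<lambda>(a,b,\<mu>,i). (i,\<mu>,a,b)" "\<lambda>(i,\<mu>,a,b). (a,b,\<mu>,i)"]) auto
    also have "\<dots> = (\<Sum>a<?D. \<Sum>b<?D. \<Sum>\<mu><N. \<Sum>i<?D'. C \<mu> e i a * \<Omega> (I,a) (J,b) * cnj (C \<mu> f i b))"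
      by (simp add: sum.cartesian_product case_prod_unfold)
    also have "\<dots> = (\<Sum>a<?D. \<Sum>b<?D. \<Omega> (I,a) (J,b) * (\<Sum>\<mu><N. \<Sum>i<?D'. C \<mu> e i a * cnj (C \<mu> f i b)))"
      unfolding sum_distrib_left by (intro sum.cong refl) (simp add: mult_ac)
    \<comment> \<open>Trace preservation of \<open>F\<close> gives a delta in the new register and
      one in the system index; the second leaves exactly the trace condition for the old
      registers.\<close>
    also have "\<dots> = (\<Sum>a<?D. \<Sum>b<?D. if b = a then (if e = f then \<Omega> (I,a) (J,a) else 0) else 0)"
      using tp I(2) J(2) by (intro sum.cong refl) auto
    also have "\<dots> = (if I' = J' then 1 else 0)"
      unfolding I(1) J(1) using tr[OF I(3) J(3)] by (cases "e = f") auto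
    finally show ?thesis .
  qed
  moreover have "id_tensor r dA dB (env_cell F \<theta> (enc n)) (X enc) $$ (i,j) =
      (\<Sum>I\<in>tuples dE (Suc n). \<Sum>J\<in>tuples dE (Suc n). tensor_entry (\<lambda>l e f. \<theta> (enc l) $$ (e,f)) I J * \<Omega>' (I,i) (J,j))"
    if enc: "\<forall>l<Suc n. enc l < k" and ij: "i < ?D'" "j < ?D'" for enc i j
  proof -
    have enc': "\<forall>l<n. enc l < k" using enc by simp
    let ?T = "tensor_entry (\<lambda>l e f. \<theta> (enc l) $$ (e,f))"
    have "\<theta> (enc n) \<in> carrier_mat dE dE" using \<theta> enc by (simp add: density_def psd_def)
    then have "id_tensor r dA dB (env_cell F \<theta> (enc n)) (X enc) $$ (i,j)
      = (\<Sum>e<dE. \<Sum>f<dE. \<theta> (enc n) $$ (e,f) * (\<Sum>\<mu><N. \<Sum>a<?D. \<Sum>b<?D. C \<mu> e i a * X enc $$ (a,b) * cnj (C \<mu> f j b)))"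
      using C[of \<theta> "enc n" i j] ij by simp
    also have "\<dots> = (\<Sum>e<dE. \<Sum>f<dE. \<theta> (enc n) $$ (e,f) * (\<Sum>\<mu><N. \<Sum>a<?D. \<Sum>b<?D. C \<mu> e i a *
       (\<Sum>I\<in>tuples dE n. \<Sum>J\<in>tuples dE n. ?T I J * \<Omega> (I,a) (J,b)) * cnj (C \<mu> f j b)))"
      using rep[OF enc'] by simp
    also have "\<dots> = (\<Sum>(e,f,\<mu>,a,b,I,J)\<in>{..<dE}\<times>{..<dE}\<times>{..<N}\<times>{..<?D}\<times>{..<?D}\<times>tuples dE n\<times>tuples dE n.
        \<theta> (enc n) $$ (e,f) * (C \<mu> e i a * (?T I J * \<Omega> (I,a) (J,b)) * cnj (C \<mu> f j b)))"
      unfolding sum_distrib_left sum_distrib_right by (simp add: sum.cartesian_product case_prod_unfold)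
    also have "\<dots> = (\<Sum>(e,I,f,J,\<mu>,a,b)\<in>{..<dE}\<times>tuples dE n\<times>{..<dE}\<times>tuples dE n\<times>{..<N}\<times>{..<?D}\<times>{..<?D}.
        \<theta> (enc n) $$ (e,f) * (C \<mu> e i a * (?T I J * \<Omega> (I,a) (J,b)) * cnj (C \<mu> f j b)))"
      by (rule sum.reindex_bij_witness[of _ "\<lambda>(e,I,f,J,\<mu>,a,b). (e,f,\<mu>,a,b,I,J)" "\<lambda>(e,f,\<mu>,a,b,I,J). (e,I,f,J,\<mu>,a,b)"]) auto
    also have "\<dots> = (\<Sum>e<dE. \<Sum>I\<in>tuples dE n. \<Sum>f<dE. \<Sum>J\<in>tuples dE n. \<Sum>\<mu><N. \<Sum>a<?D. \<Sum>b<?D.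
        \<theta> (enc n) $$ (e,f) * (C \<mu> e i a * (?T I J * \<Omega> (I,a) (J,b)) * cnj (C \<mu> f j b)))"
      by (simp add: sum.cartesian_product case_prod_unfold)
    also have "\<dots> = (\<Sum>e<dE. \<Sum>I\<in>tuples dE n. \<Sum>f<dE. \<Sum>J\<in>tuples dE n. ?T (e # I) (f # J) * \<Omega>' (e # I,i) (f # J,j))"
      unfolding \<Omega>'_def sum_distrib_left by (intro sum.cong refl) (simp add: length_tuples mult_ac)
    finally show ?thesis unfolding sum_tuples_Suc .
  qed
  ultimately have "open_state \<theta> k dE (Suc n) ?D' (\<lambda>enc. id_tensor r dA dB (env_cell F \<theta> (enc n)) (X enc)) \<Omega>'"
    unfolding open_state_def by (auto simp: id_tensor_def)
  then show ?thesis by blast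
qed

text \<open>The interleaved channels act on the system alone and are the same for all messages, so
  the register indices pass through unchanged.\<close>

lemma open_state_channel:
  assumes X: "open_state \<theta> k d n D X \<Omega>" and \<Phi>: "is_channel D D' \<Phi>"
  shows "\<exists>\<Omega>'. open_state \<theta> k d n D' (\<lambda>enc. \<Phi> (X enc)) \<Omega>'"
proof -
  obtain A :: "nat \<Rightarrow> nat \<Rightarrow> nat \<Rightarrow> complex" and N :: nat where
    tp: "\<And>a b. a < D \<Longrightarrow> b < D \<Longrightarrow> (\<Sum>\<mu><N. \<Sum>i<D'. A \<mu> i a * cnj (A \<mu> i b)) = (if a = b then 1 else 0)"
    and cl: "\<And>\<rho>. \<rho> \<in> carrier_mat D D \<Longrightarrow> \<Phi> \<rho> \<in> carrier_mat D' D'"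
    and A: "\<And>\<rho> i j. \<rho> \<in> carrier_mat D D \<Longrightarrow> i < D' \<Longrightarrow> j < D' \<Longrightarrow>
      \<Phi> \<rho> $$ (i,j) = (\<Sum>\<mu><N. \<Sum>a<D. \<Sum>b<D. A \<mu> i a * \<rho> $$ (a,b) * cnj (A \<mu> j b))"
    by (rule channel_kraus_entries[OF \<Phi>], rule that)
  have psd: "psd_kernel (tuples d n \<times> {..<D}) \<Omega>"
    and tr: "\<And>I J. I \<in> tuples d n \<Longrightarrow> J \<in> tuples d n \<Longrightarrow> (\<Sum>a<D. \<Omega> (I,a) (J,a)) = (if I = J then 1 else 0)"
    and Xc: "\<And>enc. \<forall>i<n. enc i < k \<Longrightarrow> X enc \<in> carrier_mat D D"
    and rep: "\<And>enc a b. \<forall>i<n. enc i < k \<Longrightarrow> a < D \<Longrightarrow> b < D \<Longrightarrow> X enc $$ (a,b) =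
       (\<Sum>I\<in>tuples d n. \<Sum>J\<in>tuples d n. tensor_entry (\<lambda>l e f. \<theta> (enc l) $$ (e,f)) I J * \<Omega> (I,a) (J,b))"
    using X unfolding open_state_def by blast+
  define \<Omega>' where "\<Omega>' p q = (\<Sum>\<mu><N. \<Sum>a<D. \<Sum>b<D.
    A \<mu> (snd p) a * \<Omega> (fst p, a) (fst q, b) * cnj (A \<mu> (snd q) b))" for p q
  have "psd_kernel (tuples d n \<times> {..<D'}) \<Omega>'"
    unfolding \<Omega>'_def
    by (rule psd_kernel_kraus[OF psd finite_tuples, where C = "\<lambda>\<mu> I. A \<mu>" and t = "\<lambda>I. I"]) auto
  moreover have "(\<Sum>i<D'. \<Omega>' (I,i) (J,i)) = (if I = J then 1 else 0)"
    if IJ: "I \<in> tuples d n" "J \<in> tuples d n" for I J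
  proof -
    have "(\<Sum>i<D'. \<Omega>' (I,i) (J,i))
       = (\<Sum>(i,\<mu>,a,b)\<in>{..<D'}\<times>{..<N}\<times>{..<D}\<times>{..<D}. A \<mu> i a * \<Omega> (I,a) (J,b) * cnj (A \<mu> i b))"
      by (simp add: \<Omega>'_def sum.cartesian_product case_prod_unfold)
    also have "\<dots> = (\<Sum>(a,b,\<mu>,i)\<in>{..<D}\<times>{..<D}\<times>{..<N}\<times>{..<D'}. A \<mu> i a * \<Omega> (I,a) (J,b) * cnj (A \<mu> i b))"
      by (rule sum.reindex_bij_witness[of _ "\<lambda>(a,b,\<mu>,i). (i,\<mu>,a,b)" "\<lambda>(i,\<mu>,a,b). (a,b,\<mu>,i)"]) auto
    also have "\<dots> = (\<Sum>a<D. \<Sum>b<D. \<Sum>\<mu><N. \<Sum>i<D'. A \<mu> i a * \<Omega> (I,a) (J,b) * cnj (A \<mu> i b))"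
      by (simp add: sum.cartesian_product case_prod_unfold)
    also have "\<dots> = (\<Sum>a<D. \<Sum>b<D. \<Omega> (I,a) (J,b) * (\<Sum>\<mu><N. \<Sum>i<D'. A \<mu> i a * cnj (A \<mu> i b)))"
      unfolding sum_distrib_left by (intro sum.cong refl) (simp add: mult_ac)
    also have "\<dots> = (\<Sum>a<D. \<Sum>b<D. if b = a then \<Omega> (I,a) (J,a) else 0)"
      using tp by (intro sum.cong refl) auto
    also have "\<dots> = (if I = J then 1 else 0)"
      using tr[OF IJ] by simp
    finally show ?thesis .
  qed
  moreover have "\<Phi> (X enc) $$ (i,j) =
      (\<Sum>I\<in>tuples d n. \<Sum>J\<in>tuples d n. tensor_entry (\<lambda>l e f. \<theta> (enc l) $$ (e,f)) I J * \<Omega>' (I,i) (J,j))"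
    if enc: "\<forall>l<n. enc l < k" and ij: "i < D'" "j < D'" for enc i j
  proof -
    let ?T = "tensor_entry (\<lambda>l e f. \<theta> (enc l) $$ (e,f))"
    have "\<Phi> (X enc) $$ (i,j) = (\<Sum>\<mu><N. \<Sum>a<D. \<Sum>b<D. A \<mu> i a *
       (\<Sum>I\<in>tuples d n. \<Sum>J\<in>tuples d n. ?T I J * \<Omega> (I,a) (J,b)) * cnj (A \<mu> j b))"
      using A[OF Xc[OF enc] ij] rep[OF enc] by simp
    also have "\<dots> = (\<Sum>(\<mu>,a,b,I,J)\<in>{..<N}\<times>{..<D}\<times>{..<D}\<times>tuples d n\<times>tuples d n.
        A \<mu> i a * (?T I J * \<Omega> (I,a) (J,b)) * cnj (A \<mu> j b))"
      unfolding sum_distrib_left sum_distrib_right by (simp add: sum.cartesian_product case_prod_unfold)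
    also have "\<dots> = (\<Sum>(I,J,\<mu>,a,b)\<in>tuples d n\<times>tuples d n\<times>{..<N}\<times>{..<D}\<times>{..<D}.
        A \<mu> i a * (?T I J * \<Omega> (I,a) (J,b)) * cnj (A \<mu> j b))"
      by (rule sum.reindex_bij_witness[of _ "\<lambda>(I,J,\<mu>,a,b). (\<mu>,a,b,I,J)" "\<lambda>(\<mu>,a,b,I,J). (I,J,\<mu>,a,b)"]) auto
    also have "\<dots> = (\<Sum>I\<in>tuples d n. \<Sum>J\<in>tuples d n. \<Sum>\<mu><N. \<Sum>a<D. \<Sum>b<D.
        A \<mu> i a * (?T I J * \<Omega> (I,a) (J,b)) * cnj (A \<mu> j b))"
      by (simp add: sum.cartesian_product case_prod_unfold)
    also have "\<dots> = (\<Sum>I\<in>tuples d n. \<Sum>J\<in>tuples d n. ?T I J * \<Omega>' (I,i) (J,j))"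
      unfolding \<Omega>'_def sum_distrib_left by (intro sum.cong refl) (simp add: mult_ac)
    finally show ?thesis .
  qed
  ultimately have "open_state \<theta> k d n D' (\<lambda>enc. \<Phi> (X enc)) \<Omega>'"
    unfolding open_state_def using cl Xc by auto
  then show ?thesis by blast
qed

lemma open_state_proto_state:
  assumes F: "is_channel (dA * dE) dB F" and \<theta>: "\<forall>x<k. density dE (\<theta> x)"
    and \<rho>0: "density (r 0 * dA) \<rho>0"
    and Ad: "\<forall>i. Suc i < n \<longrightarrow> is_channel (r i * dB) (r (Suc i) * dA) (Ad i)"
  shows "i < n \<Longrightarrow> \<exists>\<Omega>. open_state \<theta> k dE i (r i * dA)
    (\<lambda>enc. proto_state r dA dB (\<lambda>l. env_cell F \<theta> (enc l)) Ad \<rho>0 i) \<Omega>"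
proof (induction i)
  case 0
  then show ?case using open_state_initial[OF \<rho>0] by auto
next
  case (Suc i)
  then obtain \<Omega> where "open_state \<theta> k dE i (r i * dA)
    (\<lambda>enc. proto_state r dA dB (\<lambda>l. env_cell F \<theta> (enc l)) Ad \<rho>0 i) \<Omega>" by auto
  from open_state_env_cell[OF this F \<theta>] obtain \<Omega>' where "open_state \<theta> k dE (Suc i) (r i * dB)
    (\<lambda>enc. id_tensor (r i) dA dB (env_cell F \<theta> (enc i)) (proto_state r dA dB (\<lambda>l. env_cell F \<theta> (enc l)) Ad \<rho>0 i)) \<Omega>'"
    by blast
  from open_state_channel[OF this] Ad Suc.prems show ?case by auto
qed

text \<open>Pulling the POVM back through the open protocol turns adaptive discrimination of
  channels into a single collective measurement \<open>B\<close> of product states. Completeness of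
  \<open>B\<close> combines completeness of \<open>\<Lambda>\<close> with the trace condition on
  \<open>\<Omega>\<close>.\<close>

lemma reading_protocol_kernels:
  assumes F: "is_channel (dA * dE) dB F" and \<theta>: "\<forall>x<k. density dE (\<theta> x)"
    and prot: "reading_protocol (env_cell F \<theta>) k dA dB n M \<epsilon>" and n: "1 \<le> n"
  shows "\<exists>enc B. (\<forall>m<M. \<forall>i<n. enc m i < k) \<and> (\<forall>m<M. psd_kernel (tuples dE n) (B m)) \<and>
    (\<forall>I\<in>tuples dE n. \<forall>J\<in>tuples dE n. (\<Sum>m<M. B m I J) = (if I = J then 1 else 0)) \<and>
    1 - \<epsilon> \<le> (1 / real M) * (\<Sum>m<M. Re (\<Sum>I\<in>tuples dE n. \<Sum>J\<in>tuples dE n.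
       tensor_entry (\<lambda>l e f. \<theta> (enc m l) $$ (e,f)) I J * B m I J))"
proof -
  obtain enc r \<rho>0 Ad \<Lambda> where enc: "\<forall>m<M. \<forall>i<n. enc m i < k"
    and \<rho>0: "density (r 0 * dA) \<rho>0"
    and Ad: "\<forall>i. Suc i < n \<longrightarrow> is_channel (r i * dB) (r (Suc i) * dA) (Ad i)"
    and \<Lambda>: "\<forall>m<M. psd (r (n - 1) * dB) (\<Lambda> m)"
    and one: "msum (r (n - 1) * dB) (r (n - 1) * dB) \<Lambda> M = 1\<^sub>m (r (n - 1) * dB)"
    and succ: "(1 / real M) * (\<Sum>m<M. Re (tr (\<Lambda> m *
          proto_output r dA dB (\<lambda>i. env_cell F \<theta> (enc m i)) Ad \<rho>0 n))) \<ge> 1 - \<epsilon>"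
    using prot unfolding reading_protocol_def by blast
  let ?D = "r (n - 1) * dB"
  let ?X = "\<lambda>enc. proto_output r dA dB (\<lambda>l. env_cell F \<theta> (enc l)) Ad \<rho>0 n"
  \<comment> \<open>The output ends with a cell call and not with an interleaved channel, so the
    last complete round is number \<open>n - 1\<close> and the final call is added
    separately.\<close>
  have "n - 1 < n" using n by simp
  from open_state_proto_state[OF F \<theta> \<rho>0 Ad this]
  obtain \<Omega>0 where "open_state \<theta> k dE (n - 1) (r (n - 1) * dA)
    (\<lambda>enc. proto_state r dA dB (\<lambda>l. env_cell F \<theta> (enc l)) Ad \<rho>0 (n - 1)) \<Omega>0" by blast
  from open_state_env_cell[OF this F \<theta>] obtain \<Omega> where "open_state \<theta> k dE n ?D ?X \<Omega>"
    using n by (auto simp: proto_output_def)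
  then have psd: "psd_kernel (tuples dE n \<times> {..<?D}) \<Omega>"
    and tr: "\<And>I J. I \<in> tuples dE n \<Longrightarrow> J \<in> tuples dE n \<Longrightarrow> (\<Sum>a<?D. \<Omega> (I,a) (J,a)) = (if I = J then 1 else 0)"
    and Xc: "\<And>enc. \<forall>i<n. enc i < k \<Longrightarrow> ?X enc \<in> carrier_mat ?D ?D"
    and rep: "\<And>enc a b. \<forall>i<n. enc i < k \<Longrightarrow> a < ?D \<Longrightarrow> b < ?D \<Longrightarrow> ?X enc $$ (a,b) =
       (\<Sum>I\<in>tuples dE n. \<Sum>J\<in>tuples dE n. tensor_entry (\<lambda>l e f. \<theta> (enc l) $$ (e,f)) I J * \<Omega> (I,a) (J,b))"
    unfolding open_state_def by blast+
  define B where "B m I J = (\<Sum>a<?D. \<Sum>b<?D. \<Omega> (I,a) (J,b) * \<Lambda> m $$ (b,a))" for m I J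
  have \<Lambda>c: "\<Lambda> m \<in> carrier_mat ?D ?D" if "m < M" for m using \<Lambda> that by (simp add: psd_def)
  have "psd_kernel (tuples dE n) (B m)" if m: "m < M" for m
  proof -
    have "dag (\<Lambda> m) = \<Lambda> m" using \<Lambda> m by (simp add: psd_def)
    then obtain v l where v: "spectral_decomp ?D (\<Lambda> m) v l"
      using hermitian_spectral_decomp[OF \<Lambda>c[OF m]] by blast
    have l0: "0 \<le> l j" if "j < ?D" for j using eigenvalue_nonneg[OF v] \<Lambda> m that by blast
    \<comment> \<open>Giving \<open>sqrt (l j)\<close> to either side of \<open>\<Omega>\<close>
      writes \<open>B m\<close> as a sum of congruences, one for each eigenvector of the POVM
      element.\<close>
    have eq: "B m I J = (\<Sum>j<?D. \<Sum>a<?D. \<Sum>b<?D.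
       (of_real (sqrt (l j)) * cnj (v j a)) * \<Omega> (I,a) (J,b) * cnj (of_real (sqrt (l j)) * cnj (v j b)))" for I J
    proof -
      have "B m I J = (\<Sum>a<?D. \<Sum>b<?D. \<Sum>j<?D. \<Omega> (I,a) (J,b) * (of_real (l j) * v j b * cnj (v j a)))"
        using v unfolding B_def spectral_decomp_def by (simp add: sum_distrib_left)
      also have "\<dots> = (\<Sum>a<?D. \<Sum>j<?D. \<Sum>b<?D. \<Omega> (I,a) (J,b) * (of_real (l j) * v j b * cnj (v j a)))"
        by (intro sum.cong refl sum.swap)
      also have "\<dots> = (\<Sum>j<?D. \<Sum>a<?D. \<Sum>b<?D. \<Omega> (I,a) (J,b) * (of_real (l j) * v j b * cnj (v j a)))"
        by (rule sum.swap)
      also have "\<dots> = (\<Sum>j<?D. \<Sum>a<?D. \<Sum>b<?D.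
       (of_real (sqrt (l j)) * cnj (v j a)) * \<Omega> (I,a) (J,b) * cnj (of_real (sqrt (l j)) * cnj (v j b)))"
      proof (intro sum.cong refl)
        fix j a b assume "j \<in> {..<?D}"
        then have "complex_of_real (l j) = of_real (sqrt (l j)) * of_real (sqrt (l j))"
          using l0[of j] by (simp flip: of_real_mult)
        then show "\<Omega> (I,a) (J,b) * (of_real (l j) * v j b * cnj (v j a)) =
          (of_real (sqrt (l j)) * cnj (v j a)) * \<Omega> (I,a) (J,b) * cnj (of_real (sqrt (l j)) * cnj (v j b))"
          by (simp add: mult_ac)
      qed
      finally show ?thesis .
    qed
    \<comment> \<open>The measurement leaves no system; a dummy of dimension 1 makes the lemma on
      Kraus operators applicable.\<close>
    have "psd_kernel (tuples dE n \<times> {..<1::nat}) (\<lambda>p q. B m (fst p) (fst q))"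
      unfolding eq
      by (rule psd_kernel_kraus[OF psd finite_tuples, where t = "\<lambda>I. I" and
        C = "\<lambda>j I i a. of_real (sqrt (l j)) * cnj (v j a)"]) auto
    then show ?thesis
      unfolding psd_kernel_def
    proof (intro allI)
      fix \<phi> :: "nat list \<Rightarrow> complex"
      assume *: "\<forall>\<phi>. 0 \<le> Re (\<Sum>p\<in>tuples dE n \<times> {..<1::nat}. \<Sum>q\<in>tuples dE n \<times> {..<1}. \<phi> p * cnj (\<phi> q) * B m (fst p) (fst q))"
      have fst: "(\<Sum>p\<in>tuples dE n \<times> {..<1::nat}. g (fst p)) = (\<Sum>I\<in>tuples dE n. g I)" for g :: "nat list \<Rightarrow> complex"
        by (rule sum.reindex_bij_witness[of _ "\<lambda>I. (I,0)" fst]) auto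
      have "(\<Sum>p\<in>tuples dE n \<times> {..<1::nat}. \<Sum>q\<in>tuples dE n \<times> {..<1::nat}. h (fst p) (fst q))
        = (\<Sum>I\<in>tuples dE n. \<Sum>J\<in>tuples dE n. h I J)" for h :: "nat list \<Rightarrow> nat list \<Rightarrow> complex"
        by (subst fst, subst fst) (rule refl)
      from this[of "\<lambda>I J. \<phi> I * cnj (\<phi> J) * B m I J"]
      show "0 \<le> Re (\<Sum>p\<in>tuples dE n. \<Sum>q\<in>tuples dE n. \<phi> p * cnj (\<phi> q) * B m p q)"
        using *[rule_format, of "\<lambda>p. \<phi> (fst p)"] by (simp only:)
    qed
  qed
  moreover have "(\<Sum>m<M. B m I J) = (if I = J then 1 else 0)" if IJ: "I \<in> tuples dE n" "J \<in> tuples dE n" for I J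
  proof -
    have "(\<Sum>m<M. B m I J) = (\<Sum>a<?D. \<Sum>m<M. \<Sum>b<?D. \<Omega> (I,a) (J,b) * \<Lambda> m $$ (b,a))"
      unfolding B_def by (rule sum.swap)
    also have "\<dots> = (\<Sum>a<?D. \<Sum>b<?D. \<Sum>m<M. \<Omega> (I,a) (J,b) * \<Lambda> m $$ (b,a))"
      by (intro sum.cong refl sum.swap)
    also have "\<dots> = (\<Sum>a<?D. \<Sum>b<?D. \<Omega> (I,a) (J,b) * msum ?D ?D \<Lambda> M $$ (b,a))"
      by (intro sum.cong refl) (simp add: msum_def sum_distrib_left)
    also have "\<dots> = (\<Sum>a<?D. \<Sum>b<?D. if b = a then \<Omega> (I,a) (J,a) else 0)"
      unfolding one by (intro sum.cong refl) auto
    also have "\<dots> = (if I = J then 1 else 0)" using tr[OF IJ] by simp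
    finally show ?thesis .
  qed
  moreover have "tr (\<Lambda> m * ?X (enc m)) = (\<Sum>I\<in>tuples dE n. \<Sum>J\<in>tuples dE n.
       tensor_entry (\<lambda>l e f. \<theta> (enc m l) $$ (e,f)) I J * B m I J)" if m: "m < M" for m
  proof -
    let ?T = "tensor_entry (\<lambda>l e f. \<theta> (enc m l) $$ (e,f))"
    have e: "\<forall>i<n. enc m i < k" using enc m by simp
    have "tr (\<Lambda> m * ?X (enc m)) = (\<Sum>b<?D. \<Sum>a<?D. \<Lambda> m $$ (b,a) * ?X (enc m) $$ (a,b))"
      using \<Lambda>c[OF m] unfolding tr_def
      by (intro sum.cong) (auto simp: index_mult_sum[OF \<Lambda>c[OF m] Xc[OF e]] simp del: index_mult_mat(1))
    also have "\<dots> = (\<Sum>b<?D. \<Sum>a<?D. \<Lambda> m $$ (b,a) * (\<Sum>I\<in>tuples dE n. \<Sum>J\<in>tuples dE n. ?T I J * \<Omega> (I,a) (J,b)))"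
      using rep[OF e] by simp
    also have "\<dots> = (\<Sum>(b,a,I,J)\<in>{..<?D}\<times>{..<?D}\<times>tuples dE n\<times>tuples dE n. \<Lambda> m $$ (b,a) * (?T I J * \<Omega> (I,a) (J,b)))"
      unfolding sum_distrib_left by (simp add: sum.cartesian_product case_prod_unfold)
    also have "\<dots> = (\<Sum>(I,J,a,b)\<in>tuples dE n\<times>tuples dE n\<times>{..<?D}\<times>{..<?D}. \<Lambda> m $$ (b,a) * (?T I J * \<Omega> (I,a) (J,b)))"
      by (rule sum.reindex_bij_witness[of _ "\<lambda>(I,J,a,b). (b,a,I,J)" "\<lambda>(b,a,I,J). (I,J,a,b)"]) auto
    also have "\<dots> = (\<Sum>I\<in>tuples dE n. \<Sum>J\<in>tuples dE n. \<Sum>a<?D. \<Sum>b<?D. \<Lambda> m $$ (b,a) * (?T I J * \<Omega> (I,a) (J,b)))"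
      by (simp add: sum.cartesian_product case_prod_unfold)
    also have "\<dots> = (\<Sum>I\<in>tuples dE n. \<Sum>J\<in>tuples dE n. ?T I J * B m I J)"
      unfolding B_def sum_distrib_left by (intro sum.cong refl) (simp add: mult_ac)
    finally show ?thesis .
  qed
  ultimately show ?thesis using enc succ by (intro exI[of _ enc] exI[of _ B]) simp
qed

section \<open>Product states, typical sets and tests\<close>

fun tuple_prod :: "(nat \<Rightarrow> nat \<Rightarrow> 'a::comm_monoid_mult) \<Rightarrow> nat list \<Rightarrow> 'a" where
  "tuple_prod c [] = 1"
| "tuple_prod c (e # I) = c (length I) e * tuple_prod c I"

fun tuple_sum :: "(nat \<Rightarrow> nat \<Rightarrow> 'a::comm_monoid_add) \<Rightarrow> nat list \<Rightarrow> 'a" where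
  "tuple_sum c [] = 0"
| "tuple_sum c (e # I) = c (length I) e + tuple_sum c I"

lemma tuples_SucE:
  assumes "I \<in> tuples d (Suc n)"
  obtains e I' where "I = e # I'" "e < d" "I' \<in> tuples d n" "length I' = n"
  using assms by (auto simp: tuples_Suc length_tuples)

section \<open>Algebra of product operators\<close>

lemma tensor_entry_cong:
  assumes "I \<in> tuples d n" "J \<in> tuples d n"
    and "\<And>l e f. l < n \<Longrightarrow> e < d \<Longrightarrow> f < d \<Longrightarrow> S l e f = T l e f"
  shows "tensor_entry S I J = tensor_entry T I J"
  using assms
proof (induction n arbitrary: I J)
  case (Suc n)
  from Suc.prems(1,2) show ?case
    by (elim tuples_SucE) (simp add: Suc.prems(3) Suc.IH)
qed simp

lemma tensor_entry_mult:
  assumes "I \<in> tuples d n" "K \<in> tuples d n"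
  shows "(\<Sum>J\<in>tuples d n. tensor_entry S I J * tensor_entry T J K)
    = tensor_entry (\<lambda>l e g. \<Sum>f<d. S l e f * T l f g) I K"
  using assms
proof (induction n arbitrary: I K)
  case (Suc n)
  obtain e I' where I: "I = e # I'" "I' \<in> tuples d n" using Suc.prems(1) by (rule tuples_SucE)
  obtain g K' where K: "K = g # K'" "K' \<in> tuples d n" using Suc.prems(2) by (rule tuples_SucE)
  have "(\<Sum>J\<in>tuples d (Suc n). tensor_entry S I J * tensor_entry T J K)
    = (\<Sum>f<d. \<Sum>J\<in>tuples d n. (S n e f * T n f g) * (tensor_entry S I' J * tensor_entry T J K'))"
    unfolding sum_tuples_Suc I K using I by (intro sum.cong refl) (simp add: length_tuples)
  also have "\<dots> = (\<Sum>f<d. S n e f * T n f g) * (\<Sum>J\<in>tuples d n. tensor_entry S I' J * tensor_entry T J K')"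
    by (simp add: sum_distrib_left sum_distrib_right sum.swap[of _ "tuples d n"])
  finally show ?case using Suc.IH[OF I(2) K(2)] I K by (simp add: length_tuples)
qed simp

lemma tensor_entry_mult_cnj:
  assumes "I \<in> tuples d n" "K \<in> tuples d n"
  shows "(\<Sum>J\<in>tuples d n. tensor_entry S I J * cnj (tensor_entry T K J))
    = tensor_entry (\<lambda>l e g. \<Sum>f<d. S l e f * cnj (T l g f)) I K"
  using assms
proof (induction n arbitrary: I K)
  case (Suc n)
  obtain e I' where I: "I = e # I'" "I' \<in> tuples d n" using Suc.prems(1) by (rule tuples_SucE)
  obtain g K' where K: "K = g # K'" "K' \<in> tuples d n" using Suc.prems(2) by (rule tuples_SucE)
  have "(\<Sum>J\<in>tuples d (Suc n). tensor_entry S I J * cnj (tensor_entry T K J))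
    = (\<Sum>f<d. \<Sum>J\<in>tuples d n. (S n e f * cnj (T n g f)) * (tensor_entry S I' J * cnj (tensor_entry T K' J)))"
    unfolding sum_tuples_Suc I K using I K by (intro sum.cong refl) (simp add: length_tuples)
  also have "\<dots> = (\<Sum>f<d. S n e f * cnj (T n g f)) * (\<Sum>J\<in>tuples d n. tensor_entry S I' J * cnj (tensor_entry T K' J))"
    by (simp add: sum_distrib_left sum_distrib_right sum.swap[of _ "tuples d n"])
  finally show ?case using Suc.IH[OF I(2) K(2)] I K by (simp add: length_tuples)
qed simp

text \<open>Expanding the product of sums yields products of eigenvectors with products of
  eigenvalues. With all weights 1 the same identity gives resolutions of the identity.\<close>

lemma tensor_entry_spectral:
  assumes "I \<in> tuples d n" "K \<in> tuples d n"
  shows "tensor_entry (\<lambda>l e f. \<Sum>j<d. c l j * U l j e * cnj (U l j f)) I K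
    = (\<Sum>J\<in>tuples d n. tuple_prod c J * tensor_entry U J I * cnj (tensor_entry U J K))"
  using assms
proof (induction n arbitrary: I K)
  case (Suc n)
  obtain e I' where I: "I = e # I'" "I' \<in> tuples d n" using Suc.prems(1) by (rule tuples_SucE)
  obtain g K' where K: "K = g # K'" "K' \<in> tuples d n" using Suc.prems(2) by (rule tuples_SucE)
  have "(\<Sum>J\<in>tuples d (Suc n). tuple_prod c J * tensor_entry U J I * cnj (tensor_entry U J K))
    = (\<Sum>f<d. \<Sum>J\<in>tuples d n. (c n f * U n f e * cnj (U n f g)) *
        (tuple_prod c J * tensor_entry U J I' * cnj (tensor_entry U J K')))"
    unfolding sum_tuples_Suc I K by (intro sum.cong refl) (simp add: length_tuples)
  also have "\<dots> = (\<Sum>f<d. c n f * U n f e * cnj (U n f g)) *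
      (\<Sum>J\<in>tuples d n. tuple_prod c J * tensor_entry U J I' * cnj (tensor_entry U J K'))"
    by (simp add: sum_distrib_left sum_distrib_right sum.swap[of _ "tuples d n"])
  finally show ?case using Suc.IH[OF I(2) K(2)] I K by (simp add: length_tuples)
qed simp

lemma tensor_entry_identity:
  assumes "I \<in> tuples d n" "K \<in> tuples d n"
  shows "tensor_entry (\<lambda>l e f. if e = f then 1 else 0) I K = (if I = K then 1 else 0)"
  using assms
proof (induction n arbitrary: I K)
  case (Suc n)
  from Suc.prems show ?case by (elim tuples_SucE) (auto simp: Suc.IH)
qed simp

lemma tensor_entry_diagonal: "tensor_entry T I I = tuple_prod (\<lambda>l e. T l e e) I"
  by (induction I) auto

section \<open>Product weights, logarithmic weights and deviations\<close>

lemma tuple_prod_cong: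
  assumes "I \<in> tuples d n" "\<And>l e. l < n \<Longrightarrow> e < d \<Longrightarrow> c l e = c' l e"
  shows "tuple_prod c I = tuple_prod c' I"
  using assms
proof (induction n arbitrary: I)
  case (Suc n)
  from Suc.prems(1) show ?case by (rule tuples_SucE) (simp add: Suc.prems(2) Suc.IH)
qed simp

lemma tuple_prod_of_real: "tuple_prod (\<lambda>l e. of_real (c l e)) I = (of_real (tuple_prod c I) :: complex)"
  by (induction I) auto

lemma tuple_prod_one: "tuple_prod (\<lambda>l e. 1) I = 1"
  by (induction I) auto

lemma tuple_prod_nonneg:
  fixes c :: "nat \<Rightarrow> nat \<Rightarrow> real"
  assumes "I \<in> tuples d n" "\<And>l e. l < n \<Longrightarrow> e < d \<Longrightarrow> 0 \<le> c l e"
  shows "0 \<le> tuple_prod c I"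
  using assms
proof (induction n arbitrary: I)
  case (Suc n)
  from Suc.prems(1) show ?case by (rule tuples_SucE) (simp add: Suc.prems(2) Suc.IH)
qed simp

lemma sum_tuple_prod:
  fixes c :: "nat \<Rightarrow> nat \<Rightarrow> real"
  assumes "\<And>l. l < n \<Longrightarrow> (\<Sum>e<d. c l e) = 1"
  shows "(\<Sum>I\<in>tuples d n. tuple_prod c I) = 1"
  using assms
proof (induction n)
  case (Suc n)
  have "(\<Sum>I\<in>tuples d (Suc n). tuple_prod c I) = (\<Sum>e<d. c n e) * (\<Sum>I\<in>tuples d n. tuple_prod c I)"
    unfolding sum_tuples_Suc sum_product by (intro sum.cong refl) (simp add: length_tuples)
  then show ?case using Suc by simp
qed simp

text \<open>The junk value \<open>log 2 0 = 0\<close> is harmless in this direction only, because \<open>0 \<le> 2 powr 0\<close>.\<close>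
lemma tuple_prod_le_powr:
  fixes c :: "nat \<Rightarrow> nat \<Rightarrow> real"
  assumes "I \<in> tuples d n" "\<And>l e. l < n \<Longrightarrow> e < d \<Longrightarrow> 0 \<le> c l e"
  shows "tuple_prod c I \<le> 2 powr (tuple_sum (\<lambda>l e. log 2 (c l e)) I)"
  using assms
proof (induction n arbitrary: I)
  case (Suc n)
  obtain e I' where I: "I = e # I'" "e < d" "I' \<in> tuples d n" "length I' = n"
    using Suc.prems(1) by (rule tuples_SucE)
  have "c n e \<le> 2 powr (log 2 (c n e))" using Suc.prems(2)[of n e] I by (cases "c n e = 0") auto
  then have "c n e * tuple_prod c I' \<le> 2 powr (log 2 (c n e)) * 2 powr (tuple_sum (\<lambda>l e. log 2 (c l e)) I')"
    using Suc.IH[OF I(3)] Suc.prems(2) tuple_prod_nonneg[OF I(3)] by (intro mult_mono) auto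
  then show ?case using I by (simp add: powr_add)
qed simp

text \<open>A nonzero product has only positive factors, so no junk logarithm occurs. The lower
  bound on the weight obtained from this equality limits the number of typical tuples.\<close>

lemma tuple_prod_eq_powr:
  fixes c :: "nat \<Rightarrow> nat \<Rightarrow> real"
  assumes "I \<in> tuples d n" "\<And>l e. l < n \<Longrightarrow> e < d \<Longrightarrow> 0 \<le> c l e" "tuple_prod c I \<noteq> 0"
  shows "tuple_prod c I = 2 powr (tuple_sum (\<lambda>l e. log 2 (c l e)) I)"
  using assms
proof (induction n arbitrary: I)
  case (Suc n)
  obtain e I' where I: "I = e # I'" "e < d" "I' \<in> tuples d n" "length I' = n"
    using Suc.prems(1) by (rule tuples_SucE)
  have "0 < c n e" "tuple_prod c I' \<noteq> 0" using Suc.prems(2)[of n e] Suc.prems(3) I by auto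
  then show ?case using I Suc.IH[OF I(3)] Suc.prems(2) by (simp add: powr_add)
qed simp

text \<open>Absolute continuity passes from the factors to the product weights.\<close>

lemma tuple_prod_eq_0_transfer:
  fixes c w :: "nat \<Rightarrow> nat \<Rightarrow> real"
  assumes "I \<in> tuples d n" "tuple_prod c I = 0" "\<And>l e. l < n \<Longrightarrow> e < d \<Longrightarrow> c l e = 0 \<Longrightarrow> w l e = 0"
  shows "tuple_prod w I = 0"
  using assms
proof (induction n arbitrary: I)
  case (Suc n)
  obtain e I' where I: "I = e # I'" "e < d" "I' \<in> tuples d n" "length I' = n"
    using Suc.prems(1) by (rule tuples_SucE)
  show ?case using Suc.prems(2,3) Suc.IH[OF I(3)] I by auto
qed simp

text \<open>Independent centred terms: the variance of the sum is the sum of the variances. The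
  first moment is carried along because the cross term of the induction step contains it.\<close>

lemma second_moment_tuple_sum:
  fixes w h :: "nat \<Rightarrow> nat \<Rightarrow> real"
  assumes "\<And>l. l < n \<Longrightarrow> (\<Sum>e<d. w l e) = 1" "\<And>l. l < n \<Longrightarrow> (\<Sum>e<d. w l e * h l e) = 0"
  shows "(\<Sum>I\<in>tuples d n. tuple_prod w I * tuple_sum h I) = 0 \<and>
    (\<Sum>I\<in>tuples d n. tuple_prod w I * (tuple_sum h I)\<^sup>2) = (\<Sum>l<n. \<Sum>e<d. w l e * (h l e)\<^sup>2)"
  using assms
proof (induction n)
  case (Suc n)
  let ?P = "\<lambda>I. tuple_prod w I" and ?S = "\<lambda>I. tuple_sum h I"
  have IH: "(\<Sum>I\<in>tuples d n. ?P I * ?S I) = 0"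
    "(\<Sum>I\<in>tuples d n. ?P I * (?S I)\<^sup>2) = (\<Sum>l<n. \<Sum>e<d. w l e * (h l e)\<^sup>2)"
    using Suc by auto
  have one: "(\<Sum>I\<in>tuples d n. ?P I) = 1" by (rule sum_tuple_prod) (use Suc.prems in simp)
  have w: "(\<Sum>e<d. w n e) = 1" "(\<Sum>e<d. w n e * h n e) = 0" using Suc.prems by auto
  have "(\<Sum>I\<in>tuples d (Suc n). ?P I * ?S I)
     = (\<Sum>e<d. \<Sum>I\<in>tuples d n. (w n e * h n e) * ?P I + w n e * (?P I * ?S I))"
    unfolding sum_tuples_Suc by (intro sum.cong refl) (simp add: length_tuples algebra_simps)
  also have "\<dots> = (\<Sum>e<d. w n e * h n e) * (\<Sum>I\<in>tuples d n. ?P I) + (\<Sum>e<d. w n e) * (\<Sum>I\<in>tuples d n. ?P I * ?S I)"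
    unfolding sum_product sum.distrib ..
  finally have 1: "(\<Sum>I\<in>tuples d (Suc n). ?P I * ?S I) = 0" using w IH by simp
  have "(\<Sum>I\<in>tuples d (Suc n). ?P I * (?S I)\<^sup>2)
     = (\<Sum>e<d. \<Sum>I\<in>tuples d n. ((w n e * (h n e)\<^sup>2) * ?P I + (2 * w n e * h n e) * (?P I * ?S I)) + w n e * (?P I * (?S I)\<^sup>2))"
    unfolding sum_tuples_Suc by (intro sum.cong refl) (simp add: length_tuples algebra_simps power2_eq_square)
  also have "\<dots> = (\<Sum>e<d. w n e * (h n e)\<^sup>2) * (\<Sum>I\<in>tuples d n. ?P I)
      + (\<Sum>e<d. 2 * w n e * h n e) * (\<Sum>I\<in>tuples d n. ?P I * ?S I)
      + (\<Sum>e<d. w n e) * (\<Sum>I\<in>tuples d n. ?P I * (?S I)\<^sup>2)"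
    unfolding sum_product sum.distrib ..
  finally show ?case using 1 w IH one by simp
qed simp

lemma tuple_sum_diff:
  fixes g :: "nat \<Rightarrow> nat \<Rightarrow> real"
  assumes "I \<in> tuples d n"
  shows "tuple_sum (\<lambda>l e. g l e - \<mu> l) I = tuple_sum g I - (\<Sum>l<n. \<mu> l)"
  using assms
proof (induction n arbitrary: I)
  case (Suc n)
  obtain e I' where I: "I = e # I'" "e < d" "I' \<in> tuples d n" "length I' = n"
    using Suc.prems(1) by (rule tuples_SucE)
  then show ?case using Suc.IH[OF I(3)] by simp
qed simp

text \<open>Chebyshev's inequality for independent positions with possibly different distributions,
  as a codeword requires. Variances are replaced by raw second moments, for which a bound
  independent of the distribution is available.\<close>

lemma chebyshev_tuples:
  fixes w g :: "nat \<Rightarrow> nat \<Rightarrow> real"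
  assumes w1: "\<And>l. l < n \<Longrightarrow> (\<Sum>e<d. w l e) = 1" and w0: "\<And>l e. l < n \<Longrightarrow> e < d \<Longrightarrow> 0 \<le> w l e"
    and t: "0 < t" and X: "X \<subseteq> tuples d n"
    and dev: "\<And>I. I \<in> X \<Longrightarrow> t \<le> \<bar>tuple_sum g I - (\<Sum>l<n. \<Sum>e<d. w l e * g l e)\<bar>"
  shows "(\<Sum>I\<in>X. tuple_prod w I) \<le> (\<Sum>l<n. \<Sum>e<d. w l e * (g l e)\<^sup>2) / t\<^sup>2"
proof -
  define \<mu> where "\<mu> l = (\<Sum>e<d. w l e * g l e)" for l
  let ?h = "\<lambda>l e. g l e - \<mu> l"
  have wp: "0 \<le> tuple_prod w I" if "I \<in> tuples d n" for I by (rule tuple_prod_nonneg[OF that w0])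
  have zero: "(\<Sum>e<d. w l e * ?h l e) = 0" if "l < n" for l
  proof -
    have "(\<Sum>e<d. w l e * ?h l e) = (\<Sum>e<d. w l e * g l e) - (\<Sum>e<d. w l e) * \<mu> l"
      by (simp add: right_diff_distrib sum_subtractf sum_distrib_right)
    then show ?thesis using w1[OF that] by (simp add: \<mu>_def)
  qed
  have var: "(\<Sum>e<d. w l e * (?h l e)\<^sup>2) \<le> (\<Sum>e<d. w l e * (g l e)\<^sup>2)" if "l < n" for l
  proof -
    have "(\<Sum>e<d. w l e * (?h l e)\<^sup>2) = (\<Sum>e<d. w l e * (g l e)\<^sup>2 - (2 * \<mu> l) * (w l e * g l e) + (\<mu> l)\<^sup>2 * w l e)"
      by (intro sum.cong refl) (simp add: algebra_simps power2_eq_square)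
    also have "\<dots> = (\<Sum>e<d. w l e * (g l e)\<^sup>2) - (2 * \<mu> l) * (\<Sum>e<d. w l e * g l e) + (\<mu> l)\<^sup>2 * (\<Sum>e<d. w l e)"
      by (simp only: sum.distrib sum_subtractf sum_distrib_left)
    also have "\<dots> = (\<Sum>e<d. w l e * (g l e)\<^sup>2) - (\<mu> l)\<^sup>2"
      using w1[OF that] by (simp add: power2_eq_square flip: \<mu>_def)
    finally show ?thesis by simp
  qed
  have "t\<^sup>2 * (\<Sum>I\<in>X. tuple_prod w I) \<le> (\<Sum>I\<in>X. tuple_prod w I * (tuple_sum ?h I)\<^sup>2)"
    unfolding sum_distrib_left
  proof (rule sum_mono)
    fix I assume I: "I \<in> X"
    then have IT: "I \<in> tuples d n" using X by auto
    have "t \<le> \<bar>tuple_sum ?h I\<bar>" using dev[OF I] unfolding tuple_sum_diff[OF IT] \<mu>_def .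
    then have "t\<^sup>2 \<le> (tuple_sum ?h I)\<^sup>2" using t by (metis abs_ge_zero less_imp_le power2_abs power_mono)
    then show "t\<^sup>2 * tuple_prod w I \<le> tuple_prod w I * (tuple_sum ?h I)\<^sup>2"
      using wp[OF IT] by (simp add: mult.commute mult_left_mono)
  qed
  also have "\<dots> \<le> (\<Sum>I\<in>tuples d n. tuple_prod w I * (tuple_sum ?h I)\<^sup>2)"
    using X wp by (intro sum_mono2) auto
  also have "\<dots> = (\<Sum>l<n. \<Sum>e<d. w l e * (?h l e)\<^sup>2)"
    using second_moment_tuple_sum[where w = w and h = ?h and d = d and n = n] w1 zero by blast
  also have "\<dots> \<le> (\<Sum>l<n. \<Sum>e<d. w l e * (g l e)\<^sup>2)" by (intro sum_mono var) simp
  finally show ?thesis using t by (simp add: field_simps)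
qed

section \<open>Quadratic forms of tests\<close>

definition kernel_form :: "'a set \<Rightarrow> ('a \<Rightarrow> 'a \<Rightarrow> complex) \<Rightarrow> ('a \<Rightarrow> complex) \<Rightarrow> real" where
  "kernel_form S K \<phi> = Re (\<Sum>p\<in>S. \<Sum>q\<in>S. \<phi> p * cnj (\<phi> q) * K p q)"

lemma kernel_form_nonneg: "psd_kernel S K \<Longrightarrow> 0 \<le> kernel_form S K \<phi>"
  by (simp add: psd_kernel_def kernel_form_def del: Re_sum)

text \<open>The parallelogram law, with the nonnegative form at the difference dropped. It replaces
  an estimate of cross terms.\<close>

lemma kernel_form_add_le:
  assumes "psd_kernel S K"
  shows "kernel_form S K (\<lambda>p. \<phi> p + \<psi> p) \<le> 2 * kernel_form S K \<phi> + 2 * kernel_form S K \<psi>"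
proof -
  have "kernel_form S K (\<lambda>p. \<phi> p + \<psi> p) + kernel_form S K (\<lambda>p. \<phi> p - \<psi> p)
      = 2 * kernel_form S K \<phi> + 2 * kernel_form S K \<psi>"
  proof -
    have two: "Re (2 * z) = 2 * Re z" for z by simp
    have "(\<Sum>p\<in>S. \<Sum>q\<in>S. (\<phi> p + \<psi> p) * cnj (\<phi> q + \<psi> q) * K p q) + (\<Sum>p\<in>S. \<Sum>q\<in>S. (\<phi> p - \<psi> p) * cnj (\<phi> q - \<psi> q) * K p q)
      = 2 * (\<Sum>p\<in>S. \<Sum>q\<in>S. \<phi> p * cnj (\<phi> q) * K p q) + 2 * (\<Sum>p\<in>S. \<Sum>q\<in>S. \<psi> p * cnj (\<psi> q) * K p q)"
      unfolding sum.distrib[symmetric] sum_distrib_left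
      by (intro sum.cong refl) (simp add: algebra_simps)
    from arg_cong[OF this, of Re] show ?thesis
      unfolding kernel_form_def by (simp only: plus_complex.sel two)
  qed
  then show ?thesis using kernel_form_nonneg[OF assms, of "\<lambda>p. \<phi> p - \<psi> p"] by linarith
qed

text \<open>A single test is dominated by the sum of all tests, which is the identity.\<close>

lemma kernel_form_le_norm:
  assumes psd: "\<And>m. m < M \<Longrightarrow> psd_kernel S (B m)" and fin: "finite S"
    and one: "\<And>p q. p \<in> S \<Longrightarrow> q \<in> S \<Longrightarrow> (\<Sum>m<M. B m p q) = (if p = q then 1 else 0)"
    and m: "m < (M::nat)"
  shows "kernel_form S (B m) \<phi> \<le> (\<Sum>p\<in>S. (cmod (\<phi> p))\<^sup>2)"
proof -
  have "kernel_form S (B m) \<phi> \<le> (\<Sum>m<M. kernel_form S (B m) \<phi>)"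
    using m kernel_form_nonneg[OF psd] by (intro member_le_sum) auto
  also have "\<dots> = Re (\<Sum>m<M. \<Sum>p\<in>S. \<Sum>q\<in>S. \<phi> p * cnj (\<phi> q) * B m p q)"
    by (simp only: kernel_form_def Re_sum)
  also have "(\<Sum>m<M. \<Sum>p\<in>S. \<Sum>q\<in>S. \<phi> p * cnj (\<phi> q) * B m p q) = (\<Sum>p\<in>S. \<Sum>m<M. \<Sum>q\<in>S. \<phi> p * cnj (\<phi> q) * B m p q)"
    by (rule sum.swap)
  also have "\<dots> = (\<Sum>p\<in>S. \<Sum>q\<in>S. \<Sum>m<M. \<phi> p * cnj (\<phi> q) * B m p q)"
    by (intro sum.cong refl sum.swap)
  also have "\<dots> = (\<Sum>p\<in>S. \<Sum>q\<in>S. if q = p then \<phi> p * cnj (\<phi> p) else 0)"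
    using one by (intro sum.cong refl) (auto simp flip: sum_distrib_left)
  also have "\<dots> = (\<Sum>p\<in>S. of_real ((cmod (\<phi> p))\<^sup>2))"
    using fin by (intro sum.cong refl) (simp add: complex_norm_square del: of_real_power)
  finally show ?thesis by (simp flip: of_real_sum)
qed

text \<open>The vector \<open>U j\<close> is split into its parts inside and outside the typical set \<open>T\<close>. Summed over
  all \<open>j\<close>, the inside parts form a resolution of the identity on \<open>T\<close>, which leaves the trace of the
  test over \<open>T\<close>, weighted by the largest typical eigenvalue \<open>r\<close>.\<close>
lemma typical_test_bound:
  fixes \<Lambda> :: "'j \<Rightarrow> real"
  assumes fin: "finite P" "finite Q" and psd: "psd_kernel Q B"
    and le: "\<And>\<phi>. kernel_form Q B \<phi> \<le> (\<Sum>p\<in>Q. (cmod (\<phi> p))\<^sup>2)"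
    and norm: "\<And>j. j \<in> P \<Longrightarrow> (\<Sum>K\<in>Q. (cmod (U j K))\<^sup>2) = 1"
    and res: "\<And>K K'. K \<in> Q \<Longrightarrow> K' \<in> Q \<Longrightarrow> (\<Sum>j\<in>P. U j K * cnj (U j K')) = (if K = K' then 1 else 0)"
    and \<Lambda>: "\<And>j. j \<in> P \<Longrightarrow> 0 \<le> \<Lambda> j" and r: "\<And>j. j \<in> A \<Longrightarrow> \<Lambda> j \<le> r" "0 \<le> r" and A: "A \<subseteq> P" and T: "T \<subseteq> Q"
  shows "(\<Sum>j\<in>P. \<Lambda> j * kernel_form Q B (U j)) \<le> (\<Sum>j\<in>P-A. \<Lambda> j) + 2 * r * (\<Sum>K\<in>T. Re (B K K))
    + 2 * (\<Sum>K\<in>Q-T. \<Sum>j\<in>P. \<Lambda> j * (cmod (U j K))\<^sup>2)"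
proof -
  define a where "a j K = (if K \<in> T then U j K else 0)" for j K
  define b where "b j K = (if K \<in> T then 0 else U j K)" for j K
  have ab: "U j = (\<lambda>K. a j K + b j K)" for j by (auto simp: a_def b_def)
  let ?q = "kernel_form Q B"
  have q0: "0 \<le> ?q \<phi>" for \<phi> by (rule kernel_form_nonneg[OF psd])
  have qb: "?q (b j) \<le> (\<Sum>K\<in>Q-T. (cmod (U j K))\<^sup>2)" for j
  proof -
    have "(\<Sum>K\<in>Q. (cmod (b j K))\<^sup>2) = (\<Sum>K\<in>Q-T. (cmod (b j K))\<^sup>2)"
      using fin by (intro sum.mono_neutral_right) (auto simp: b_def)
    also have "\<dots> = (\<Sum>K\<in>Q-T. (cmod (U j K))\<^sup>2)" by (intro sum.cong) (auto simp: b_def)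
    finally show ?thesis using le[of "b j"] by simp
  qed
  have qa: "(\<Sum>j\<in>P. ?q (a j)) = (\<Sum>K\<in>T. Re (B K K))"
  proof -
    have "(\<Sum>j\<in>P. ?q (a j)) = Re (\<Sum>j\<in>P. \<Sum>p\<in>Q. \<Sum>q\<in>Q. a j p * cnj (a j q) * B p q)"
      by (simp only: kernel_form_def Re_sum)
    also have "(\<Sum>j\<in>P. \<Sum>p\<in>Q. \<Sum>q\<in>Q. a j p * cnj (a j q) * B p q) = (\<Sum>p\<in>Q. \<Sum>j\<in>P. \<Sum>q\<in>Q. a j p * cnj (a j q) * B p q)"
      by (rule sum.swap)
    also have "\<dots> = (\<Sum>p\<in>Q. \<Sum>q\<in>Q. \<Sum>j\<in>P. a j p * cnj (a j q) * B p q)"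
      by (intro sum.cong refl sum.swap)
    also have "\<dots> = (\<Sum>p\<in>Q. \<Sum>q\<in>Q. if q = p then (if p \<in> T then B p p else 0) else 0)"
    proof (intro sum.cong refl)
      fix p q assume pq: "p \<in> Q" "q \<in> Q"
      show "(\<Sum>j\<in>P. a j p * cnj (a j q) * B p q) = (if q = p then (if p \<in> T then B p p else 0) else 0)"
      proof (cases "p \<in> T \<and> q \<in> T")
        case True
        then have "(\<Sum>j\<in>P. a j p * cnj (a j q) * B p q) = (\<Sum>j\<in>P. U j p * cnj (U j q)) * B p q"
          by (simp add: a_def sum_distrib_right)
        then show ?thesis using res[OF pq] True by simp
      qed (auto simp: a_def)
    qed
    also have "\<dots> = (\<Sum>p\<in>Q. if p \<in> T then B p p else 0)" using fin by simp
    also have "\<dots> = (\<Sum>p\<in>T. B p p)"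
      using fin T by (simp add: sum.If_cases Int_absorb1)
    finally show ?thesis by simp
  qed
  have "(\<Sum>j\<in>P. \<Lambda> j * ?q (U j)) = (\<Sum>j\<in>P-A. \<Lambda> j * ?q (U j)) + (\<Sum>j\<in>A. \<Lambda> j * ?q (U j))"
    using fin A by (simp add: sum.subset_diff)
  also have "(\<Sum>j\<in>P-A. \<Lambda> j * ?q (U j)) \<le> (\<Sum>j\<in>P-A. \<Lambda> j)"
    using \<Lambda> le norm by (intro sum_mono) (metis DiffD1 mult.right_neutral mult_left_mono)
  \<comment> \<open>Only the inside part is charged with \<open>r\<close>. The outside part keeps
    its weight \<open>\<Lambda> j\<close>, so that summing over \<open>j\<close> produces the
    outcome distribution of a measurement.\<close>
  also have "(\<Sum>j\<in>A. \<Lambda> j * ?q (U j)) \<le> (\<Sum>j\<in>A. 2 * (r * ?q (a j)) + 2 * (\<Lambda> j * ?q (b j)))"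
  proof (rule sum_mono)
    fix j assume j: "j \<in> A"
    have "\<Lambda> j * ?q (U j) \<le> \<Lambda> j * (2 * ?q (a j) + 2 * ?q (b j))"
      using \<Lambda>[of j] j A kernel_form_add_le[OF psd, of "a j" "b j"]
      by (intro mult_left_mono) (auto simp flip: ab)
    also have "\<dots> \<le> 2 * (r * ?q (a j)) + 2 * (\<Lambda> j * ?q (b j))"
      using mult_right_mono[OF r(1)[OF j] q0[of "a j"]] by (simp add: algebra_simps)
    finally show "\<Lambda> j * ?q (U j) \<le> 2 * (r * ?q (a j)) + 2 * (\<Lambda> j * ?q (b j))" .
  qed
  \<comment> \<open>Going back from \<open>A\<close> to all of \<open>P\<close> costs nothing in
    sign and is what makes the resolution of the identity usable in \<open>qa\<close>.\<close>
  also have "\<dots> \<le> (\<Sum>j\<in>P. 2 * (r * ?q (a j)) + 2 * (\<Lambda> j * ?q (b j)))"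
    using fin A \<Lambda> r(2) q0 by (intro sum_mono2) auto
  also have "\<dots> = 2 * r * (\<Sum>j\<in>P. ?q (a j)) + 2 * (\<Sum>j\<in>P. \<Lambda> j * ?q (b j))"
    by (simp add: sum.distrib sum_distrib_left mult.assoc)
  also have "(\<Sum>j\<in>P. \<Lambda> j * ?q (b j)) \<le> (\<Sum>j\<in>P. \<Lambda> j * (\<Sum>K\<in>Q-T. (cmod (U j K))\<^sup>2))"
    using \<Lambda> qb by (intro sum_mono mult_left_mono) auto
  also have "\<dots> = (\<Sum>K\<in>Q-T. \<Sum>j\<in>P. \<Lambda> j * (cmod (U j K))\<^sup>2)"
    unfolding sum_distrib_left by (rule sum.swap)
  finally show ?thesis unfolding qa by simp
qed

text \<open>With \<open>y = sqrt t\<close> the product \<open>t * (ln t)^2\<close> is 4 times the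
  square of \<open>y * ln y\<close>, and \<open>ln (1 / y) \<le> 1 / y\<close> bounds the latter by
  1. The bound holds down to \<open>t = 0\<close>, which matters since eigenvalues of the average
  state can become arbitrarily small as the type varies.\<close>

lemma mult_log_square_le:
  fixes t :: real
  assumes "0 \<le> t" "t \<le> 1"
  shows "t * (log 2 t)\<^sup>2 \<le> 4 / (ln 2)\<^sup>2"
proof (cases "t = 0")
  case False
  then have t: "0 < t" using assms by simp
  define y where "y = sqrt t"
  have y: "0 < y" "y\<^sup>2 = t" "y \<le> 1" using t assms by (auto simp: y_def)
  have "- ln y \<le> 1 / y" using ln_le_minus_one[of "1 / y"] y by (simp add: ln_div)
  then have "y * (- ln y) \<le> 1" using y by (simp add: field_simps)
  moreover have "0 \<le> y * (- ln y)" using y by (simp add: mult_nonneg_nonpos)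
  ultimately have "(y * (- ln y))\<^sup>2 \<le> 1" unfolding abs_square_le_1 by linarith
  moreover have "ln t = 2 * ln y" using y by (simp flip: y(2) add: ln_realpow)
  ultimately have "t * (ln t)\<^sup>2 \<le> 4" by (simp add: power_mult_distrib y(2))
  then show ?thesis by (simp add: log_def power_divide field_simps)
qed simp

section \<open>Codewords of a fixed type\<close>

text \<open>The array \<open>c\<close> is the unitary matrix of overlaps between the two eigenbases.
  The last item is the diagonal of \<open>A\<close> in the basis \<open>v\<close>: for a state
  \<open>A\<close>, the outcome distribution of measuring it in the eigenbasis of
  \<open>S\<close>.\<close>

lemma change_of_eigenbasis:
  assumes u: "spectral_decomp d A u ev" and v: "spectral_decomp d S v s"
  defines "c \<equiv> \<lambda>j a. \<Sum>e<d. cnj (v a e) * u j e"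
  shows "j < d \<Longrightarrow> e < d \<Longrightarrow> (\<Sum>a<d. c j a * v a e) = u j e"
    and "j < d \<Longrightarrow> (\<Sum>a<d. c j a * cnj (c j a)) = 1"
    and "a < d \<Longrightarrow> b < d \<Longrightarrow> (\<Sum>j<d. c j a * cnj (c j b)) = (if a = b then 1 else 0)"
    and "(\<Sum>e<d. \<Sum>f<d. cnj (v a e) * A $$ (e,f) * v a f) = of_real (\<Sum>j<d. ev j * (cmod (c j a))\<^sup>2)"
proof -
  have exp: "(\<Sum>a<d. c j a * v a e) = u j e" if "j < d" "e < d" for j e
  proof -
    have "(\<Sum>a<d. c j a * v a e) = (\<Sum>a<d. \<Sum>f<d. u j f * (v a e * cnj (v a f)))"
      unfolding c_def sum_distrib_right by (intro sum.cong refl) (simp add: mult_ac)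
    also have "\<dots> = (\<Sum>f<d. u j f * (\<Sum>a<d. v a e * cnj (v a f)))"
      unfolding sum_distrib_left by (rule sum.swap)
    also have "\<dots> = (\<Sum>f<d. if f = e then u j e else 0)"
      using that by (intro sum.cong refl) (simp add: spectral_decomp_complete[OF v])
    finally show ?thesis using that by simp
  qed
  then show "j < d \<Longrightarrow> e < d \<Longrightarrow> (\<Sum>a<d. c j a * v a e) = u j e" .
  show "(\<Sum>a<d. c j a * cnj (c j a)) = 1" if "j < d"
  proof -
    have "cnj (c j a) = (\<Sum>e<d. v a e * cnj (u j e))" for a by (simp add: c_def)
    then have "(\<Sum>a<d. c j a * cnj (c j a)) = (\<Sum>a<d. \<Sum>e<d. (c j a * v a e) * cnj (u j e))"
      by (simp add: sum_distrib_left mult.assoc)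
    also have "\<dots> = (\<Sum>e<d. (\<Sum>a<d. c j a * v a e) * cnj (u j e))"
      unfolding sum_distrib_right by (rule sum.swap)
    also have "\<dots> = (\<Sum>e<d. cnj (u j e) * u j e)"
      using exp[OF that] by (intro sum.cong refl) (simp add: mult.commute)
    finally show ?thesis using u that by (simp add: spectral_decomp_def)
  qed
  show "(\<Sum>j<d. c j a * cnj (c j b)) = (if a = b then 1 else 0)" if "a < d" "b < d"
  proof -
    have "(\<Sum>j<d. c j a * cnj (c j b)) = (\<Sum>j<d. \<Sum>e<d. \<Sum>f<d. (cnj (v a e) * v b f) * (u j e * cnj (u j f)))"
      unfolding c_def cnj_sum sum_product by (intro sum.cong refl) (simp add: mult_ac)
    also have "\<dots> = (\<Sum>e<d. \<Sum>j<d. \<Sum>f<d. (cnj (v a e) * v b f) * (u j e * cnj (u j f)))"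
      by (rule sum.swap)
    also have "\<dots> = (\<Sum>e<d. \<Sum>f<d. \<Sum>j<d. (cnj (v a e) * v b f) * (u j e * cnj (u j f)))"
      by (intro sum.cong refl sum.swap)
    also have "\<dots> = (\<Sum>e<d. \<Sum>f<d. if f = e then cnj (v a e) * v b e else 0)"
      unfolding sum_distrib_left[symmetric]
      by (intro sum.cong refl) (simp add: spectral_decomp_complete[OF u])
    also have "\<dots> = (\<Sum>e<d. cnj (v a e) * v b e)" by simp
    finally show ?thesis using v that by (simp add: spectral_decomp_def)
  qed
  show "(\<Sum>e<d. \<Sum>f<d. cnj (v a e) * A $$ (e,f) * v a f) = of_real (\<Sum>j<d. ev j * (cmod (c j a))\<^sup>2)"
  proof -
    have "cmod (\<Sum>f<d. cnj (u j f) * v a f) = cmod (c j a)" for j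
    proof -
      have "c j a = cnj (\<Sum>f<d. cnj (u j f) * v a f)" by (simp add: c_def mult.commute)
      then show ?thesis by (simp only: complex_mod_cnj)
    qed
    then show ?thesis unfolding quadratic_form_spectral[OF u] by simp
  qed
qed

text \<open>The exact identity for which codewords are grouped by type: sums along a codeword become
  averages over its letter frequencies.\<close>

lemma sum_over_positions:
  fixes f :: "nat \<Rightarrow> real"
  assumes "\<And>l. l < n \<Longrightarrow> x l < k" "1 \<le> n"
    and p: "\<And>y. y < k \<Longrightarrow> p y = real (card {l. l < n \<and> x l = y}) / real n"
  shows "(\<Sum>l<n. f (x l)) = real n * (\<Sum>y<k. p y * f y)"
proof -
  have "(\<Sum>l<n. f (x l)) = (\<Sum>y<k. \<Sum>l\<in>{l\<in>{..<n}. x l = y}. f (x l))"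
    by (rule sum.group[symmetric]) (use assms(1) in auto)
  also have "\<dots> = (\<Sum>y<k. real n * (p y * f y))"
  proof (intro sum.cong refl)
    fix y assume "y \<in> {..<k}"
    then have "real n * p y = real (card {l. l < n \<and> x l = y})" using p assms(2) by simp
    then show "(\<Sum>l\<in>{l\<in>{..<n}. x l = y}. f (x l)) = real n * (p y * f y)"
      by (simp add: mult.assoc[symmetric])
  qed
  finally show ?thesis by (simp add: sum_distrib_left)
qed

text \<open>All messages of a class share the average state, so one typical set \<open>S\<close>
  serves them all and their tests can be added before the trace over \<open>S\<close> is taken. This
  is why the exponential term is paid once per class and not once per message.\<close>

lemma codeword_class_bound:
  fixes C \<delta> :: real and M :: nat
  assumes \<theta>: "\<forall>x<k. density d (\<theta> x)" and n: "1 \<le> n"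
    and enc: "\<And>m i. m < M \<Longrightarrow> i < n \<Longrightarrow> enc m i < k"
    and psd: "\<And>m. m < M \<Longrightarrow> psd_kernel (tuples d n) (B m)"
    and one: "\<And>I J. I \<in> tuples d n \<Longrightarrow> J \<in> tuples d n \<Longrightarrow> (\<Sum>m<M. B m I J) = (if I = J then 1 else 0)"
    and Cl: "Cl \<subseteq> {..<M}"
    and type: "\<And>m x. m \<in> Cl \<Longrightarrow> x < k \<Longrightarrow> p x = real (card {l. l < n \<and> enc m l = x}) / real n"
    and p: "prob_dist k p" and C: "mutual_info k d (cq_state k d p \<theta>) \<le> C" and \<delta>: "0 < \<delta>"
  shows "(\<Sum>m\<in>Cl. Re (\<Sum>I\<in>tuples d n. \<Sum>J\<in>tuples d n. tensor_entry (\<lambda>l e f. \<theta> (enc m l) $$ (e,f)) I J * B m I J))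
    \<le> real (card Cl) * (12 * real d / ((ln 2)\<^sup>2 * real n * \<delta>\<^sup>2)) + 2 * 2 powr (real n * (C + 2 * \<delta>))"
proof -
  let ?Q = "tuples d n"
  define c0 :: real where "c0 = 4 / (ln 2)\<^sup>2"
  have "\<exists>u l. spectral_decomp d (\<theta> x) u l" if "x < k" for x
    using \<theta> that hermitian_spectral_decomp[of "\<theta> x" d] unfolding density_def psd_def by metis
  then obtain u ev where u: "\<And>x. x < k \<Longrightarrow> spectral_decomp d (\<theta> x) (u x) (ev x)" by metis
  define \<sigma> where "\<sigma> = average_state k d p \<theta>"
  have \<sigma>: "density d \<sigma>" unfolding \<sigma>_def by (rule density_average_state[OF p \<theta>])
  then obtain v s where v: "spectral_decomp d \<sigma> v s"
    using hermitian_spectral_decomp[of \<sigma> d] unfolding density_def psd_def by metis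
  have ev0: "0 \<le> ev x j" if "x < k" "j < d" for x j
    using density_eigenvalues(1)[OF u[OF that(1)]] \<theta> that by blast
  have ev1: "(\<Sum>j<d. ev x j) = 1" if "x < k" for x
    using density_eigenvalues(2)[OF u[OF that]] \<theta> that by blast
  have s0: "0 \<le> s j" if "j < d" for j using density_eigenvalues(1)[OF v \<sigma> that] .
  have s1: "(\<Sum>j<d. s j) = 1" using density_eigenvalues(2)[OF v \<sigma>] .
  have p0: "0 \<le> p x" if "x < k" for x using p that by (simp add: prob_dist_def)
  define ov where "ov x j a = (\<Sum>e<d. cnj (v a e) * u x j e)" for x j a
  note ov = change_of_eigenbasis[OF u v, folded ov_def]
  \<comment> \<open>The outcome distribution of \<open>\<theta> x\<close> measured in the eigenbasis
    of \<open>\<sigma>\<close>; its average over \<open>p\<close> is the spectrum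
    \<open>s\<close>.\<close>
  define w where "w x a = (\<Sum>j<d. ev x j * (cmod (ov x j a))\<^sup>2)" for x a
  have w0: "0 \<le> w x a" if "x < k" for x a
    unfolding w_def using ev0 that by (intro sum_nonneg) auto
  have w1: "(\<Sum>a<d. w x a) = 1" if x: "x < k" for x
  proof -
    have "(\<Sum>a<d. w x a) = (\<Sum>j<d. ev x j * (\<Sum>a<d. (cmod (ov x j a))\<^sup>2))"
      unfolding w_def sum_distrib_left by (rule sum.swap)
    also have "\<dots> = (\<Sum>j<d. ev x j)"
    proof (intro sum.cong refl)
      fix j assume "j \<in> {..<d}"
      then have "complex_of_real (\<Sum>a<d. (cmod (ov x j a))\<^sup>2) = 1"
        using ov(2)[OF x, of j] by (simp add: complex_norm_square del: of_real_power)
      then have "(\<Sum>a<d. (cmod (ov x j a))\<^sup>2) = 1" using of_real_eq_1_iff by blast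
      then show "ev x j * (\<Sum>a<d. (cmod (ov x j a))\<^sup>2) = ev x j" by simp
    qed
    finally show ?thesis using ev1[OF x] by simp
  qed
  have sw: "s a = (\<Sum>x<k. p x * w x a)" if a: "a < d" for a
  proof -
    have "complex_of_real (s a) = (\<Sum>e<d. \<Sum>f<d. cnj (v a e) * \<sigma> $$ (e,f) * v a f)"
      by (rule eigenvalue_quadratic_form[OF v a, symmetric])
    also have "\<dots> = (\<Sum>e<d. \<Sum>f<d. \<Sum>x<k. of_real (p x) * (cnj (v a e) * \<theta> x $$ (e,f) * v a f))"
      by (intro sum.cong refl) (simp add: \<sigma>_def average_state_def sum_distrib_left sum_distrib_right mult_ac)
    also have "\<dots> = (\<Sum>e<d. \<Sum>x<k. \<Sum>f<d. of_real (p x) * (cnj (v a e) * \<theta> x $$ (e,f) * v a f))"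
      by (intro sum.cong refl sum.swap)
    also have "\<dots> = (\<Sum>x<k. of_real (p x) * (\<Sum>e<d. \<Sum>f<d. cnj (v a e) * \<theta> x $$ (e,f) * v a f))"
      unfolding sum_distrib_left by (rule sum.swap)
    also have "\<dots> = of_real (\<Sum>x<k. p x * w x a)"
      using ov(4) by (simp add: w_def)
    finally show ?thesis using of_real_eq_iff by blast
  qed
  define a where "a = (\<Sum>x<k. p x * (\<Sum>j<d. ev x j * log 2 (ev x j)))"
  define b where "b = (\<Sum>j<d. s j * log 2 (s j))"
  have ab: "a - b \<le> C"
    using C mutual_info_cq_state[OF p \<theta> u v[unfolded \<sigma>_def]] by (simp add: a_def b_def)
  have sle1: "s j \<le> 1" if "j < d" for j
    using s1 member_le_sum[of j "{..<d}" s] s0 that by simp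
  have evle1: "ev x j \<le> 1" if "x < k" "j < d" for x j
    using ev1[OF that(1)] member_le_sum[of j "{..<d}" "ev x"] ev0 that by simp
  \<comment> \<open>Tuples containing a zero eigenvalue are excluded explicitly: as
    \<open>log 2 0 = 0\<close>, the condition on the sum of logarithms does not detect them.\<close>
  define S where "S = {K \<in> ?Q. tuple_prod (\<lambda>_. s) K \<noteq> 0 \<and>
     real n * (b - \<delta>) < tuple_sum (\<lambda>_ j. log 2 (s j)) K}"
  define r where "r = 2 powr (real n * (a + \<delta>))"
  \<comment> \<open>Second moments at \<open>n\<close> positions, each a sum of \<open>d\<close>
    terms bounded by \<open>c0\<close>, divided by the squared deviation.\<close>
  define E where "E = real n * (real d * c0) / (real n * \<delta>)\<^sup>2"
  have n\<delta>: "0 < real n * \<delta>" using n \<delta> by simp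
  \<comment> \<open>The tests are rewritten in the product eigenbasis of \<open>\<sigma>\<close>,
    which is common to the class; positivity and completeness survive the change of basis.\<close>
  define V where "V K I = tensor_entry (\<lambda>_. v) K I" for K I
  define B' where "B' m K K' = (\<Sum>I\<in>?Q. \<Sum>J\<in>?Q. V K I * B m I J * cnj (V K' J))" for m K K'
  have psd': "psd_kernel ?Q (B' m)" if "m < M" for m
    by (rule psd_kernel_congruence[OF psd[OF that], where N = "1::nat" and C = "\<lambda>_. V"]) (simp add: B'_def)
  have one': "(\<Sum>m<M. B' m K K') = (if K = K' then 1 else 0)" if K: "K \<in> ?Q" "K' \<in> ?Q" for K K'
  proof -
    have "(\<Sum>m<M. B' m K K') = (\<Sum>I\<in>?Q. \<Sum>m<M. \<Sum>J\<in>?Q. V K I * B m I J * cnj (V K' J))"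
      unfolding B'_def by (rule sum.swap)
    also have "\<dots> = (\<Sum>I\<in>?Q. \<Sum>J\<in>?Q. \<Sum>m<M. V K I * B m I J * cnj (V K' J))"
      by (intro sum.cong refl sum.swap)
    also have "\<dots> = (\<Sum>I\<in>?Q. \<Sum>J\<in>?Q. if J = I then V K I * cnj (V K' I) else 0)"
      by (intro sum.cong refl) (simp add: one flip: sum_distrib_left sum_distrib_right)
    also have "\<dots> = (\<Sum>I\<in>?Q. V K I * cnj (V K' I))" by simp
    also have "\<dots> = tensor_entry (\<lambda>l e g. \<Sum>f<d. v e f * cnj (v g f)) K K'"
      unfolding V_def by (rule tensor_entry_mult_cnj[OF K])
    also have "\<dots> = tensor_entry (\<lambda>l e f. if e = f then 1 else 0) K K'"
    proof (rule tensor_entry_cong[OF K])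
      fix e f assume "e < d" "f < d"
      then have "(\<Sum>a<d. cnj (v f a) * v e a) = (if f = e then 1 else 0)"
        using v by (simp add: spectral_decomp_def)
      then show "(\<Sum>a<d. v e a * cnj (v f a)) = (if e = f then 1 else 0)"
        by (cases "e = f") (auto simp: mult.commute)
    qed
    also have "\<dots> = (if K = K' then 1 else 0)" by (rule tensor_entry_identity[OF K])
    finally show ?thesis .
  qed
  have diag0: "0 \<le> Re (B' m K K)" if m: "m < M" and K: "K \<in> ?Q" for m K
  proof -
    have ind: "(if p = K then 1 else 0) * cnj (if q = K then 1 else 0) * z
      = (if p = K then (if q = K then z else 0) else 0)" for p q z by simp
    have "(\<Sum>p\<in>?Q. \<Sum>q\<in>?Q. (if p = K then 1 else 0) * cnj (if q = K then 1 else 0) * B' m p q)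
      = (\<Sum>p\<in>?Q. if p = K then (\<Sum>q\<in>?Q. if q = K then B' m p q else 0) else 0)"
      unfolding ind by (intro sum.cong) auto
    also have "\<dots> = B' m K K" using K by simp
    finally have eq: "(\<Sum>p\<in>?Q. \<Sum>q\<in>?Q. (if p = K then 1 else 0) * cnj (if q = K then 1 else 0) * B' m p q) = B' m K K" .
    have "0 \<le> Re (\<Sum>p\<in>?Q. \<Sum>q\<in>?Q. (if p = K then 1 else 0) * cnj (if q = K then 1 else 0) * B' m p q)"
      using psd'[OF m] unfolding psd_kernel_def by (rule spec)
    then show ?thesis unfolding eq .
  qed
  have single: "Re (\<Sum>I\<in>?Q. \<Sum>J\<in>?Q. tensor_entry (\<lambda>l e f. \<theta> (enc m l) $$ (e,f)) I J * B m I J)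
     \<le> 3 * E + 2 * r * (\<Sum>K\<in>S. Re (B' m K K))" if m: "m \<in> Cl" for m
  proof -
    have mM: "m < M" using m Cl by auto
    define x where "x = enc m"
    have x: "x l < k" if "l < n" for l using enc[OF mM that] by (simp add: x_def)
    have px: "p y = real (card {l. l < n \<and> x l = y}) / real n" if "y < k" for y
      using type[OF m that] by (simp add: x_def)
    note pos = sum_over_positions[OF x n px]
    define \<Lambda> where "\<Lambda> J = tuple_prod (\<lambda>l. ev (x l)) J" for J
    define U where "U J K = tensor_entry (\<lambda>l. ov (x l)) J K" for J K
    define A where "A = {J \<in> ?Q. tuple_sum (\<lambda>l j. log 2 (ev (x l) j)) J < real n * (a + \<delta>)}"
    have \<Lambda>0: "0 \<le> \<Lambda> J" if "J \<in> ?Q" for J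
      unfolding \<Lambda>_def by (rule tuple_prod_nonneg[OF that]) (use x ev0 in auto)
    \<comment> \<open>Thus \<open>U J\<close> is the coefficient vector, in the product eigenbasis
      of \<open>\<sigma>\<close>, of the eigenvector \<open>J\<close> of the codeword state.\<close>
    have UV: "(\<Sum>K\<in>?Q. U J K * V K I) = tensor_entry (\<lambda>l. u (x l)) J I" if "J \<in> ?Q" "I \<in> ?Q" for I J
      unfolding U_def V_def tensor_entry_mult[OF that]
      by (rule tensor_entry_cong[OF that]) (use x ov(1) in auto)
    have T: "tensor_entry (\<lambda>l e f. \<theta> (enc m l) $$ (e,f)) I I'
       = (\<Sum>J\<in>?Q. of_real (\<Lambda> J) * ((\<Sum>K\<in>?Q. U J K * V K I) * cnj (\<Sum>K\<in>?Q. U J K * V K I')))"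
      if I: "I \<in> ?Q" "I' \<in> ?Q" for I I'
    proof -
      have "tensor_entry (\<lambda>l e f. \<theta> (enc m l) $$ (e,f)) I I'
        = tensor_entry (\<lambda>l e f. \<Sum>j<d. of_real (ev (x l) j) * u (x l) j e * cnj (u (x l) j f)) I I'"
        by (rule tensor_entry_cong[OF I]) (use u x in \<open>auto simp: spectral_decomp_def x_def\<close>)
      also have "\<dots> = (\<Sum>J\<in>?Q. tuple_prod (\<lambda>l j. of_real (ev (x l) j)) J *
         tensor_entry (\<lambda>l. u (x l)) J I * cnj (tensor_entry (\<lambda>l. u (x l)) J I'))"
        by (rule tensor_entry_spectral[OF I])
      finally show ?thesis
        using I by (simp add: UV tuple_prod_of_real \<Lambda>_def mult.assoc del: cnj_sum)
    qed
    have "(\<Sum>I\<in>?Q. \<Sum>I'\<in>?Q. tensor_entry (\<lambda>l e f. \<theta> (enc m l) $$ (e,f)) I I' * B m I I')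
      = (\<Sum>I\<in>?Q. \<Sum>I'\<in>?Q. \<Sum>J\<in>?Q. of_real (\<Lambda> J) * ((\<Sum>K\<in>?Q. U J K * V K I) * cnj (\<Sum>K\<in>?Q. U J K * V K I') * B m I I'))"
      by (intro sum.cong refl) (simp add: T sum_distrib_right mult.assoc del: cnj_sum)
    also have "\<dots> = (\<Sum>I\<in>?Q. \<Sum>J\<in>?Q. \<Sum>I'\<in>?Q. of_real (\<Lambda> J) * ((\<Sum>K\<in>?Q. U J K * V K I) * cnj (\<Sum>K\<in>?Q. U J K * V K I') * B m I I'))"
      by (intro sum.cong refl sum.swap)
    also have "\<dots> = (\<Sum>J\<in>?Q. \<Sum>I\<in>?Q. \<Sum>I'\<in>?Q. of_real (\<Lambda> J) * ((\<Sum>K\<in>?Q. U J K * V K I) * cnj (\<Sum>K\<in>?Q. U J K * V K I') * B m I I'))"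
      by (rule sum.swap)
    also have "\<dots> = (\<Sum>J\<in>?Q. of_real (\<Lambda> J) * (\<Sum>K\<in>?Q. \<Sum>K'\<in>?Q. U J K * cnj (U J K') * B' m K K'))"
      unfolding B'_def kernel_congruence by (simp only: sum_distrib_left)
    finally have succ: "Re (\<Sum>I\<in>?Q. \<Sum>I'\<in>?Q. tensor_entry (\<lambda>l e f. \<theta> (enc m l) $$ (e,f)) I I' * B m I I')
      = (\<Sum>J\<in>?Q. \<Lambda> J * kernel_form ?Q (B' m) (U J))"
      unfolding kernel_form_def by (simp only: Re_sum[of _ ?Q] Re_complex_of_real times_complex.sel Im_complex_of_real mult_zero_left diff_zero)
    have "(\<Sum>J\<in>?Q. \<Lambda> J * kernel_form ?Q (B' m) (U J)) \<le> (\<Sum>J\<in>?Q-A. \<Lambda> J) + 2 * r * (\<Sum>K\<in>S. Re (B' m K K))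
      + 2 * (\<Sum>K\<in>?Q-S. \<Sum>J\<in>?Q. \<Lambda> J * (cmod (U J K))\<^sup>2)"
    proof (rule typical_test_bound)
      show "psd_kernel ?Q (B' m)" by (rule psd'[OF mM])
      show "kernel_form ?Q (B' m) \<phi> \<le> (\<Sum>p\<in>?Q. (cmod (\<phi> p))\<^sup>2)" for \<phi>
        by (rule kernel_form_le_norm[where B = B' and M = M, OF psd' finite_tuples one' mM])
    next
      fix J assume J: "J \<in> ?Q"
      have "complex_of_real (\<Sum>K\<in>?Q. (cmod (U J K))\<^sup>2) = (\<Sum>K\<in>?Q. U J K * cnj (U J K))"
        by (simp add: complex_norm_square del: of_real_power)
      also have "\<dots> = tensor_entry (\<lambda>l e g. \<Sum>f<d. ov (x l) e f * cnj (ov (x l) g f)) J J"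
        unfolding U_def by (rule tensor_entry_mult_cnj[OF J J])
      also have "\<dots> = tuple_prod (\<lambda>l e. 1) J"
        unfolding tensor_entry_diagonal by (rule tuple_prod_cong[OF J]) (use ov(2) x in auto)
      finally show "(\<Sum>K\<in>?Q. (cmod (U J K))\<^sup>2) = 1" unfolding tuple_prod_one using of_real_eq_1_iff by blast
    next
      fix K K' assume K: "K \<in> ?Q" "K' \<in> ?Q"
      have "(\<Sum>J\<in>?Q. U J K * cnj (U J K')) = tensor_entry (\<lambda>l e f. \<Sum>j<d. 1 * ov (x l) j e * cnj (ov (x l) j f)) K K'"
        unfolding U_def tensor_entry_spectral[OF K] tuple_prod_one by simp
      also have "\<dots> = tensor_entry (\<lambda>l e f. if e = f then 1 else 0) K K'"
        by (rule tensor_entry_cong[OF K]) (use ov(3) x in auto)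
      also have "\<dots> = (if K = K' then 1 else 0)" by (rule tensor_entry_identity[OF K])
      finally show "(\<Sum>J\<in>?Q. U J K * cnj (U J K')) = (if K = K' then 1 else 0)" .
    next
      fix J assume J: "J \<in> A"
      then have "\<Lambda> J \<le> 2 powr (tuple_sum (\<lambda>l j. log 2 (ev (x l) j)) J)"
        unfolding \<Lambda>_def A_def using x ev0 by (intro tuple_prod_le_powr[of _ d n]) auto
      also have "\<dots> \<le> r" using J by (simp add: A_def r_def)
      finally show "\<Lambda> J \<le> r" .
    qed (use \<Lambda>0 in \<open>auto simp: A_def S_def r_def\<close>)
    also have "(\<Sum>J\<in>?Q-A. \<Lambda> J) \<le> E"
    proof -
      have mean: "(\<Sum>l<n. \<Sum>j<d. ev (x l) j * log 2 (ev (x l) j)) = real n * a"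
        using pos[of "\<lambda>y. \<Sum>j<d. ev y j * log 2 (ev y j)"] by (simp add: a_def)
      have "(\<Sum>J\<in>?Q-A. \<Lambda> J) \<le> (\<Sum>l<n. \<Sum>j<d. ev (x l) j * (log 2 (ev (x l) j))\<^sup>2) / (real n * \<delta>)\<^sup>2"
        unfolding \<Lambda>_def
        by (rule chebyshev_tuples[where g = "\<lambda>l j. log 2 (ev (x l) j)"])
          (use x ev0 ev1 n\<delta> in \<open>auto simp: mean A_def algebra_simps\<close>)
      also have "\<dots> \<le> (\<Sum>l<n. \<Sum>j<d. c0) / (real n * \<delta>)\<^sup>2"
        unfolding c0_def using x ev0 evle1 by (intro divide_right_mono sum_mono mult_log_square_le) auto
      finally show ?thesis by (simp add: E_def)
    qed
    also have "(\<Sum>K\<in>?Q-S. \<Sum>J\<in>?Q. \<Lambda> J * (cmod (U J K))\<^sup>2) \<le> E"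
    proof -
      let ?W = "\<lambda>K. tuple_prod (\<lambda>l. w (x l)) K"
      define X where "X = {K \<in> ?Q. tuple_sum (\<lambda>_ j. log 2 (s j)) K \<le> real n * (b - \<delta>)}"
      \<comment> \<open>This is the diagonal of the codeword state in the eigenbasis of the power of
        \<open>\<sigma>\<close>. Both are products, hence so is the distribution.\<close>
      have W: "(\<Sum>J\<in>?Q. \<Lambda> J * (cmod (U J K))\<^sup>2) = ?W K" if K: "K \<in> ?Q" for K
      proof -
        have "complex_of_real (\<Sum>J\<in>?Q. \<Lambda> J * (cmod (U J K))\<^sup>2)
          = (\<Sum>J\<in>?Q. tuple_prod (\<lambda>l j. of_real (ev (x l) j)) J * U J K * cnj (U J K))"
          by (simp add: tuple_prod_of_real \<Lambda>_def complex_norm_square mult.assoc del: of_real_power)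
        also have "\<dots> = tensor_entry (\<lambda>l e f. \<Sum>j<d. of_real (ev (x l) j) * ov (x l) j e * cnj (ov (x l) j f)) K K"
          unfolding U_def by (rule tensor_entry_spectral[OF K K, symmetric])
        also have "\<dots> = tuple_prod (\<lambda>l e. of_real (w (x l) e)) K"
          unfolding tensor_entry_diagonal w_def
          by (simp add: complex_norm_square mult.assoc del: of_real_power)
        finally show ?thesis unfolding tuple_prod_of_real using of_real_eq_iff by blast
      qed
      have Wnn: "0 \<le> ?W K" if "K \<in> ?Q" for K by (rule tuple_prod_nonneg[OF that]) (use x w0 in auto)
      \<comment> \<open>A zero eigenvalue of \<open>\<sigma>\<close> forces
        \<open>p y * w y e = 0\<close> for every letter, and \<open>p (x l)\<close> is positive
        because the letter \<open>x l\<close> occurs in the codeword. So the tuples on which the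
        logarithm is junk carry no weight.\<close>
      have W0: "?W K = 0" if K: "K \<in> ?Q" and z: "tuple_prod (\<lambda>_. s) K = 0" for K
      proof (rule tuple_prod_eq_0_transfer[OF K z])
        fix l e assume l: "l < n" and e: "e < d" and se: "s e = 0"
        have "(\<Sum>y<k. p y * w y e) = 0" using sw[OF e] se by simp
        then have "p (x l) * w (x l) e = 0"
          using sum_nonneg_eq_0_iff[of "{..<k}" "\<lambda>y. p y * w y e"] p0 w0 x[OF l] by auto
        moreover have "p (x l) \<noteq> 0" using px[OF x[OF l]] n l by auto
        ultimately show "w (x l) e = 0" by simp
      qed
      \<comment> \<open>The factors \<open>w (x l)\<close> differ from \<open>s\<close>, but the
        type makes their sum over the positions equal to \<open>n\<close> times
        \<open>s\<close>.\<close>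
      have mean: "(\<Sum>l<n. \<Sum>j<d. w (x l) j * log 2 (s j)) = real n * b"
      proof -
        have "(\<Sum>l<n. \<Sum>j<d. w (x l) j * log 2 (s j)) = real n * (\<Sum>y<k. \<Sum>j<d. p y * w y j * log 2 (s j))"
          using pos[of "\<lambda>y. \<Sum>j<d. w y j * log 2 (s j)"] by (simp add: sum_distrib_left mult.assoc)
        also have "(\<Sum>y<k. \<Sum>j<d. p y * w y j * log 2 (s j)) = (\<Sum>j<d. \<Sum>y<k. p y * w y j * log 2 (s j))"
          by (rule sum.swap)
        also have "\<dots> = b" unfolding b_def by (intro sum.cong refl) (simp add: sw sum_distrib_right)
        finally show ?thesis .
      qed
      have sq: "(\<Sum>l<n. \<Sum>j<d. w (x l) j * (log 2 (s j))\<^sup>2) = real n * (\<Sum>j<d. s j * (log 2 (s j))\<^sup>2)"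
      proof -
        have "(\<Sum>l<n. \<Sum>j<d. w (x l) j * (log 2 (s j))\<^sup>2) = real n * (\<Sum>y<k. \<Sum>j<d. p y * w y j * (log 2 (s j))\<^sup>2)"
          using pos[of "\<lambda>y. \<Sum>j<d. w y j * (log 2 (s j))\<^sup>2"] by (simp add: sum_distrib_left mult.assoc)
        also have "(\<Sum>y<k. \<Sum>j<d. p y * w y j * (log 2 (s j))\<^sup>2) = (\<Sum>j<d. \<Sum>y<k. p y * w y j * (log 2 (s j))\<^sup>2)"
          by (rule sum.swap)
        also have "\<dots> = (\<Sum>j<d. s j * (log 2 (s j))\<^sup>2)" by (intro sum.cong refl) (simp add: sw sum_distrib_right)
        finally show ?thesis .
      qed
      have "(\<Sum>K\<in>?Q-S. \<Sum>J\<in>?Q. \<Lambda> J * (cmod (U J K))\<^sup>2) = (\<Sum>K\<in>?Q-S. ?W K)"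
        by (intro sum.cong refl) (simp add: W)
      \<comment> \<open>A tuple outside both \<open>S\<close> and \<open>X\<close> has vanishing
        eigenvalue product, hence weight 0 by \<open>W0\<close>.\<close>
      also have "\<dots> = (\<Sum>K\<in>(?Q-S) \<inter> X. ?W K)"
        by (rule sum.mono_neutral_right) (auto simp: W0 S_def X_def)
      also have "\<dots> \<le> (\<Sum>K\<in>X. ?W K)" by (rule sum_mono2) (auto simp: X_def Wnn)
      also have "\<dots> \<le> (\<Sum>l<n. \<Sum>j<d. w (x l) j * (log 2 (s j))\<^sup>2) / (real n * \<delta>)\<^sup>2"
        by (rule chebyshev_tuples[where g = "\<lambda>_ j. log 2 (s j)"])
          (use x w0 w1 n\<delta> in \<open>auto simp: mean X_def algebra_simps\<close>)
      also have "\<dots> \<le> (real n * (\<Sum>j<d. c0)) / (real n * \<delta>)\<^sup>2"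
        unfolding sq c0_def using s0 sle1 by (intro divide_right_mono mult_left_mono sum_mono mult_log_square_le) auto
      finally show ?thesis by (simp add: E_def)
    qed
    finally show ?thesis unfolding succ by simp
  qed
  have "(\<Sum>m\<in>Cl. Re (\<Sum>I\<in>?Q. \<Sum>J\<in>?Q. tensor_entry (\<lambda>l e f. \<theta> (enc m l) $$ (e,f)) I J * B m I J))
    \<le> (\<Sum>m\<in>Cl. 3 * E + 2 * r * (\<Sum>K\<in>S. Re (B' m K K)))"
    by (intro sum_mono single)
  also have "\<dots> = real (card Cl) * (3 * E) + 2 * r * (\<Sum>m\<in>Cl. \<Sum>K\<in>S. Re (B' m K K))"
    by (simp add: sum.distrib sum_distrib_left)
  \<comment> \<open>Extended to all messages, the tests sum to the identity and the trace over
    \<open>S\<close> becomes the number of elements of \<open>S\<close>. Each of them has eigenvalue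
    at least \<open>2 powr (real n * (b - \<delta>))\<close>, while all eigenvalues add up to
    1.\<close>
  also have "(\<Sum>m\<in>Cl. \<Sum>K\<in>S. Re (B' m K K)) \<le> 2 powr (- (real n * (b - \<delta>)))"
  proof -
    have "(\<Sum>m\<in>Cl. \<Sum>K\<in>S. Re (B' m K K)) \<le> (\<Sum>m<M. \<Sum>K\<in>S. Re (B' m K K))"
      using Cl diag0 by (intro sum_mono2 sum_nonneg) (auto simp: S_def)
    also have "\<dots> = (\<Sum>K\<in>S. Re (\<Sum>m<M. B' m K K))" unfolding Re_sum by (rule sum.swap)
    also have "\<dots> = (\<Sum>K\<in>S. 1)" by (intro sum.cong refl) (auto simp: one' S_def)
    also have "\<dots> \<le> (\<Sum>K\<in>S. tuple_prod (\<lambda>_. s) K * 2 powr (- (real n * (b - \<delta>))))"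
    proof (rule sum_mono)
      fix K assume K: "K \<in> S"
      have inv: "1 \<le> t * 2 powr (- y)" if "2 powr y \<le> t" for t y :: real
        using that by (simp add: powr_minus field_simps)
      from K have KQ: "K \<in> ?Q" and K0: "tuple_prod (\<lambda>_. s) K \<noteq> 0" by (auto simp: S_def)
      have "2 powr (real n * (b - \<delta>)) \<le> tuple_prod (\<lambda>_. s) K"
        using K tuple_prod_eq_powr[OF KQ _ K0] s0 by (simp add: S_def)
      then show "1 \<le> tuple_prod (\<lambda>_. s) K * 2 powr (- (real n * (b - \<delta>)))"
        by (rule inv)
    qed
    also have "\<dots> \<le> (\<Sum>K\<in>?Q. tuple_prod (\<lambda>_. s) K * 2 powr (- (real n * (b - \<delta>))))"
      by (rule sum_mono2) (auto simp: S_def intro!: mult_nonneg_nonneg tuple_prod_nonneg s0)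
    also have "\<dots> = 2 powr (- (real n * (b - \<delta>)))"
      using sum_tuple_prod[where n = n and d = d and c = "\<lambda>_. s"] s1 by (simp flip: sum_distrib_right)
    finally show ?thesis .
  qed
  also have "2 * r * 2 powr (- (real n * (b - \<delta>))) = 2 * 2 powr (real n * (a - b + 2 * \<delta>))"
    unfolding r_def by (simp add: algebra_simps flip: powr_add)
  also have "\<dots> \<le> 2 * 2 powr (real n * (C + 2 * \<delta>))"
    using ab by (simp add: mult_left_mono)
  also have "3 * E = 12 * real d / ((ln 2)\<^sup>2 * real n * \<delta>\<^sup>2)"
    using n by (simp add: E_def c0_def power2_eq_square)
  finally show ?thesis by (simp add: r_def)
qed

section \<open>Converse bound\<close>

text \<open>Over the classes the Chebyshev errors are weighted by class size and average to a single
  error term. The exponential term does not depend on the class size, so it is multiplied by the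
  number of types only and then divided by \<open>M\<close>.\<close>

lemma reading_protocol_bound:
  assumes F: "is_channel (dA * dE) dB F" and \<theta>: "\<forall>x<k. density dE (\<theta> x)"
    and prot: "reading_protocol (env_cell F \<theta>) k dA dB n M \<epsilon>" and n: "1 \<le> n"
    and C: "\<And>p. prob_dist k p \<Longrightarrow> mutual_info k dE (cq_state k dE p \<theta>) \<le> C" and \<delta>: "0 < \<delta>"
  shows "1 - \<epsilon> \<le> 12 * real dE / ((ln 2)\<^sup>2 * real n * \<delta>\<^sup>2)
    + 2 * (real n + 1) ^ k * 2 powr (real n * (C + 2 * \<delta>)) / real M"
proof -
  let ?Q = "tuples dE n"
  let ?E = "12 * real dE / ((ln 2)\<^sup>2 * real n * \<delta>\<^sup>2)"
  let ?G = "2 * 2 powr (real n * (C + 2 * \<delta>))"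
  from reading_protocol_kernels[OF F \<theta> prot n] obtain enc B where
    enc': "\<forall>m<M. \<forall>i<n. enc m i < k" and psd': "\<forall>m<M. psd_kernel ?Q (B m)"
    and one': "\<forall>I\<in>?Q. \<forall>J\<in>?Q. (\<Sum>m<M. B m I J) = (if I = J then 1 else 0)"
    and succ: "1 - \<epsilon> \<le> (1 / real M) * (\<Sum>m<M. Re (\<Sum>I\<in>?Q. \<Sum>J\<in>?Q.
       tensor_entry (\<lambda>l e f. \<theta> (enc m l) $$ (e,f)) I J * B m I J))"
    by (elim exE conjE) (rule that)
  have enc: "enc m i < k" if "m < M" "i < n" for m i using enc' that by blast
  have psd: "psd_kernel ?Q (B m)" if "m < M" for m using psd' that by blast
  have one: "(\<Sum>m<M. B m I J) = (if I = J then 1 else 0)" if "I \<in> ?Q" "J \<in> ?Q" for I J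
    using one' that by blast
  have M: "1 \<le> M" using prot by (simp add: reading_protocol_def)
  define S where "S m = Re (\<Sum>I\<in>?Q. \<Sum>J\<in>?Q. tensor_entry (\<lambda>l e f. \<theta> (enc m l) $$ (e,f)) I J * B m I J)" for m
  \<comment> \<open>Counts instead of frequencies, restricted to \<open>{..<k}\<close>, place the
    types in a finite function space with \<open>(n + 1) ^ k\<close> elements.\<close>
  define ty where "ty m = (\<lambda>x\<in>{..<k}. card {l. l < n \<and> enc m l = x})" for m
  let ?T = "PiE {..<k} (\<lambda>_. {..n})"
  have ty: "ty ` {..<M} \<subseteq> ?T"
  proof -
    have "card {l. l < n \<and> enc m l = x} \<le> card {..<n}" for m x by (intro card_mono) auto
    then show ?thesis by (auto simp: ty_def split: if_splits)
  qed
  have finT: "finite ?T" by (intro finite_PiE) auto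
  have cls: "(\<Sum>m\<in>{m\<in>{..<M}. ty m = t}. S m) \<le> real (card {m\<in>{..<M}. ty m = t}) * ?E + ?G" for t
  \<comment> \<open>Empty classes are split off, since their \<open>t\<close> need not have total
    count \<open>n\<close> and so need not define a distribution.\<close>
  proof (cases "{m\<in>{..<M}. ty m = t} = {}")
    case False
    then obtain m0 where m0: "m0 < M" "ty m0 = t" by auto
    define p where "p x = real (t x) / real n" for x
    have type: "p x = real (card {l. l < n \<and> enc m l = x}) / real n"
      if "m \<in> {m\<in>{..<M}. ty m = t}" "x < k" for m x
      using that by (auto simp: p_def ty_def)
    \<comment> \<open>The constant function 1 turns the identity for positions into the
      normalisation of \<open>p\<close>.\<close>
    have pos: "(\<Sum>l<n. (1::real)) = real n * (\<Sum>y<k. p y * 1)"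
      by (rule sum_over_positions[where x = "enc m0"]) (use enc m0 n type in auto)
    have p: "prob_dist k p" unfolding prob_dist_def using pos n by (simp add: p_def)
    show ?thesis unfolding S_def
      by (rule codeword_class_bound[OF \<theta> n enc psd one _ type p C[OF p] \<delta>]) auto
  next
    case True
    then show ?thesis unfolding True by simp
  qed
  have "(\<Sum>m<M. S m) = (\<Sum>t\<in>?T. \<Sum>m\<in>{m\<in>{..<M}. ty m = t}. S m)"
    by (rule sum.group[symmetric]) (use finT ty in auto)
  also have "\<dots> \<le> (\<Sum>t\<in>?T. real (card {m\<in>{..<M}. ty m = t}) * ?E + ?G)"
    by (rule sum_mono) (rule cls)
  also have "\<dots> = real (\<Sum>t\<in>?T. card {m\<in>{..<M}. ty m = t}) * ?E + real (card ?T) * ?G"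
    by (simp only: sum.distrib sum_constant of_nat_sum sum_distrib_right)
  also have "(\<Sum>t\<in>?T. card {m\<in>{..<M}. ty m = t}) = M"
    using sum.group[of "{..<M}" ?T ty "\<lambda>_. 1::nat"] finT ty by simp
  also have "real (card ?T) = (real n + 1) ^ k" by (simp add: card_PiE add.commute)
  finally have "(1 / real M) * (\<Sum>m<M. S m) \<le> (1 / real M) * (real M * ?E + (real n + 1) ^ k * ?G)"
    by (intro mult_left_mono) auto
  also have "\<dots> = ?E + 2 * (real n + 1) ^ k * 2 powr (real n * (C + 2 * \<delta>)) / real M"
    using M by (simp add: add_divide_distrib distrib_left)
  finally show ?thesis using succ unfolding S_def by linarith
qed

lemma achievable_rate_le:
  assumes F: "is_channel (dA * dE) dB F" and \<theta>: "\<forall>x<k. density dE (\<theta> x)"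
    and ach: "achievable_rate (env_cell F \<theta>) k dA dB R"
    and C: "\<And>p. prob_dist k p \<Longrightarrow> mutual_info k dE (cq_state k dE p \<theta>) \<le> C"
  shows "R \<le> C"
proof (rule ccontr)
  assume "\<not> R \<le> C"
  \<comment> \<open>With rate loss \<open>\<gamma>\<close> and typicality slack
    \<open>2 * \<gamma>\<close>, the exponent is \<open>C + 3 * \<gamma> - R\<close>, which this
    choice makes \<open>- \<gamma>\<close>.\<close>
  define \<gamma> where "\<gamma> = (R - C) / 4"
  have \<gamma>: "0 < \<gamma>" using \<open>\<not> R \<le> C\<close> by (simp add: \<gamma>_def)
  \<comment> \<open>Any fixed error strictly between 0 and 1 would do: above \<open>C\<close> the
    bound on the success probability tends to 0.\<close>
  obtain n0 where n0: "\<And>n. n \<ge> n0 \<Longrightarrow> \<exists>M. log 2 (real M) / real n \<ge> R - \<gamma> \<and>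
      reading_protocol (env_cell F \<theta>) k dA dB n M (1/2)"
    using ach[unfolded achievable_rate_def, rule_format, of "1/2" \<gamma>] \<gamma> by auto
  have bound: "1 / 2 \<le> 12 * real dE / ((ln 2)\<^sup>2 * real n * \<gamma>\<^sup>2) + 2 * (real n + 1) ^ k * 2 powr (- \<gamma> * real n)"
    if "n \<ge> max n0 1" for n
  proof -
    have n: "1 \<le> n" and "n0 \<le> n" using that by simp_all
    from n0[OF this(2)] obtain M where rate: "log 2 (real M) / real n \<ge> R - \<gamma>"
      and prot: "reading_protocol (env_cell F \<theta>) k dA dB n M (1/2)" by blast
    have M: "1 \<le> M" using prot by (simp add: reading_protocol_def)
    have "real n * (R - \<gamma>) \<le> log 2 (real M)" using rate n by (simp add: field_simps)
    then have "2 powr (real n * (R - \<gamma>)) \<le> real M" using M by (simp add: le_log_iff)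
    then have "2 powr (real n * (C + 2 * \<gamma>)) / real M \<le> 2 powr (real n * (C + 2 * \<gamma>)) / 2 powr (real n * (R - \<gamma>))"
      by (intro divide_left_mono) (use M in auto)
    also have "\<dots> = 2 powr (real n * (C + 2 * \<gamma>) - real n * (R - \<gamma>))" by (simp add: powr_diff)
    also have "real n * (C + 2 * \<gamma>) - real n * (R - \<gamma>) = - \<gamma> * real n"
      by (simp add: \<gamma>_def field_simps)
    finally have "2 * (real n + 1) ^ k * (2 powr (real n * (C + 2 * \<gamma>)) / real M) \<le> 2 * (real n + 1) ^ k * 2 powr (- \<gamma> * real n)"
      by (intro mult_left_mono) auto
    then show ?thesis using reading_protocol_bound[OF F \<theta> prot n C \<gamma>] by simp
  qed
  have "(\<lambda>n. 12 * real dE / ((ln 2)\<^sup>2 * real n * \<gamma>\<^sup>2)) \<longlonglongrightarrow> 0"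
    using \<gamma> by real_asymp
  moreover have "(\<lambda>n. 2 * (real n + 1) ^ k * 2 powr (- \<gamma> * real n)) \<longlonglongrightarrow> 0"
    using \<gamma> by real_asymp
  ultimately have "(\<lambda>n. 12 * real dE / ((ln 2)\<^sup>2 * real n * \<gamma>\<^sup>2) + 2 * (real n + 1) ^ k * 2 powr (- \<gamma> * real n)) \<longlonglongrightarrow> 0 + 0"
    by (rule tendsto_add)
  then have "(1 / 2 :: real) \<le> 0 + 0"
    by (rule LIMSEQ_le_const) (use bound in blast)
  then show False by simp
qed

theorem mainTheorem5:
  fixes F :: "complex mat \<Rightarrow> complex mat" and \<theta> :: "nat \<Rightarrow> complex mat"
    and k dA dB dE :: nat
  assumes "is_channel (dA * dE) dB F"
    and "\<forall>x<k. density dE (\<theta> x)"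
  shows "reading_capacity (env_cell F \<theta>) k dA dB
           \<le> (SUP p \<in> {p. prob_dist k p}. ereal (mutual_info k dE (cq_state k dE p \<theta>)))"
  unfolding reading_capacity_def
proof (rule Sup_least, clarify)
  fix R assume ach: "achievable_rate (env_cell F \<theta>) k dA dB R"
  let ?S = "SUP p \<in> {p. prob_dist k p}. ereal (mutual_info k dE (cq_state k dE p \<theta>))"
  show "ereal R \<le> ?S"
  proof (rule ccontr)
    assume "\<not> ereal R \<le> ?S"
    \<comment> \<open>A real number is inserted because the supremum lives in \<open>ereal\<close>;
      for \<open>k = 0\<close> there is no distribution and it equals
      \<open>-\<infinity>\<close>.\<close>
    then obtain C where C: "?S < ereal C" "C < R" using ereal_dense2[of ?S "ereal R"] by (auto simp: not_le)
    have "mutual_info k dE (cq_state k dE p \<theta>) \<le> C" if "prob_dist k p" for p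
    proof -
      have "ereal (mutual_info k dE (cq_state k dE p \<theta>)) \<le> ?S" using that by (intro SUP_upper) simp
      also note C(1)
      finally show ?thesis by simp
    qed
    then have "R \<le> C" by (rule achievable_rate_le[OF assms ach])
    then show False using C(2) by simp
  qed
qed

end
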